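(* Any commutative association scheme whose first eigenmatrix (for suitable orderings of its relations $S_0,\dots,S_4$ and primitive idempotents) is \[ \begin{bmatrix} 1&6&16&24&16\\ 1&3&-2&0&-2\\ 1&-1&2&-4&2\\ 1&-3&-2+6i&6&-2-6i\\ 1&-3&-2-6i&6&-2+6i \end{bmatrix} \] is unique up to isomorphism; in particular, it is isomorphic to the $4$-class fission scheme of the collinearity graph of the split Cayley generalised hexagon $H(2)$ obtained by splitting the distance-$3$ relation into two relations.
   Context: The first eigenmatrix $\mathsf{P}$ is defined by $\mathsf{A}_j=\sum_i\mathsf{P}_{ij}\mathsf{E}_i$ (rows indexed by primitive idempotents, columns by relations). The collinearity graph of the split Cayley generalised hexagon $H(2)$ (of order $(2,2)$, $63$ points) is a distance-regular graph of diameter $3$ with intersection array $\{6,4,4;1,1,3\}$, whose distance relations form a $3$-class association scheme; it admits a $4$-class (non-symmetric) fission scheme obtained by splitting the distance-$3$ relation into two mutually transposed relations, with automorphism group $\mathrm{PSU}(3,3)$, having the eigenmatrix above (columns: identity, distance $1$, one half of distance $3$, distance $2$, other half of distance $3$). *)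

theory Defs
  imports "HOL-Analysis.Analysis" "HOL-Library.Z2"
begin

section \<open>Commutative association schemes\<close>

locale assoc_scheme =
  fixes X :: "'a set" and d :: nat and S :: "nat \<Rightarrow> ('a \<times> 'a) set"
  assumes finite_points: "finite X"
    and nonempty: "i \<le> d \<Longrightarrow> S i \<noteq> {}"
    and disjoint: "i \<le> d \<Longrightarrow> j \<le> d \<Longrightarrow> i \<noteq> j \<Longrightarrow> S i \<inter> S j = {}"
    and cover: "(\<Union>i\<le>d. S i) = X \<times> X"
    and diagonal: "S 0 = Id_on X"
    and transpose: "i \<le> d \<Longrightarrow> \<exists>j\<le>d. S j = (S i)\<inverse>"
    and intersection_numbers:
      "i \<le> d \<Longrightarrow> j \<le> d \<Longrightarrow> k \<le> d \<Longrightarrow>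
        \<exists>p. \<forall>(x, y) \<in> S k. card {z \<in> X. (x, z) \<in> S i \<and> (z, y) \<in> S j} = p"

locale commutative_assoc_scheme = assoc_scheme +
  assumes commute:
    "i \<le> d \<Longrightarrow> j \<le> d \<Longrightarrow> x \<in> X \<Longrightarrow> y \<in> X \<Longrightarrow>
      card {z \<in> X. (x, z) \<in> S i \<and> (z, y) \<in> S j} = card {z \<in> X. (x, z) \<in> S j \<and> (z, y) \<in> S i}"

text \<open>Isomorphisms map the relations of one scheme onto those of the other, in any order.\<close>

definition isomorphic_schemes ::
  "nat \<Rightarrow> 'a set \<Rightarrow> (nat \<Rightarrow> ('a \<times> 'a) set) \<Rightarrow> 'b set \<Rightarrow> (nat \<Rightarrow> ('b \<times> 'b) set) \<Rightarrow> bool" where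
  "isomorphic_schemes d X S Y T \<longleftrightarrow>
    (\<exists>f. bij_betw f X Y \<and> (\<lambda>R. map_prod f f ` R) ` S ` {..d} = T ` {..d})"


section \<open>The Bose--Mesner algebra and eigenmatrices\<close>

text \<open>A complex matrix with rows and columns indexed by the finite set \<open>X\<close> is a function
  \<open>'a \<Rightarrow> 'a \<Rightarrow> complex\<close>; every matrix considered here vanishes outside \<open>X \<times> X\<close>, so that equality
  of matrices is equality of functions.\<close>

definition adjacency :: "('a \<times> 'a) set \<Rightarrow> 'a \<Rightarrow> 'a \<Rightarrow> complex" where
  "adjacency R = (\<lambda>x y. if (x, y) \<in> R then 1 else 0)"

definition mat_mult ::
  "'a set \<Rightarrow> ('a \<Rightarrow> 'a \<Rightarrow> complex) \<Rightarrow> ('a \<Rightarrow> 'a \<Rightarrow> complex) \<Rightarrow> 'a \<Rightarrow> 'a \<Rightarrow> complex" where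
  "mat_mult X A B = (\<lambda>x y. \<Sum>z\<in>X. A x z * B z y)"

definition bose_mesner :: "nat \<Rightarrow> (nat \<Rightarrow> ('a \<times> 'a) set) \<Rightarrow> ('a \<Rightarrow> 'a \<Rightarrow> complex) set" where
  "bose_mesner d S = {(\<lambda>x y. \<Sum>j\<le>d. c j * adjacency (S j) x y) | c. True}"

definition nonzero_idempotents ::
  "'a set \<Rightarrow> nat \<Rightarrow> (nat \<Rightarrow> ('a \<times> 'a) set) \<Rightarrow> ('a \<Rightarrow> 'a \<Rightarrow> complex) set" where
  "nonzero_idempotents X d S =
    {E \<in> bose_mesner d S. E \<noteq> (\<lambda>x y. 0) \<and> mat_mult X E E = E}"

definition primitive_idempotents ::
  "'a set \<Rightarrow> nat \<Rightarrow> (nat \<Rightarrow> ('a \<times> 'a) set) \<Rightarrow> ('a \<Rightarrow> 'a \<Rightarrow> complex) set" where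
  "primitive_idempotents X d S =
    {E \<in> nonzero_idempotents X d S.
      \<not> (\<exists>F\<in>nonzero_idempotents X d S. \<exists>G\<in>nonzero_idempotents X d S.
          mat_mult X F G = (\<lambda>x y. 0) \<and> mat_mult X G F = (\<lambda>x y. 0) \<and>
          E = (\<lambda>x y. F x y + G x y))}"

definition is_first_eigenmatrix ::
  "'a set \<Rightarrow> nat \<Rightarrow> (nat \<Rightarrow> ('a \<times> 'a) set) \<Rightarrow> (nat \<Rightarrow> nat \<Rightarrow> complex) \<Rightarrow> bool" where
  "is_first_eigenmatrix X d S P \<longleftrightarrow>
    (\<exists>E. bij_betw E {..d} (primitive_idempotents X d S) \<and>
      (\<forall>j\<le>d. adjacency (S j) = (\<lambda>x y. \<Sum>i\<le>d. P i j * E i x y)))"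

definition P_matrix :: "nat \<Rightarrow> nat \<Rightarrow> complex" where
  "P_matrix i j =
    [[1,  6, 16,          24, 16],
     [1,  3, -2,           0, -2],
     [1, -1,  2,          -4,  2],
     [1, -3, -2 + 6 * \<i>,   6, -2 - 6 * \<i>],
     [1, -3, -2 - 6 * \<i>,   6, -2 + 6 * \<i>]] ! i ! j"


section \<open>The split Cayley hexagon of order (2,2)\<close>

text \<open>This is Tits' coordinatisation. The points are those of the parabolic quadric
  \<open>X\<^sub>0X\<^sub>4 + X\<^sub>1X\<^sub>5 + X\<^sub>2X\<^sub>6 = X\<^sub>3\<^sup>2\<close> in \<open>PG(6,2)\<close>, and the lines are the lines on this quadric whose
  Grassmann coordinates satisfy six linear equations. Over the field with two elements a
  projective point has exactly one representing vector, which is nonzero, and the projective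
  line through \<open>x\<close> and \<open>y\<close> is \<open>{x, y, x + y}\<close>. The indices 0 to 6 are the elements of the type \<open>7\<close>.\<close>

definition H2_points :: "(bit ^ 7) set" where
  "H2_points = {x. x \<noteq> 0 \<and> x $ 0 * x $ 4 + x $ 1 * x $ 5 + x $ 2 * x $ 6 = (x $ 3)\<^sup>2}"

definition grassmann :: "bit ^ 7 \<Rightarrow> bit ^ 7 \<Rightarrow> 7 \<Rightarrow> 7 \<Rightarrow> bit" where
  "grassmann x y i j = x $ i * y $ j - x $ j * y $ i"

definition H2_lines :: "(bit ^ 7) set set" where
  "H2_lines = {{x, y, x + y} | x y.
    x \<noteq> y \<and> {x, y, x + y} \<subseteq> H2_points \<and>
    grassmann x y 1 2 = grassmann x y 3 4 \<and>
    grassmann x y 5 4 = grassmann x y 3 2 \<and>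
    grassmann x y 2 0 = grassmann x y 3 5 \<and>
    grassmann x y 6 5 = grassmann x y 3 0 \<and>
    grassmann x y 0 1 = grassmann x y 3 6 \<and>
    grassmann x y 4 6 = grassmann x y 3 1}"

definition H2_collinear :: "((bit ^ 7) \<times> (bit ^ 7)) set" where
  "H2_collinear = {(x, y). x \<noteq> y \<and> (\<exists>l\<in>H2_lines. x \<in> l \<and> y \<in> l)}"

definition distance_relation :: "'a set \<Rightarrow> ('a \<times> 'a) set \<Rightarrow> nat \<Rightarrow> ('a \<times> 'a) set" where
  "distance_relation V adj n =
    {(x, y) \<in> V \<times> V. (x, y) \<in> adj ^^ n \<and> (\<forall>m<n. (x, y) \<notin> adj ^^ m)}"

abbreviation H2_distance :: "nat \<Rightarrow> ((bit ^ 7) \<times> (bit ^ 7)) set" where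
  "H2_distance \<equiv> distance_relation H2_points H2_collinear"

text \<open>The 4-class fission: the distance-3 relation is split into \<open>S 2\<close> and its transpose \<open>S 4\<close>.
  The distance-2 relation is \<open>S 3\<close>, in accordance with the columns of \<^const>\<open>P_matrix\<close>.\<close>

definition H2_fission_scheme :: "(nat \<Rightarrow> ((bit ^ 7) \<times> (bit ^ 7)) set) \<Rightarrow> bool" where
  "H2_fission_scheme S \<longleftrightarrow>
    commutative_assoc_scheme H2_points 4 S \<and>
    S 0 = H2_distance 0 \<and> S 1 = H2_distance 1 \<and> S 3 = H2_distance 2 \<and>
    S 2 \<union> S 4 = H2_distance 3 \<and> S 4 = (S 2)\<inverse>"

end

theory Submission
  imports Defs
begin

text \<open>The eigenmatrix determines the intersection numbers. They make \<open>S\<^sub>1\<close> the collinearity relation of a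
  generalised hexagon of order \<open>(2,2)\<close> in which every pair of opposite points carries a sign (\<open>S\<^sub>2\<close> or
  \<open>S\<^sub>4\<close>), antisymmetric in the pair and alternating along lines. The signs force opposition, read
  modulo 2, to be a nondegenerate symplectic form for which the points are all nonzero vectors: for
  distinct points \<open>x, y\<close> there is a point \<open>z\<close> such that every point is opposite an even number of
  \<open>x, y, z\<close>. If \<open>x, y\<close> are at distance two this is a parity argument around their common neighbour; if
  they are opposite, \<open>z\<close> is the third point of the regulus that they span. The rules that locate
  collinear points relative to such sums generate all 63 lines from an ordinary hexagon, which gives
  coordinates and hence uniqueness; the signs are unique up to a global change because the graph of
  opposite pairs is connected. Conversely, in every such signed hexagon the square of the sign matrix
  is \<open>- 32I + 16S\<^sub>1 - 8S\<^sub>3 + 4(S\<^sub>2 + S\<^sub>4)\<close>, from which all intersection numbers and the eigenmatrix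
  follow. For \<open>H(2)\<close> the signs are given by an explicit polynomial, and a divisibility argument shows
  that the halves of the distance-3 relation in any fission are such signs.\<close>

section \<open>A standard adjacency relation on 63 codes\<close>

text \<open>Apart from transposes and valencies, the uniqueness proof takes from the eigenmatrix
  only the products of \<open>S 1\<close> with \<open>S 1\<close>, \<open>S 2\<close> and
  \<open>S 4\<close>. Distances alone cannot suffice: H(2) and its dual are generalised hexagons
  with the same parameters, and it is the signs that exclude the dual. Reversing all signs exchanges
  \<open>S 2\<close> and \<open>S 4\<close>, which \<open>isomorphic_schemes\<close> permits, so
  signs that are unique up to a global change give a unique scheme. For the converse, these three
  products and the row sums determine every product that involves \<open>S 1\<close> or
  \<open>S 3\<close>, but leave the four products of \<open>S 2\<close> and \<open>S 4\<close> one
  linear condition short; the square of the sign matrix supplies it. A fission of H(2) comes without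
  an eigenmatrix, so its behaviour along lines has to be found from the mere constancy of its
  intersection numbers. Here, and for the sign matrix, the decisive remark is that rotating an
  apartment exchanges two opposite points by an odd number of moves along lines
  (\<open>opp_swap\<close>).\<close>

unbundle bit_operations_syntax

text \<open>A code is a vector of \<open>GF(2)\<^sup>6\<close>, written as a number and relative to an apartment with vertices
  \<open>2\<^sup>0, \<dots>, 2\<^sup>5\<close>. The last two rules are the lemmas \<open>plane_sum\<close> and \<open>hyperbolic_sum\<close> below.\<close>

inductive std_adj :: "nat \<Rightarrow> nat \<Rightarrow> bool" where
  "std_adj 1 2" | "std_adj 2 4" | "std_adj 4 8" | "std_adj 8 16" | "std_adj 16 32" | "std_adj 32 1"
| std_sym: "std_adj k l \<Longrightarrow> std_adj l k"
| std_third: "std_adj k l \<Longrightarrow> std_adj k (k XOR l)"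
| std_plane: "std_adj k l \<Longrightarrow> std_adj k m \<Longrightarrow> l \<noteq> m \<Longrightarrow> m \<noteq> k XOR l \<Longrightarrow> std_adj k (l XOR m)"
| std_hyp: "std_adj k l \<Longrightarrow> std_adj l m \<Longrightarrow> std_adj m n \<Longrightarrow> k \<noteq> m \<Longrightarrow> m \<noteq> k XOR l \<Longrightarrow>
    l \<noteq> n \<Longrightarrow> n \<noteq> l XOR m \<Longrightarrow> std_adj (k XOR n) (l XOR m)"

lemmas std_base = std_adj.intros(1-6)

lemma std_line:
  assumes "std_adj k l"
  shows "std_adj k l" "std_adj l k" "std_adj k (k XOR l)" "std_adj (k XOR l) k"
    "std_adj l (k XOR l)" "std_adj (k XOR l) l"
  using assms std_sym[OF assms] std_third[OF assms] std_third[OF std_sym[OF assms]]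
  by (auto intro: std_sym simp: xor.commute)

text \<open>Row \<open>k - 1\<close> holds six codes adjacent to \<open>k\<close>. Only this lower
  bound is derived from the rules; \<open>A_iff_std_adj\<close> gets equality from the valency
  6.\<close>

definition std_nbrs :: "nat list list" where
  "std_nbrs = [[2, 3, 32, 33, 34, 35], [1, 3, 4, 5, 6, 7], [1, 2, 36, 37, 38, 39], [2, 6, 8, 10, 12, 14],
    [2, 7, 40, 42, 45, 47], [2, 4, 9, 11, 13, 15], [2, 5, 41, 43, 44, 46],
    [4, 12, 16, 20, 24, 28], [6, 15, 48, 54, 57, 63], [4, 14, 17, 21, 27, 31],
    [6, 13, 49, 55, 58, 60], [4, 8, 18, 22, 26, 30], [6, 11, 51, 53, 56, 62],
    [4, 10, 19, 23, 25, 29], [6, 9, 50, 52, 59, 61], [8, 24, 32, 40, 48, 56],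
    [10, 27, 32, 42, 49, 59], [12, 30, 33, 45, 51, 63], [14, 29, 33, 47, 50, 60],
    [8, 28, 34, 42, 54, 62], [10, 31, 34, 40, 55, 61], [12, 26, 35, 47, 53, 57],
    [14, 25, 35, 45, 52, 58], [8, 16, 36, 44, 52, 60], [14, 23, 39, 41, 48, 62],
    [12, 22, 39, 43, 49, 61], [10, 17, 36, 46, 53, 63], [8, 20, 38, 46, 50, 58],
    [14, 19, 37, 43, 54, 56], [12, 18, 37, 41, 55, 59], [10, 21, 38, 44, 51, 57],
    [1, 16, 17, 33, 48, 49], [1, 18, 19, 32, 50, 51], [1, 20, 21, 35, 54, 55],
    [1, 22, 23, 34, 52, 53], [3, 24, 27, 39, 60, 63], [3, 29, 30, 38, 56, 59],
    [3, 28, 31, 37, 57, 58], [3, 25, 26, 36, 61, 62], [5, 16, 21, 45, 56, 61],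
    [7, 25, 30, 46, 48, 55], [5, 17, 20, 47, 59, 62], [7, 26, 29, 44, 49, 54],
    [7, 24, 31, 43, 51, 52], [5, 18, 23, 40, 58, 63], [7, 27, 28, 41, 50, 53],
    [5, 19, 22, 42, 57, 60], [9, 16, 25, 32, 41, 57], [11, 17, 26, 32, 43, 58],
    [15, 19, 28, 33, 46, 61], [13, 18, 31, 33, 44, 62], [15, 23, 24, 35, 44, 59],
    [13, 22, 27, 35, 46, 56], [9, 20, 29, 34, 43, 63], [11, 21, 30, 34, 41, 60],
    [13, 16, 29, 37, 40, 53], [9, 22, 31, 38, 47, 48], [11, 23, 28, 38, 45, 49],
    [15, 17, 30, 37, 42, 52], [11, 19, 24, 36, 47, 55], [15, 21, 26, 39, 40, 50],
    [13, 20, 25, 39, 42, 51], [9, 18, 27, 36, 45, 54]]"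

lemma upt_1_64: "[1..<64] = [1, 2, 3, 4, 5, 6, 7, 8, 9, 10, 11, 12, 13, 14, 15, 16, 17, 18, 19, 20, 21, 22, 23, 24, 25,
    26, 27, 28, 29, 30, 31, 32, 33, 34, 35, 36, 37, 38, 39, 40, 41, 42, 43, 44, 45, 46, 47, 48,
    49, 50, 51, 52, 53, 54, 55, 56, 57, 58, 59, 60, 61, 62, 63 :: nat]"
  by (simp add: upt_conv_Cons)

lemma std_nbrs_adj: "list_all2 (\<lambda>k ls. list_all (std_adj k) ls) [1..<64] std_nbrs"
proof -
  \<comment> \<open>\<open>L0\<close> to \<open>L62\<close> are the 63 lines, each expanded into its
    six ordered pairs: the sides of the apartment, the third lines through its vertices
    (\<open>L6\<close> to \<open>L11\<close>), then lines found by further sums.\<close>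
  note L0 = std_line[OF std_base(1), simplified]
  note L1 = std_line[OF std_base(2), simplified]
  note L2 = std_line[OF std_base(3), simplified]
  note L3 = std_line[OF std_base(4), simplified]
  note L4 = std_line[OF std_base(5), simplified]
  note L5 = std_line[OF std_base(6), simplified]
  note L6 = std_line[OF std_plane[OF L0(1) L5(2)], simplified]
  note L7 = std_line[OF std_plane[OF L0(2) L1(1)], simplified]
  note L8 = std_line[OF std_plane[OF L1(2) L2(1)], simplified]
  note L9 = std_line[OF std_plane[OF L2(2) L3(1)], simplified]
  note L10 = std_line[OF std_plane[OF L3(2) L4(1)], simplified]
  note L11 = std_line[OF std_plane[OF L5(1) L4(2)], simplified]
  note L12 = std_line[OF std_hyp[OF L0(1) L1(1) L2(1)], simplified]
  note L13 = std_line[OF std_hyp[OF L0(1) L1(1) L8(1)], simplified]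
  note L14 = std_line[OF std_hyp[OF L5(2) L4(2) L3(2)], simplified]
  note L15 = std_line[OF std_hyp[OF L5(2) L4(2) L3(5)], simplified]
  note L16 = std_line[OF std_hyp[OF L0(2) L5(2) L4(2)], simplified]
  note L17 = std_line[OF std_hyp[OF L0(2) L5(2) L11(1)], simplified]
  note L18 = std_line[OF std_hyp[OF L1(1) L2(1) L3(1)], simplified]
  note L19 = std_line[OF std_hyp[OF L1(1) L2(1) L9(1)], simplified]
  note L20 = std_line[OF std_hyp[OF L1(2) L0(2) L5(2)], simplified]
  note L21 = std_line[OF std_hyp[OF L1(2) L0(2) L5(5)], simplified]
  note L22 = std_line[OF std_hyp[OF L2(1) L3(1) L4(1)], simplified]
  note L23 = std_line[OF std_hyp[OF L2(1) L3(1) L10(1)], simplified]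
  note L24 = std_line[OF std_plane[OF L12(1) L14(1)], simplified]
  note L25 = std_line[OF std_plane[OF L18(1) L16(1)], simplified]
  note L26 = std_line[OF std_plane[OF L20(1) L22(1)], simplified]
  note L27 = std_line[OF std_hyp[OF L0(3) L20(2) L22(1)], simplified]
  note L28 = std_line[OF std_hyp[OF L0(3) L20(2) L26(1)], simplified]
  note L29 = std_line[OF std_hyp[OF L5(5) L16(2) L18(1)], simplified]
  note L30 = std_line[OF std_hyp[OF L5(5) L16(2) L18(3)], simplified]
  note L31 = std_line[OF std_hyp[OF L1(3) L12(2) L14(1)], simplified]
  note L32 = std_line[OF std_hyp[OF L1(3) L12(2) L24(1)], simplified]
  note L33 = std_line[OF std_hyp[OF L20(2) L22(1) L3(4)], simplified]
  note L34 = std_line[OF std_hyp[OF L20(2) L22(1) L3(6)], simplified]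
  note L35 = std_line[OF std_hyp[OF L20(2) L26(3) L24(4)], simplified]
  note L36 = std_line[OF std_hyp[OF L20(2) L26(3) L25(6)], simplified]
  note L37 = std_line[OF std_hyp[OF L2(3) L18(2) L16(1)], simplified]
  note L38 = std_line[OF std_hyp[OF L2(3) L18(2) L25(1)], simplified]
  note L39 = std_line[OF std_hyp[OF L12(2) L14(1) L4(4)], simplified]
  note L40 = std_line[OF std_hyp[OF L12(2) L14(1) L15(2)], simplified]
  note L41 = std_line[OF std_hyp[OF L12(2) L24(3) L25(4)], simplified]
  note L42 = std_line[OF std_hyp[OF L12(2) L24(3) L26(6)], simplified]
  note L43 = std_line[OF std_hyp[OF L24(3) L25(4) L18(1)], simplified]
  note L44 = std_line[OF std_hyp[OF L24(3) L25(4) L18(3)], simplified]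
  note L45 = std_line[OF std_plane[OF L7(2) L43(3)], simplified]
  note L46 = std_line[OF std_plane[OF L8(2) L35(3)], simplified]
  note L47 = std_line[OF std_plane[OF L13(1) L33(3)], simplified]
  note L48 = std_line[OF std_plane[OF L13(6) L29(1)], simplified]
  note L49 = std_line[OF std_plane[OF L35(4) L11(2)], simplified]
  note L50 = std_line[OF std_plane[OF L17(1) L34(3)], simplified]
  note L51 = std_line[OF std_plane[OF L9(2) L41(3)], simplified]
  note L52 = std_line[OF std_plane[OF L19(1) L39(3)], simplified]
  note L53 = std_line[OF std_plane[OF L27(1) L15(3)], simplified]
  note L54 = std_line[OF std_plane[OF L19(6) L28(1)], simplified]
  note L55 = std_line[OF std_plane[OF L6(2) L41(4)], simplified]
  note L56 = std_line[OF std_plane[OF L21(1) L37(1)], simplified]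
  note L57 = std_line[OF std_plane[OF L21(6) L40(4)], simplified]
  note L58 = std_line[OF std_plane[OF L43(4) L10(2)], simplified]
  note L59 = std_line[OF std_plane[OF L15(4) L38(1)], simplified]
  note L60 = std_line[OF std_plane[OF L23(1) L30(4)], simplified]
  note L61 = std_line[OF std_plane[OF L31(1) L17(4)], simplified]
  note L62 = std_line[OF std_plane[OF L32(1) L23(6)], simplified]
  show ?thesis
    unfolding std_nbrs_def upt_1_64
    by (simp add: L0 L1 L2 L3 L4 L5 L6 L7 L8 L9 L10 L11 L12 L13 L14 L15 L16 L17 L18 L19 L20 L21 L22 L23 L24
      L25 L26 L27 L28 L29 L30 L31 L32 L33 L34 L35 L36 L37 L38 L39 L40 L41 L42 L43 L44 L45 L46 L47
      L48 L49 L50 L51 L52 L53 L54 L55 L56 L57 L58 L59 L60 L61 L62)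
qed

lemma std_nbrs_distinct: "list_all (\<lambda>ls. distinct ls \<and> length ls = 6 \<and> list_all (\<lambda>l. 0 < l \<and> l < 64) ls) std_nbrs"
  by (simp add: std_nbrs_def)

lemma std_card_nbr:
  assumes "0 < k" "k < 64"
  shows "\<exists>S. S \<subseteq> {l. std_adj k l \<and> 0 < l \<and> l < 64} \<and> finite S \<and> card S = 6"
proof -
  let ?ls = "std_nbrs ! (k - 1)"
  have len: "k - 1 < length std_nbrs" using assms by (simp add: std_nbrs_def)
  have "[1..<64] ! (k - 1) = k" using assms by simp
  then have "list_all (std_adj k) ?ls"
    using list_all2_nthD2[OF std_nbrs_adj len] by simp
  moreover have "distinct ?ls" "length ?ls = 6" "list_all (\<lambda>l. 0 < l \<and> l < 64) ?ls"
    using std_nbrs_distinct len by (auto simp: list_all_length)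
  ultimately show ?thesis
    using distinct_card[of ?ls] by (intro exI[of _ "set ?ls"]) (auto simp: list_all_iff)
qed

section \<open>Signed hexagons\<close>

text \<open>\<open>A\<close> and \<open>B\<close> stand for \<open>S\<^sub>1\<close> and \<open>S\<^sub>2\<close>. With \<open>C\<close> the transpose of \<open>B\<close> and \<open>D\<close> the remaining relation, the
  counts say \<open>A\<^sup>2 = 6I + A + D\<close>, \<open>AB = 2D + 3C\<close> and \<open>AC = 2D + 3B\<close>; the signs of the relation
  \<open>B \<union> C\<close> (opposition) therefore alternate along lines.\<close>

locale signed_hexagon =
  fixes X :: "'a set" and A B :: "'a \<Rightarrow> 'a \<Rightarrow> bool"
  assumes finite_X: "finite X"
    and card_X: "card X = 63"
    and A_in: "A x y \<Longrightarrow> x \<in> X"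
    and A_sym: "A x y \<Longrightarrow> A y x"
    and A_irrefl: "\<not> A x x"
    and B_in: "B x y \<Longrightarrow> x \<in> X \<and> y \<in> X"
    and B_antisym: "B x y \<Longrightarrow> \<not> B y x"
    and A_not_B: "A x y \<Longrightarrow> \<not> B x y"
    and AA: "x \<in> X \<Longrightarrow> y \<in> X \<Longrightarrow> card {z. A x z \<and> A z y} =
      (if x = y then 6 else if A x y then 1 else if B x y \<or> B y x then 0 else 1)"
    and AB: "x \<in> X \<Longrightarrow> y \<in> X \<Longrightarrow> card {z. A x z \<and> B z y} =
      (if x = y \<or> A x y \<or> B x y then 0 else if B y x then 3 else 2)"
    and AC: "x \<in> X \<Longrightarrow> y \<in> X \<Longrightarrow> card {z. A x z \<and> B y z} =
      (if x = y \<or> A x y \<or> B y x then 0 else if B x y then 3 else 2)"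
begin

definition opp :: "'a \<Rightarrow> 'a \<Rightarrow> bool" where
  "opp x y \<longleftrightarrow> B x y \<or> B y x"

text \<open>The third point of the line through collinear points, which is unique because
  \<open>AA\<close> gives them exactly one common neighbour.\<close>

definition th :: "'a \<Rightarrow> 'a \<Rightarrow> 'a" where
  "th x y = (THE z. A x z \<and> A z y)"

lemma A_in2: "A x y \<Longrightarrow> y \<in> X"
  using A_in A_sym by blast

lemma A_commute: "A x y \<longleftrightarrow> A y x"
  using A_sym by blast

lemma opp_sym: "opp x y \<longleftrightarrow> opp y x"
  by (auto simp: opp_def)

lemma opp_in: "opp x y \<Longrightarrow> x \<in> X" "opp x y \<Longrightarrow> y \<in> X"
  using B_in by (auto simp: opp_def)

lemma opp_irrefl: "\<not> opp x x"
  using B_antisym by (auto simp: opp_def)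

lemma A_not_opp: "A x y \<Longrightarrow> \<not> opp x y"
  using A_not_B A_sym by (auto simp: opp_def)

lemma finite_sub: "(\<And>z. P z \<Longrightarrow> z \<in> X) \<Longrightarrow> finite {z. P z}"
  by (rule finite_subset[OF _ finite_X]) auto

lemma finite_nbr: "finite {z. A x z \<and> P z}"
  by (rule finite_sub) (use A_in2 in blast)

lemma card_nbr: "x \<in> X \<Longrightarrow> card {z. A x z} = 6"
  using AA[of x x] A_sym by (metis (mono_tags, lifting) Collect_cong)

lemma common_unique:
  assumes "x \<noteq> y" "A x m" "A m y" "A x n" "A n y"
  shows "m = n"
proof -
  have "card {z. A x z \<and> A z y} \<le> 1"
    using AA[of x y] assms A_in A_in2 by (auto simp: split: if_splits)
  then show ?thesis
    using assms card_le_Suc0_iff_eq[OF finite_nbr[of x "\<lambda>z. A z y"]] by auto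
qed

lemma common_not_opp:
  assumes "A x m" "A m y"
  shows "\<not> opp x y"
proof
  assume o: "opp x y"
  then have "x \<noteq> y" "\<not> A x y" using opp_irrefl A_not_opp by auto
  then have "card {z. A x z \<and> A z y} = 0"
    using AA[of x y] o opp_in[OF o] by (auto simp: opp_def)
  then show False using assms finite_nbr[of x "\<lambda>z. A z y"] by auto
qed

lemma th_A:
  assumes "A x y"
  shows "A x (th x y)" "A (th x y) y" "A (th x y) x" "A y (th x y)"
proof -
  have "x \<noteq> y" using assms A_irrefl by auto
  then have "card {z. A x z \<and> A z y} = 1"
    using AA[of x y] assms A_in A_in2 by auto
  then obtain t where t: "A x t" "A t y" by (auto simp: card_1_singleton_iff)
  have "th x y = t" unfolding th_def
    by (rule the_equality) (use t common_unique[OF \<open>x \<noteq> y\<close>] in auto)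
  then show "A x (th x y)" "A (th x y) y" "A (th x y) x" "A y (th x y)"
    using t A_sym by auto
qed

lemma th_unique: "A x y \<Longrightarrow> A x z \<Longrightarrow> A z y \<Longrightarrow> th x y = z"
  using common_unique th_A A_irrefl by metis

lemma th_sym: "A x y \<Longrightarrow> th x y = th y x"
  by (meson A_sym th_A th_unique)

lemma th_th: "A x y \<Longrightarrow> th x (th x y) = y"
  by (meson A_sym th_A th_unique)

lemma th_neq: "A x y \<Longrightarrow> th x y \<noteq> x" "A x y \<Longrightarrow> th x y \<noteq> y"
  using th_A A_irrefl by metis+

text \<open>Distance two: for such pairs \<open>AA\<close> yields exactly one common neighbour
  (\<open>D_mid\<close>).\<close>

definition D :: "'a \<Rightarrow> 'a \<Rightarrow> bool" where
  "D x y \<longleftrightarrow> x \<in> X \<and> y \<in> X \<and> x \<noteq> y \<and> \<not> A x y \<and> \<not> opp x y"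

lemma D_sym: "D x y \<longleftrightarrow> D y x"
  using A_sym opp_sym by (auto simp: D_def)

lemma D_mid:
  assumes "D x y"
  obtains m where "A x m" "A m y"
proof -
  have "card {z. A x z \<and> A z y} = 1"
    using AA[of x y] assms by (auto simp: D_def opp_def)
  then show ?thesis using that by (auto simp: card_1_singleton_iff)
qed

lemma D_I: "A x m \<Longrightarrow> A m y \<Longrightarrow> x \<noteq> y \<Longrightarrow> \<not> A x y \<Longrightarrow> D x y"
  using common_not_opp A_in A_in2 by (auto simp: D_def)

lemma card_opp_nbr:
  assumes "x \<in> X" "y \<in> X"
  shows "card {z. A x z \<and> opp z y} = (if x = y \<or> A x y then 0 else if opp x y then 3 else 4)"
proof -
  have "{z. A x z \<and> opp z y} = {z. A x z \<and> B z y} \<union> {z. A x z \<and> B y z}"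
    by (auto simp: opp_def)
  moreover have "{z. A x z \<and> B z y} \<inter> {z. A x z \<and> B y z} = {}"
    using B_antisym by auto
  ultimately have "card {z. A x z \<and> opp z y} = card {z. A x z \<and> B z y} + card {z. A x z \<and> B y z}"
    by (simp add: card_Un_disjoint finite_nbr)
  then show ?thesis
    using AB[OF assms] AC[OF assms] B_antisym[of x y] by (auto simp: opp_def)
qed

lemma card_nonopp_nbr:
  assumes "x \<in> X" "y \<in> X"
  shows "card {z. A x z \<and> \<not> opp z y} = (if x = y \<or> A x y then 6 else if opp x y then 3 else 2)"
proof -
  have "{z. A x z} = {z. A x z \<and> opp z y} \<union> {z. A x z \<and> \<not> opp z y}" by auto
  then have "card {z. A x z} = card {z. A x z \<and> opp z y} + card {z. A x z \<and> \<not> opp z y}"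
    using card_Un_disjoint[of "{z. A x z \<and> opp z y}" "{z. A x z \<and> \<not> opp z y}"] finite_nbr
    by fastforce
  then show ?thesis using card_nbr[OF assms(1)] card_opp_nbr[OF assms] by auto
qed

text \<open>By \<open>card_nonopp_nbr\<close> only two neighbours of \<open>x\<close> are not
  opposite \<open>y\<close>, and \<open>m\<close> and \<open>th x m\<close> are two of that
  kind.\<close>

lemma D_nonopp:
  assumes "D x y" "A x m" "A m y" "A x z" "\<not> opp z y"
  shows "z = m \<or> z = th x m"
proof -
  have "card {z. A x z \<and> \<not> opp z y} = 2"
    using card_nonopp_nbr[of x y] assms(1) by (auto simp: D_def)
  moreover have "{m, th x m} \<subseteq> {z. A x z \<and> \<not> opp z y}"
    using assms th_A[OF assms(2)] common_not_opp A_not_opp by blast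
  moreover have "card {m, th x m} = 2" using th_neq[OF assms(2)] by auto
  ultimately have "{m, th x m} = {z. A x z \<and> \<not> opp z y}"
    by (intro card_subset_eq finite_nbr) auto
  then show ?thesis using assms by auto
qed

lemma D_opp:
  assumes "A x m" "A m y" "\<not> A x y" "x \<noteq> y" "A x z" "z \<noteq> m" "\<not> A z m"
  shows "opp z y"
  using D_nonopp[OF D_I[OF assms(1,2)] assms(1,2,5)] assms th_A(2) by metis

text \<open>This is \<open>D_opp\<close> at \<open>u\<close>, with \<open>a\<close> as common
  neighbour of \<open>u\<close> and \<open>c\<close>: the hexagon contains no ordinary pentagon.
  Most opposite pairs below are found in this way.\<close>

lemma path_opp:
  assumes "A c a" "A a u" "A u w" "c \<noteq> u" "\<not> A c u" "a \<noteq> w" "\<not> A a w"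
  shows "opp c w"
proof -
  have "opp w c"
    by (rule D_opp[of u a c w]) (use assms A_sym in metis)+
  then show ?thesis using opp_sym by simp
qed

section \<open>Opposition and signs along lines\<close>

lemma line_parity1:
  assumes "A x y" "\<not> opp y p" "\<not> opp (th x y) p"
  shows "\<not> opp x p"
proof
  assume o: "opp x p"
  have "y \<noteq> p" using o assms A_not_opp by auto
  moreover have "\<not> A y p" using o assms common_not_opp by auto
  ultimately have D: "D y p"
    using assms opp_in[OF o] A_in2 by (auto simp: D_def)
  then obtain m where m: "A y m" "A m p" by (rule D_mid)
  have x: "x = th y (th x y)"
    using th_unique[of y "th x y" x] assms(1) th_A[OF assms(1)] A_sym by auto
  consider "th x y = m" | "th x y = th y m"
    using D_nonopp[OF D m] assms th_A by blast
  then show False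
  proof cases
    case 1
    then have "A x m" using th_A(1)[OF assms(1)] by simp
    then show False using o m common_not_opp by auto
  next
    case 2
    then have "x = m" using x th_th[OF m(1)] by simp
    then show False using o m A_not_opp by auto
  qed
qed

text \<open>Additivity of opposition modulo 2 on lines. A single opposite point is excluded by
  \<open>line_parity1\<close>. If all three points were opposite \<open>p\<close>, the three
  neighbours of \<open>x\<close> not opposite \<open>p\<close> would have distinct third points
  among its three opposite neighbours, and \<open>y\<close> and \<open>th x y\<close> leave only one
  place for them.\<close>

lemma line_parity:
  assumes "A x y"
  shows "opp (th x y) p \<longleftrightarrow> (opp x p \<noteq> opp y p)"
proof -
  let ?z = "th x y"
  note T = th_A[OF assms]
  have a: "\<not> (opp x p \<and> opp y p \<and> opp ?z p)"
  proof
    assume o: "opp x p \<and> opp y p \<and> opp ?z p"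
    let ?N = "{v. A x v \<and> \<not> opp v p}" and ?O = "{v. A x v \<and> opp v p}"
    have p: "p \<in> X" "x \<in> X" using o opp_in by auto
    have ne: "x \<noteq> p" "\<not> A x p" using o opp_irrefl A_not_opp by auto
    have c: "card ?N = 3" "card ?O = 3"
      using card_nonopp_nbr[OF p(2,1)] card_opp_nbr[OF p(2,1)] o ne by auto
    have sub: "th x ` ?N \<subseteq> ?O - {y, ?z}"
    proof
      fix t assume "t \<in> th x ` ?N"
      then obtain v where v: "A x v" "\<not> opp v p" "t = th x v" by auto
      have "opp t p" using line_parity1[OF v(1,2)] v o by auto
      moreover have "A x t" using th_A(1)[OF v(1)] v(3) by simp
      moreover have vt: "v = th x t" using th_th[OF v(1)] v(3) by simp
      moreover have "t \<noteq> y" using vt v(2) o by auto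
      moreover have "t \<noteq> ?z" using vt v(2) o th_th[OF assms] by auto
      ultimately show "t \<in> ?O - {y, ?z}" by blast
    qed
    have "inj_on (th x) ?N"
      by (rule inj_on_inverseI[where g = "th x"]) (use th_th in auto)
    then have "3 = card (th x ` ?N)" using c card_image by metis
    also have "\<dots> \<le> card (?O - {y, ?z})"
      by (rule card_mono[OF _ sub]) (use finite_nbr in auto)
    also have "card (?O - {y, ?z}) = card ?O - card {y, ?z}"
      by (rule card_Diff_subset) (use o assms T in auto)
    finally show False using c th_neq[OF assms] by auto
  qed
  have "\<not> opp y p \<and> \<not> opp ?z p \<longrightarrow> \<not> opp x p"
    using line_parity1[OF assms] by auto
  moreover have "\<not> opp x p \<and> \<not> opp ?z p \<longrightarrow> \<not> opp y p"
    using line_parity1[OF A_sym[OF assms]] th_sym[OF assms] by auto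
  moreover have "\<not> opp y p \<and> \<not> opp x p \<longrightarrow> \<not> opp ?z p"
    using line_parity1[of ?z y p] T th_unique[of ?z y x] assms A_sym by auto
  ultimately show ?thesis using a by blast
qed

lemma line_parity': "A x y \<Longrightarrow> opp p (th x y) \<longleftrightarrow> (opp p x \<noteq> opp p y)"
  using line_parity opp_sym by metis

text \<open>If \<open>B x y\<close>, the count \<open>AB\<close> is zero; if \<open>B y x\<close>,
  the count \<open>AC\<close> is zero. So no neighbour of \<open>x\<close> has the same sign towards
  \<open>y\<close> as \<open>x\<close>.\<close>

lemma flip:
  assumes "A x z" "opp x y" "opp z y"
  shows "B z y \<longleftrightarrow> \<not> B x y"
proof -
  have in': "x \<in> X" "y \<in> X" using opp_in assms by auto
  show ?thesis
  proof (cases "B x y")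
    case True
    then have "card {z. A x z \<and> B z y} = 0" using AB[OF in'] by auto
    then show ?thesis using True assms finite_nbr[of x "\<lambda>z. B z y"] by auto
  next
    case False
    then have "B y x" using assms by (auto simp: opp_def)
    then have "card {z. A x z \<and> B y z} = 0" using AC[OF in'] by auto
    then show ?thesis using False assms finite_nbr[of x "\<lambda>z. B y z"] by (auto simp: opp_def)
  qed
qed

lemma B_swap: "opp x y \<Longrightarrow> B y x \<longleftrightarrow> \<not> B x y"
  using B_antisym by (auto simp: opp_def)

lemma flip':
  assumes "A y z" "opp x y" "opp x z"
  shows "B x z \<longleftrightarrow> \<not> B x y"
  using flip[of y z x] B_swap assms opp_sym by metis

lemma card_nbr_gt:
  assumes "c \<in> X" "finite S" "card S < 6"
  obtains f where "A c f" "f \<notin> S"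
proof -
  have "\<not> {v. A c v} \<subseteq> S"
    using card_mono[OF assms(2), of "{v. A c v}"] card_nbr[OF assms(1)] assms(3) by auto
  then show ?thesis using that by blast
qed

lemma on_line: "A c a \<Longrightarrow> A c f \<Longrightarrow> A a f \<longleftrightarrow> f = th c a"
  using th_unique[of c a f] A_sym th_A by metis

text \<open>The six neighbours of \<open>c\<close> fall into pairs under \<open>th c\<close>, so
  exactly three lines pass through a point.\<close>

lemma three_lines:
  assumes "A c a" "A c b" "a \<noteq> b" "\<not> A a b"
  obtains f where "A c f" "f \<noteq> a" "f \<noteq> b" "\<not> A a f" "\<not> A b f"
    "\<And>v. A c v \<Longrightarrow> v \<in> {a, th c a, b, th c b, f, th c f}"
proof -
  have "card {a, th c a, b, th c b} < 6"
    by (simp add: card_insert_if)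
  then obtain f where f: "A c f" "f \<notin> {a, th c a, b, th c b}"
    using card_nbr_gt[OF A_in[OF assms(1)]] by (metis finite.emptyI finite.insertI)
  have nA: "\<not> A a f" "\<not> A b f"
    using f on_line[of c a f] on_line[of c b f] assms by auto
  have n: "th c x = th c y \<longleftrightarrow> x = y" "th c x = y \<longleftrightarrow> x = th c y" "th c x \<noteq> x"
    if "A c x" "A c y" for x y using that th_th th_neq by metis+
  have "b \<noteq> th c a" using on_line[OF assms(1,2)] assms(4) by simp
  moreover have "a \<noteq> th c b" using \<open>b \<noteq> th c a\<close> th_th[OF assms(2)] by auto
  moreover have "th c f \<noteq> a" "th c f \<noteq> b" "th c f \<noteq> th c a" "th c f \<noteq> th c b" "th c a \<noteq> th c b"
    using n f assms(1-3) by (metis insertI1 insertI2)+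
  ultimately have "distinct [a, th c a, b, th c b, f, th c f]"
    using f(2) n(3)[OF f(1) f(1)] n(3)[OF assms(1,1)] n(3)[OF assms(2,2)] assms(3) by auto
  from distinct_card[OF this] have "card {a, th c a, b, th c b, f, th c f} = 6"
    by simp
  moreover have "{a, th c a, b, th c b, f, th c f} \<subseteq> {v. A c v}"
    using f assms th_A(1) by blast
  ultimately have "{a, th c a, b, th c b, f, th c f} = {v. A c v}"
    using card_nbr[OF A_in[OF assms(1)]] finite_nbr[of c "\<lambda>_. True"]
    by (intro card_subset_eq) auto
  then show ?thesis using f nA that[of f] by blast
qed

lemma other_line:
  assumes "A c a"
  obtains b where "A c b" "a \<noteq> b" "\<not> A a b"
proof -
  have "card {a, th c a} < 6" by (simp add: card_insert_if)
  then obtain b where "A c b" "b \<notin> {a, th c a}"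
    using card_nbr_gt[OF A_in[OF assms(1)]] by (metis finite.emptyI finite.insertI)
  then show ?thesis using that[of b] on_line[of c a b] assms by auto
qed

lemma opp_path:
  assumes "opp c w" "A c a" "\<not> opp a w"
  obtains u where "A a u" "A u w" "c \<noteq> u" "\<not> A c u" "a \<noteq> w" "\<not> A a w" "opp a w = False"
proof -
  have "a \<noteq> w" "\<not> A a w" using assms A_not_opp common_not_opp by auto
  then have "D a w" using assms opp_in A_in2 by (auto simp: D_def)
  then obtain u where u: "A a u" "A u w" by (rule D_mid)
  then have "c \<noteq> u" "\<not> A c u" using assms A_not_opp common_not_opp by auto
  then show ?thesis using that u \<open>a \<noteq> w\<close> \<open>\<not> A a w\<close> assms by blast
qed

lemma opp_nbr_nonopp:
  assumes "opp c w" "A c b"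
  obtains e where "A c e" "e = b \<or> e = th c b" "\<not> opp e w" "opp (th c e) w"
proof (cases "opp b w")
  case True
  then have "\<not> opp (th c b) w" using line_parity[OF assms(2)] assms by auto
  then show ?thesis using that[of "th c b"] True th_th[OF assms(2)] th_A(1)[OF assms(2)] by auto
next
  case False
  then have "opp (th c b) w" using line_parity[OF assms(2)] assms by auto
  then show ?thesis using that[of b] False assms by auto
qed

text \<open>The properties of the signs separated from the counts, so that
  \<open>sign_transfer\<close> serves both \<open>B\<close> and a competing sign in
  \<open>sign_unique\<close>.\<close>

definition sign_function :: "('a \<Rightarrow> 'a \<Rightarrow> bool) \<Rightarrow> bool" where
  "sign_function C \<longleftrightarrow> (\<forall>x y. opp x y \<longrightarrow> C y x = (\<not> C x y)) \<and>
    (\<forall>x y z. A x z \<longrightarrow> opp x y \<longrightarrow> opp z y \<longrightarrow> C z y = (\<not> C x y))"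

lemma sign_function_flip: "sign_function C \<Longrightarrow> A x z \<Longrightarrow> opp x y \<Longrightarrow> opp z y \<Longrightarrow> C z y \<longleftrightarrow> \<not> C x y"
  unfolding sign_function_def by blast

lemma sign_function_flip':
  assumes "sign_function C" "A y z" "opp x y" "opp x z"
  shows "C x z \<longleftrightarrow> \<not> C x y"
  using assms opp_sym unfolding sign_function_def by blast

lemma sign_function_B: "sign_function B"
  unfolding sign_function_def using B_swap flip by blast

text \<open>If \<open>p\<close> is opposite \<open>b\<close>, two flips lead from
  \<open>C p x\<close> over \<open>C p b\<close> to \<open>C u b\<close>. Otherwise \<open>b\<close>
  and \<open>x\<close> are both opposite the third point of the line \<open>p u\<close>, and the way
  through that point takes three flips. So the parity of the number of flips records whether
  \<open>p\<close> is opposite \<open>b\<close>.\<close>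

lemma sign_transfer:
  assumes C: "sign_function C"
    and "A p u" "A u m" "A m x" "A x b" "opp p x" "b \<noteq> m" "\<not> A m b"
  shows "C u b \<longleftrightarrow> (C p x \<longleftrightarrow> opp p b)"
proof -
  note ass = assms(2-)
  have ux: "u \<noteq> x" "\<not> A u x" using ass A_not_opp common_not_opp by auto
  have ub: "opp u b" by (rule path_opp[of u m x b]) (use ass ux in auto)
  show ?thesis
  proof (cases "opp p b")
    case True
    then have "C p b \<longleftrightarrow> \<not> C p x" using sign_function_flip'[OF C ass(4)] ass by auto
    moreover have "C u b \<longleftrightarrow> \<not> C p b" using sign_function_flip[OF C ass(1) True ub] .
    ultimately show ?thesis using True by auto
  next
    case False
    let ?q = "th p u"
    have q: "opp ?q b" "opp ?q x"
      using line_parity[OF ass(1)] False ub ass A_not_opp common_not_opp by blast+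
    have "C ?q b \<longleftrightarrow> \<not> C u b"
      using sign_function_flip[OF C th_A(4)[OF ass(1)] ub q(1)] .
    moreover have "C ?q b \<longleftrightarrow> \<not> C ?q x" using sign_function_flip'[OF C ass(4) q(2) q(1)] .
    moreover have "C ?q x \<longleftrightarrow> \<not> C p x" using sign_function_flip[OF C th_A(1)[OF ass(1)] ass(5) q(2)] .
    ultimately show ?thesis using False by auto
  qed
qed

end

section \<open>Connectivity of the points opposite a given point, and sums in a plane\<close>

context signed_hexagon begin

lemma off_line: "A m u \<Longrightarrow> A m v \<Longrightarrow> A u v \<Longrightarrow> A x m \<Longrightarrow> x \<noteq> u \<Longrightarrow> \<not> A x v"
  using common_unique A_irrefl A_sym by metis

text \<open>In the hypothesis \<open>near\<close>, the points \<open>p\<close> and \<open>q\<close> are collinear with different points of the line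
  \<open>m u v\<close>, whose point nearest to \<open>x\<close> is \<open>m\<close>.\<close>

lemma connected_opposite:
  assumes adj: "\<And>p q. opp p x \<Longrightarrow> opp q x \<Longrightarrow> A p q \<Longrightarrow> Q p = Q q"
    and near: "\<And>p q m u v. A x m \<Longrightarrow> A m u \<Longrightarrow> A m v \<Longrightarrow> A u v \<Longrightarrow> x \<noteq> u \<Longrightarrow> \<not> A x u \<Longrightarrow>
      A p u \<Longrightarrow> A q v \<Longrightarrow> opp p x \<Longrightarrow> opp q x \<Longrightarrow> Q p = Q q"
    and pq: "opp p x" "opp q x"
  shows "Q p = Q q"
proof -
  have same_line: "Q p = Q q" if "A x m" "A m u" "A m v" "u = v \<or> A u v"
    "A p u" "A q v" "opp p x" "opp q x" for p q m u v
  proof -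
    have u: "x \<noteq> u" "\<not> A x u" using that A_not_opp common_not_opp A_sym by metis+
    show ?thesis
    proof (cases "u = v")
      case True
      \<comment> \<open>Detour through a point \<open>r\<close> beyond the third point of the line
        \<open>m u\<close>, so that \<open>near\<close> applies twice.\<close>
      have t: "A m (th m u)" "A u (th m u)" using th_A[OF that(2)] by auto
      obtain r where r: "A (th m u) r" "m \<noteq> r" "\<not> A m r"
        using other_line[OF A_sym[OF t(1)]] by blast
      have "\<not> A x (th m u)" using off_line[OF that(2) t that(1) u(1)] .
      moreover have "x \<noteq> th m u" using u t A_sym by metis
      ultimately have "opp r x"
        using path_opp[of x m "th m u" r] that t r opp_sym by auto
      then have "Q p = Q r" "Q q = Q r"
        using near[OF that(1,2) t(1,2) u _ A_sym[OF r(1)]] that True by auto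
      then show ?thesis by simp
    next
      case False
      then show ?thesis using near[OF that(1-3) _ u] that by auto
    qed
  qed
  have same_point: "Q p = Q q" if m: "A x m" and p: "opp p x" "\<not> opp p m" and q: "opp q x" "\<not> opp q m"
    for p q m
  proof -
    have mp: "\<not> opp m p" "\<not> opp m q" "opp x p" "opp x q" using p q opp_sym by auto
    obtain u where u: "A m u" "A u p" "x \<noteq> u" "\<not> A x u" "m \<noteq> p" "\<not> A m p"
      using opp_path[OF mp(3) m mp(1)] by metis
    obtain v where v: "A m v" "A v q" "x \<noteq> v" "\<not> A x v"
      using opp_path[OF mp(4) m mp(2)] by metis
    \<comment> \<open>Leave \<open>p\<close> on a line other than \<open>p u\<close> for the point
      \<open>?p\<close> that is still opposite \<open>x\<close> but now also opposite
      \<open>m\<close>. Some point \<open>n\<close> of the line \<open>m v\<close> is at distance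
      two from \<open>?p\<close>, and the middle point \<open>g\<close> of this path can be compared
      with \<open>q\<close> by \<open>same_line\<close>.\<close>
    obtain b where b: "A p b" "u \<noteq> b" "\<not> A u b" using other_line[OF A_sym[OF u(2)]] by blast
    obtain e where e: "A p e" "e = b \<or> e = th p b" "\<not> opp e x" "opp (th p e) x"
      using opp_nbr_nonopp[OF p(1) b(1)] by metis
    let ?p = "th p e"
    have pe: "A p ?p" using th_A[OF e(1)] by simp
    have "?p = b \<or> ?p = th p b" using e th_th b by metis
    then have pu: "?p \<noteq> u" "\<not> A ?p u"
      using b th_A[OF b(1)] on_line[OF b(1) A_sym[OF u(2)]] on_line[OF th_A(1)[OF b(1)] A_sym[OF u(2)]]
        th_th[OF b(1)] A_sym by metis+
    have pm: "opp ?p m"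
      by (rule D_opp[of p u m ?p]) (use u pe pu A_sym in metis)+
    obtain n where n: "A m n" "n = v \<or> n = th m v" "\<not> opp n ?p"
    proof (cases "opp v ?p")
      case True
      then have "\<not> opp (th m v) ?p" using line_parity[OF v(1)] pm opp_sym by auto
      then show ?thesis using that th_A(1)[OF v(1)] by blast
    next
      case False
      then show ?thesis using that v(1) by blast
    qed
    have "x \<noteq> n"
      using n(2) v(3,4) th_A(4)[OF v(1)] th_A(1)[OF v(1)] A_sym by metis
    have "\<not> A x n"
      using n(2) v(4) off_line[OF v(1) th_A(1)[OF v(1)] th_A(4)[OF v(1)] m v(3)] by auto
    have "n \<noteq> ?p" "\<not> A n ?p" using n(1) pm A_not_opp common_not_opp opp_sym by metis+
    then have "D n ?p" using n opp_in[OF pm] A_in2 by (auto simp: D_def)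
    then obtain g where g: "A n g" "A g ?p" by (rule D_mid)
    have "m \<noteq> g" "\<not> A m g" using g pm A_not_opp common_not_opp opp_sym by metis+
    then have gx: "opp g x"
      using path_opp[OF m n(1) g(1) \<open>x \<noteq> n\<close> \<open>\<not> A x n\<close>] opp_sym by auto
    have "Q p = Q ?p" using adj[OF p(1) e(4) pe] .
    also have "\<dots> = Q g" using adj[OF e(4) gx A_sym[OF g(2)]] .
    also have "\<dots> = Q q"
    proof (rule same_line[OF m n(1) v(1) _ A_sym[OF g(1)] A_sym[OF v(2)] gx q(1)])
      show "n = v \<or> A n v" using n(2) th_A[OF v(1)] by auto
    qed
    finally show ?thesis .
  qed
  have xp: "opp x p" using pq opp_sym by auto
  obtain m0 where "A x m0"
    using card_nbr_gt[OF opp_in(1)[OF xp], of "{}"] by auto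
  then obtain m where m: "A x m" "\<not> opp m p"
    using opp_nbr_nonopp[OF xp] by metis
  show ?thesis
  proof (cases "opp m q")
    case False
    then show ?thesis using same_point[OF m(1) pq(1) _ pq(2)] m opp_sym by auto
  next
    case True
    \<comment> \<open>Here \<open>m\<close> is near \<open>p\<close> but opposite \<open>q\<close>.
      Take \<open>b\<close> near \<open>q\<close> on another line through \<open>x\<close>; if
      \<open>p\<close> is opposite \<open>b\<close>, the third point of the line \<open>p u\<close>
      replaces it, since it stays opposite \<open>x\<close> but is not opposite
      \<open>b\<close>.\<close>
    obtain b0 where b0: "A x b0" "m \<noteq> b0" "\<not> A m b0" using other_line[OF m(1)] by blast
    obtain b where b: "A x b" "b = b0 \<or> b = th x b0" "\<not> opp b q" "opp (th x b) q"
      using opp_nbr_nonopp[OF _ b0(1)] pq opp_sym by metis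
    have bm: "b \<noteq> m" "\<not> A m b"
      using b b0 on_line[OF b0(1) m(1)] on_line[OF th_A(1)[OF b0(1)] m(1)] th_th[OF b0(1)] th_A[OF b0(1)] A_sym
      by metis+
    obtain r where r: "opp r x" "\<not> opp r b" "Q p = Q r"
    proof (cases "opp p b")
      case False
      then show ?thesis using that pq by blast
    next
      case True
      obtain u where u: "A m u" "A u p" "x \<noteq> u" "\<not> A x u"
        using opp_path[OF xp m] by metis
      have "A x b" by fact
      have ub: "opp u b"
        using path_opp[of u m x b] u m b bm A_sym by metis
      let ?r = "th p u"
      have r: "A p ?r" "opp ?r x" "\<not> opp ?r b"
        using line_parity[OF A_sym[OF u(2)]] th_A[OF A_sym[OF u(2)]] pq True ub
          common_not_opp[OF A_sym[OF u(1)] A_sym[OF m(1)]] by auto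
      then show ?thesis using that adj[OF pq(1) r(2) r(1)] by blast
    qed
    have "\<not> opp q b" using b opp_sym by auto
    then show ?thesis using same_point[OF b(1) r(1,2) pq(2)] r by auto
  qed
qed

lemma nonopp_line:
  assumes "A c m" "A m p" "c \<noteq> p" "\<not> A c p" "A c y"
  shows "opp p y \<longleftrightarrow> y \<noteq> m \<and> \<not> A y m"
  using assms D_opp[of c m p y] common_not_opp A_not_opp A_sym opp_sym by metis

text \<open>For \<open>f\<close> on the third line through \<open>c\<close>, the parity of the number of points among \<open>a, b, f\<close> that are
  opposite \<open>p\<close> is the same for all \<open>p\<close> opposite \<open>c\<close>, by \<open>connected_opposite\<close>. The signs are needed for its
  hypothesis \<open>near\<close>: in the dual of \<open>H(2)\<close>, which admits no signs, the lemma is false.\<close>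

lemma plane_sum:
  assumes "A c a" "A c b" "a \<noteq> b" "\<not> A a b"
  obtains f where "A c f" "f \<noteq> a" "f \<noteq> b" "\<not> A a f" "\<not> A b f" "\<And>p. opp p f \<longleftrightarrow> opp p a \<noteq> opp p b"
proof -
  obtain f where f: "A c f" "f \<noteq> a" "f \<noteq> b" "\<not> A a f" "\<not> A b f"
    and all: "\<And>v. A c v \<Longrightarrow> v \<in> {a, th c a, b, th c b, f, th c f}"
    using three_lines[OF assms] by blast
  have lines: "(y \<noteq> m \<and> \<not> A y m) \<longleftrightarrow> m \<notin> {y, th c y}" if "A c y" "A c m" for y m
    using on_line[OF that] by auto
  have n: "th c x \<noteq> x" "th c x = y \<longleftrightarrow> x = th c y" if "A c x" "A c y" for x y
    using that th_th th_neq by metis+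
  have dis: "a \<notin> {b, th c b, f, th c f}" "th c a \<notin> {b, th c b, f, th c f}"
    "b \<notin> {a, th c a, f, th c f}" "th c b \<notin> {a, th c a, f, th c f}"
    "f \<notin> {b, th c b, a, th c a}" "th c f \<notin> {b, th c b, a, th c a}"
    using assms f lines n th_A th_th by (metis insertE singletonD insertCI A_sym)+
  have cases: "m \<in> {a, th c a} \<and> m \<notin> {b, th c b} \<and> m \<notin> {f, th c f} \<or>
      m \<in> {b, th c b} \<and> m \<notin> {a, th c a} \<and> m \<notin> {f, th c f} \<or>
      m \<in> {f, th c f} \<and> m \<notin> {a, th c a} \<and> m \<notin> {b, th c b}" if "A c m" for m
    using all[OF that] dis by (elim insertE) simp_all
  \<comment> \<open>At distance two from \<open>c\<close>, the point \<open>p\<close> is opposite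
    exactly the points on the two lines through \<open>c\<close> that avoid the common neighbour:
    two of \<open>a, b, f\<close>. If \<open>p\<close> is closer, it is opposite none of
    them.\<close>
  have non: "opp p f \<longleftrightarrow> opp p a \<noteq> opp p b" if "\<not> opp p c" for p
  proof (cases "p \<in> X \<and> p \<noteq> c \<and> \<not> A p c")
    case True
    then have "D c p" using that A_in[OF f(1)] A_sym opp_sym by (auto simp: D_def)
    then obtain m where m: "A c m" "A m p" by (rule D_mid)
    have "opp p y \<longleftrightarrow> m \<notin> {y, th c y}" if "A c y" for y
      using nonopp_line[OF m _ _ that] lines[OF that m(1)] True A_sym by metis
    then show ?thesis using cases[OF m(1)] assms(1,2) f(1) by blast
  next
    case False
    then have "\<not> opp p y" if "A c y" for y
      using that opp_in A_not_opp[of c y] common_not_opp[of p c y] by metis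
    then show ?thesis using assms(1,2) f(1) by blast
  qed
  have th_f: "opp p (th c f) \<longleftrightarrow> \<not> opp p f" if "opp p c" for p
    using line_parity'[OF f(1)] that by auto
  let ?Q = "\<lambda>p. opp p f \<longleftrightarrow> opp p a \<noteq> opp p b"
  have const: "?Q p = ?Q q" if "opp p c" "opp q c" for p q
  proof (rule connected_opposite[OF _ _ that])
    fix p q assume o: "opp p c" "opp q c" "A p q"
    \<comment> \<open>The third point of the line \<open>p q\<close> has the right parity by
      \<open>non\<close>, and line parity carries the comparison over to \<open>p\<close> and
      \<open>q\<close>.\<close>
    have "\<not> opp (th p q) c" using line_parity[OF o(3)] o by simp
    from non[OF this] show "?Q p = ?Q q" using line_parity[OF o(3)] by auto
  next
    fix p q m u v
    assume h: "A c m" "A m u" "A m v" "A u v" "c \<noteq> u" "\<not> A c u" "A p u" "A q v" "opp p c" "opp q c"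
    \<comment> \<open>From \<open>p\<close> to \<open>q\<close>, opposition to \<open>y\<close>
      changes by an amount that depends only on \<open>B p c\<close> and \<open>B q c\<close>,
      because \<open>u\<close> and \<open>v\<close> have different signs towards \<open>y\<close>.
      The amount is the same for both lines through \<open>c\<close> that avoid \<open>m\<close>,
      hence cancels in the parity; on the line through \<open>m\<close> nothing changes
      (\<open>on\<close>).\<close>
    have off: "(B q c \<longleftrightarrow> opp q y) \<longleftrightarrow> \<not> (B p c \<longleftrightarrow> opp p y)" if y: "A c y" "m \<notin> {y, th c y}" for y
    proof -
      have my: "y \<noteq> m" "\<not> A m y" using lines[OF y(1) h(1)] y(2) A_sym by auto
      have "c \<noteq> v" "\<not> A c v" using h(8,10) A_not_opp common_not_opp A_sym by blast+
      then have "opp u y" "opp v y"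
        using path_opp[of u m c y] path_opp[of v m c y] h my y A_sym by metis+
      then have "B v y = (\<not> B u y)" using flip[OF h(4)] by auto
      then show ?thesis
        using sign_transfer[OF sign_function_B h(7) A_sym[OF h(2)] A_sym[OF h(1)] y(1) h(9) my]
          sign_transfer[OF sign_function_B h(8) A_sym[OF h(3)] A_sym[OF h(1)] y(1) h(10) my] by auto
    qed
    have on: "opp q y = opp p y" if y: "A c y" "m \<in> {y, th c y}" for y
    proof -
      have "\<not> opp q m" "\<not> opp p m" using h common_not_opp A_sym by metis+
      moreover have "m = y \<or> th c m = y" using y th_th by auto
      ultimately show ?thesis using line_parity'[OF h(1)] h(9,10) by metis
    qed
    show "?Q p = ?Q q"
      using cases[OF h(1)] off[OF assms(1)] off[OF assms(2)] off[OF f(1)]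
        on[OF assms(1)] on[OF assms(2)] on[OF f(1)] by argo
  qed
  show ?thesis
  proof (cases "\<exists>p. opp p c \<and> \<not> ?Q p")
    case False
    then show ?thesis using that[OF f] non by blast
  next
    case True
    \<comment> \<open>The parity is wrong for every \<open>p\<close> opposite \<open>c\<close>.
      Replacing \<open>f\<close> by \<open>th c f\<close> reverses it there and, by line parity,
      changes nothing for the other points.\<close>
    have "?Q p = False" if "opp p c" for p using const that True by blast
    then have "opp p (th c f) \<longleftrightarrow> opp p a \<noteq> opp p b" for p
      using th_f non line_parity'[OF f(1)] by blast
    moreover have "th c f \<noteq> a" "th c f \<noteq> b" using dis by auto
    moreover have "\<not> A a (th c f)" "\<not> A b (th c f)"
      using dis lines[OF assms(1) th_A(1)[OF f(1)]] lines[OF assms(2) th_A(1)[OF f(1)]] by blast+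
    ultimately show ?thesis using that[of "th c f"] th_A(1)[OF f(1)] by blast
  qed
qed

text \<open>A separating point exists at every distance: \<open>x\<close> itself if the two are
  opposite; at distance two, a neighbour of one point off the line to the common neighbour; for
  collinear points, the end of a path of length three from \<open>x\<close> through
  \<open>y\<close>.\<close>

lemma opp_nondegenerate:
  assumes "x \<in> X" "y \<in> X" "\<And>p. opp p x \<longleftrightarrow> opp p y"
  shows "x = y"
proof (rule ccontr)
  assume ne: "x \<noteq> y"
  have dist2: False if "D x y" "\<And>p. opp p x \<longleftrightarrow> opp p y" for x y
  proof -
    from that(1) obtain m where m: "A x m" "A m y" by (rule D_mid)
    obtain b where b: "A y b" "m \<noteq> b" "\<not> A m b" using other_line[OF A_sym[OF m(2)]] by blast
    have "opp b x"
      using path_opp[OF m b(1)] that(1) b opp_sym by (auto simp: D_def)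
    then show False using that(2) A_not_opp[OF b(1)] opp_sym by metis
  qed
  show False
  proof (cases "A x y")
    case True
    obtain u where u: "A y u" "x \<noteq> u" "\<not> A x u" using other_line[OF A_sym[OF True]] by blast
    obtain b where b: "A u b" "y \<noteq> b" "\<not> A y b" using other_line[OF A_sym[OF u(1)]] by blast
    have "opp b x" using path_opp[OF True u(1) b(1)] u b opp_sym by auto
    then show False using assms(3) common_not_opp[OF u(1) b(1)] opp_sym by metis
  next
    case False
    moreover have "\<not> opp x y" using assms(3)[of x] opp_irrefl by auto
    ultimately show False using dist2[of x y] assms ne by (auto simp: D_def)
  qed
qed

end

section \<open>Opposition is a symplectic form\<close>

context signed_hexagon begin

section \<open>Reguli and hyperbolic sums\<close>

lemma three_lines_cover:
  assumes "A c a" "A c b" "A c f" "a \<noteq> b" "\<not> A a b" "a \<noteq> f" "\<not> A a f" "b \<noteq> f" "\<not> A b f" "A c v"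
  shows "v \<in> {a, th c a, b, th c b, f, th c f}"
proof -
  obtain g where g: "A c g" "\<And>v. A c v \<Longrightarrow> v \<in> {a, th c a, b, th c b, g, th c g}"
    using three_lines[OF assms(1,2,4,5)] by metis
  have "f \<noteq> th c a" "f \<noteq> th c b" using on_line assms by metis+
  then have "f = g \<or> f = th c g" using g(2)[OF assms(3)] assms by auto
  then show ?thesis using g(2)[OF assms(10)] th_th[OF g(1)] by auto
qed

text \<open>Three points and three lines \<open>a i, u i, t i\<close> such that each of
  \<open>c, w, z\<close> has its nearest point on each line at distance one: a point regulus
  together with the complementary line regulus.\<close>

definition regulus where
  "regulus c w z a u t \<longleftrightarrow> opp c w \<and> opp c z \<and> opp w z \<and>
    (\<forall>i<3::nat. A c (a i) \<and> A w (u i) \<and> A z (t i) \<and> A (a i) (u i) \<and> A (a i) (t i) \<and> A (u i) (t i)) \<and>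
    (\<forall>i<3. \<forall>j<3. i \<noteq> j \<longrightarrow> a i \<noteq> a j \<and> \<not> A (a i) (a j) \<and> u i \<noteq> u j \<and> \<not> A (u i) (u j) \<and>
      t i \<noteq> t j \<and> \<not> A (t i) (t j))"

lemma regulus_sym:
  assumes "regulus c w z a u t"
  shows "regulus c z w a t u" "regulus w c z u a t"
proof -
  note r = assms[unfolded regulus_def]
  have o: "opp c w" "opp c z" "opp w z" "opp w c" "opp z w" using r opp_sym by auto
  have e: "A c (a i)" "A w (u i)" "A z (t i)" "A (a i) (u i)" "A (a i) (t i)" "A (u i) (t i)"
    "A (u i) (a i)" "A (t i) (u i)" if "i < 3" for i using r that A_commute by metis+
  have d: "i \<noteq> j \<longrightarrow> a i \<noteq> a j \<and> \<not> A (a i) (a j) \<and> u i \<noteq> u j \<and> \<not> A (u i) (u j) \<and> t i \<noteq> t j \<and> \<not> A (t i) (t j)"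
    if "i < 3" "j < 3" for i j using r that by blast
  show "regulus c z w a t u" "regulus w c z u a t"
    unfolding regulus_def using o e d by simp_all
qed

lemma regulus_nearest:
  assumes "regulus c w z a u t" "A c p" "\<not> opp p w"
  obtains i where "i < 3" "p = a i"
proof -
  have inj: "inj_on a {..<3}" and sub: "a ` {..<3} \<subseteq> {v. A c v \<and> \<not> opp v w}"
    using assms(1) common_not_opp A_sym unfolding regulus_def inj_on_def by blast+
  have o: "opp c w" using assms(1) unfolding regulus_def by blast
  have "card {v. A c v \<and> \<not> opp v w} = 3"
    using card_nonopp_nbr[OF opp_in[OF o]] o A_not_opp opp_irrefl by auto
  moreover have "card (a ` {..<3}) = 3" using card_image[OF inj] by simp
  ultimately have "a ` {..<3} = {v. A c v \<and> \<not> opp v w}"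
    using card_subset_eq[OF finite_nbr sub] by simp
  then show ?thesis using assms(2,3) that by blast
qed

text \<open>The path \<open>c, a 1, u 1, w\<close> leaves the set of points opposite
  \<open>z\<close>, but not that of the points opposite \<open>th z (t 0)\<close>. Three flips along
  the path for this point, and one on either side to return to \<open>z\<close>, give the
  sign.\<close>

lemma regulus_sign:
  assumes "regulus c w z a u t"
  shows "B w z \<longleftrightarrow> \<not> B c z"
proof -
  note R = assms[unfolded regulus_def]
  have r: "A c (a 0)" "A w (u 0)" "A z (t 0)" "A (a 0) (t 0)" "A (u 0) (t 0)"
    "A c (a 1)" "A w (u 1)" "A z (t 1)" "A (a 1) (u 1)" "A (a 1) (t 1)" "A (u 1) (t 1)"
    "opp c w" "opp c z" "opp w z" using R by auto
  have d: "a 0 \<noteq> a 1" "\<not> A (a 0) (a 1)" "u 0 \<noteq> u 1" "\<not> A (u 0) (u 1)"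
    using R by (metis one_less_numeral_iff semiring_norm(77) zero_less_numeral zero_neq_one)+
  let ?y = "th z (t 0)"
  have far: "c \<noteq> t 0" "\<not> A c (t 0)" "w \<noteq> t 0" "\<not> A w (t 0)"
    using r A_not_opp common_not_opp A_sym by metis+
  have "opp (t 0) (a 1)"
    using path_opp[of "t 0" "a 0" c "a 1"] r d far A_sym by metis
  moreover have "opp (t 0) (u 1)"
    using path_opp[of "t 0" "u 0" w "u 1"] r d far A_sym by metis
  moreover have "\<not> opp z (a 1)" "\<not> opp z (u 1)" "\<not> opp (t 0) c" "\<not> opp (t 0) w"
    using common_not_opp r A_sym by metis+
  ultimately have y: "opp c ?y" "opp (a 1) ?y" "opp (u 1) ?y" "opp w ?y"
    using line_parity[OF r(3)] r opp_sym by metis+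
  have "B w ?y \<longleftrightarrow> \<not> B c ?y"
    using flip[OF r(6) y(1,2)] flip[OF r(9) y(2,3)] flip[OF A_sym[OF r(7)] y(3,4)] by auto
  then show ?thesis
    using flip'[OF th_A(1)[OF r(3)] r(13) y(1)] flip'[OF th_A(1)[OF r(3)] r(14) y(4)] by auto
qed

lemma regulus_on_transversal:
  assumes "regulus c w z a u t" "i < 3" "A (a i) p" "\<not> opp p w" "p \<noteq> c" "\<not> A c p"
  shows "A w p \<or> A z p"
proof -
  have r: "A w (u i)" "A z (t i)" "A (a i) (u i)" "A (a i) (t i)" "A (u i) (t i)" "opp c w" "A c (a i)"
    using assms unfolding regulus_def by blast+
  have wa: "w \<noteq> a i" "\<not> A w (a i)" using r A_not_opp common_not_opp A_sym by metis+
  consider "u i = p" | "A (u i) p" | "opp w p"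
    using path_opp[OF r(1) A_sym[OF r(3)] assms(3) wa] by blast
  then show ?thesis
  proof cases
    case 2
    then have "th (a i) (u i) = p" "th (a i) (u i) = t i"
      using th_unique r assms(3) A_sym by blast+
    then show ?thesis using r by simp
  qed (use r assms opp_sym in auto)
qed

text \<open>If \<open>e\<close> were not opposite \<open>w\<close> it would be some
  \<open>a i\<close>, and then \<open>p\<close> would lie on a transversal. Hence
  \<open>th c e\<close> is the \<open>a i\<close> on that line; it is not opposite \<open>z\<close>,
  and line parity makes \<open>e\<close> opposite \<open>z\<close>.\<close>

lemma regulus_far:
  assumes "regulus c w z a u t" "A c e" "A e p" "\<not> opp p w" "p \<noteq> c" "\<not> A c p" "\<not> A w p" "\<not> A z p"
  shows "opp e w" "opp e z"
proof -
  have o: "opp c w" "opp c z" using assms(1) unfolding regulus_def by blast+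
  show ew: "opp e w"
  proof (rule ccontr)
    assume "\<not> opp e w"
    then obtain i where "i < 3" "e = a i" using regulus_nearest[OF assms(1,2)] by blast
    then show False using regulus_on_transversal[OF assms(1)] assms by blast
  qed
  have "\<not> opp (th c e) w" using line_parity[OF assms(2)] ew o by auto
  then obtain i where "i < 3" "th c e = a i"
    using regulus_nearest[OF assms(1) th_A(1)[OF assms(2)]] by blast
  then have "\<not> opp (th c e) z"
    using assms(1) common_not_opp[of "a i" "t i" z] A_sym unfolding regulus_def by metis
  then show "opp e z" using line_parity[OF assms(2)] o by auto
qed

text \<open>Otherwise \<open>c\<close> and \<open>w\<close> are joined by a path of length four through \<open>p\<close> all of whose points are
  opposite \<open>z\<close>; as the signs alternate along it, this contradicts \<open>regulus_sign\<close>.\<close>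

lemma regulus_perp:
  assumes R: "regulus c w z a u t" and "\<not> opp p c" "\<not> opp p w"
  shows "\<not> opp p z"
proof
  assume pz: "opp p z"
  note R' = regulus_sym(2)[OF R]
  have o: "opp c w" "opp c z" "opp w z" using R unfolding regulus_def by blast+
  have zp: "\<not> A z p" using A_not_opp pz opp_sym by metis
  have cp: "c \<noteq> p" "w \<noteq> p" using assms o opp_sym by metis+
  have step: "\<not> A c p" if r: "regulus c w z a u t" and nw: "\<not> opp p w" for c w a u
  proof
    assume "A c p"
    then obtain i where "i < 3" "p = a i" using regulus_nearest[OF r _ nw] by blast
    then have "A p (t i)" "A (t i) z" using r A_sym unfolding regulus_def by metis+
    then show False using pz common_not_opp by blast
  qed
  have np: "\<not> A c p" "\<not> A w p" using step[OF R] step[OF R'] assms by auto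
  have "D c p" "D w p"
    using np cp assms o opp_in[OF pz] opp_in[OF o(1)] opp_sym by (auto simp: D_def)
  then obtain e n where e: "A c e" "A e p" and n: "A w n" "A n p" using D_mid by metis
  have ez: "opp e z" using regulus_far[OF R e] assms cp np zp by auto
  have nz: "opp n z" using regulus_far[OF R' n] assms cp np zp by auto
  have "B w z \<longleftrightarrow> B c z"
    using flip[OF e(1) o(2) ez] flip[OF e(2) ez pz] flip[OF A_sym[OF n(2)] pz nz]
      flip[OF A_sym[OF n(1)] nz o(3)] by auto
  then show False using regulus_sign[OF R] by auto
qed

text \<open>By \<open>regulus_perp\<close> in all three roles, \<open>p\<close> cannot be opposite
  exactly one of \<open>c, w, z\<close>. If it were opposite all three, a neighbour \<open>q\<close>
  would be opposite none. The lines from \<open>q\<close> towards \<open>c\<close> and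
  \<open>w\<close> then contain no point opposite \<open>c\<close> and \<open>w\<close>
  respectively, and the third line through \<open>q\<close> none opposite \<open>z\<close>; but
  \<open>p\<close> lies on one of these lines.\<close>

lemma regulus_sum:
  assumes R: "regulus c w z a u t"
  shows "opp p z \<longleftrightarrow> opp p c \<noteq> opp p w"
proof -
  have perp: "\<not> opp q c \<Longrightarrow> \<not> opp q w \<Longrightarrow> \<not> opp q z" "\<not> opp q c \<Longrightarrow> \<not> opp q z \<Longrightarrow> \<not> opp q w"
    "\<not> opp q w \<Longrightarrow> \<not> opp q z \<Longrightarrow> \<not> opp q c" for q
    using regulus_perp R regulus_sym by metis+
  have "\<not> (opp p c \<and> opp p w \<and> opp p z)"
  proof
    assume p: "opp p c \<and> opp p w \<and> opp p z"
    have R': "regulus w c z u a t" using regulus_sym R by blast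
    obtain b where "A p b" using card_nbr_gt[OF opp_in(1), of p c "{}"] p by auto
    then obtain q where q: "A p q" "\<not> opp q c" "opp (th p q) c"
      using opp_nbr_nonopp[of p c b] p by metis
    have q3: "\<not> opp q w" "\<not> opp q z"
      using perp[of q] perp[of "th p q"] q line_parity[OF q(1)] p by auto
    have qn: "q \<noteq> c" "\<not> A c q" "q \<noteq> w" "\<not> A w q" "q \<noteq> z" "\<not> A z q"
      using q(1) p A_not_opp common_not_opp A_sym by metis+
    have "D c q" "D w q"
      using qn q q3 R opp_in A_in2 opp_sym by (auto simp: D_def regulus_def)
    then obtain e n where e: "A c e" "A e q" and n: "A w n" "A n q" using D_mid by metis
    have E: "opp e w" "opp e z" using regulus_far[OF R e] qn q q3 by auto
    have N: "opp n c" "opp n z" using regulus_far[OF R' n] qn q q3 by auto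
    have EN: "\<not> opp e c" "\<not> opp n w" using e n A_not_opp A_sym by metis+
    have "e \<noteq> n" using E EN by auto
    moreover have "\<not> A e n"
    proof
      assume "A e n"
      then have "th q e = n" using th_unique e n A_sym by metis
      then show False using line_parity[OF A_sym[OF e(2)], of w] q3 E EN by auto
    qed
    ultimately obtain f where f: "A q f" "f \<noteq> e" "f \<noteq> n" "\<not> A e f" "\<not> A n f"
      and fs: "\<And>p. opp p f \<longleftrightarrow> opp p e \<noteq> opp p n"
      using plane_sum[OF A_sym[OF e(2)] A_sym[OF n(2)]] by metis
    have fz: "\<not> opp f z" using fs[of z] E N opp_sym by auto
    have "p \<in> {e, th q e, n, th q n, f, th q f}"
      using three_lines_cover[OF A_sym[OF e(2)] A_sym[OF n(2)] f(1) \<open>e \<noteq> n\<close> \<open>\<not> A e n\<close>]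
        f A_sym[OF q(1)] by auto
    then show False
      using p EN fz q q3 line_parity[OF A_sym[OF e(2)]] line_parity[OF A_sym[OF n(2)]] line_parity[OF f(1)]
      by auto
  qed
  then show ?thesis using perp[of p] by blast
qed

text \<open>The path is one of three that join \<open>c\<close> to \<open>w\<close>. The third
  points of their middle lines sum to zero, so by nondegeneracy they have a common neighbour
  \<open>z\<close>, which completes a regulus.\<close>

lemma hyperbolic_sum:
  assumes "opp c w" "A c a" "A a u" "A u w"
  obtains z where "A z (th a u)" "\<And>p. opp p z \<longleftrightarrow> opp p c \<noteq> opp p w"
proof -
  have cw: "opp w c" using assms opp_sym by auto
  have aw: "\<not> opp a w" using assms common_not_opp by blast
  obtain b0 where b0: "A c b0" "a \<noteq> b0" "\<not> A a b0" using other_line[OF assms(2)] .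
  obtain b where b: "A c b" "b = b0 \<or> b = th c b0" "\<not> opp b w"
    using opp_nbr_nonopp[OF assms(1) b0(1)] by metis
  have ab: "a \<noteq> b" "\<not> A a b"
    using b(2) b0 off_line[OF b0(1) th_A(1,4)[OF b0(1)] A_sym[OF assms(2)]] th_A[OF b0(1)] A_sym by metis+
  obtain d where d: "A c d" "d \<noteq> a" "d \<noteq> b" "\<not> A a d" "\<not> A b d"
    and ds: "\<And>p. opp p d \<longleftrightarrow> opp p a \<noteq> opp p b" using plane_sum[OF assms(2) b(1) ab] by metis
  have dw: "\<not> opp d w" using ds[of w] aw b opp_sym by auto
  obtain v where v: "A b v" "A v w" using opp_path[OF assms(1) b(1,3)] by metis
  obtain x where x: "A d x" "A x w" using opp_path[OF assms(1) d(1) dw] by metis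
  define al where "al = (\<lambda>i::nat. if i = 0 then a else if i = 1 then b else d)"
  define ul where "ul = (\<lambda>i::nat. if i = 0 then u else if i = 1 then v else x)"
  define tl where "tl = (\<lambda>i. th (al i) (ul i))"
  have i3: "P i" if "P 0" "P 1" "P 2" "i < 3" for P and i :: nat
    using that by (auto simp: numeral_3_eq_3 less_Suc_eq numeral_2_eq_2)
  have al: "A c (al i)" "A (al i) (ul i)" "A (ul i) w" for i
    using assms b d v x by (auto simp: al_def ul_def)
  have ald: "al i \<noteq> al j" "\<not> A (al i) (al j)" if "i < 3" "j < 3" "i \<noteq> j" for i j
    using that ab d by (auto simp: al_def A_commute)
  have ca: "c \<noteq> ul i" "\<not> A c (ul i)" for i
    using al[of i] assms(1) A_not_opp common_not_opp by metis+
  have au: "opp (al i) (ul j)" if "i < 3" "j < 3" "i \<noteq> j" for i j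
    by (rule path_opp[of "al i" c "al j"]) (use al ald[OF that] ca in \<open>auto simp: A_commute\<close>)
  have uld: "ul i \<noteq> ul j" "\<not> A (ul i) (ul j)" if "i < 3" "j < 3" "i \<noteq> j" for i j
    using au[OF that] al[of i] A_not_opp common_not_opp by metis+
  have naa: "\<not> opp (al i) (al j)" for i j
    using al common_not_opp A_sym by metis
  have nuu: "\<not> opp (ul i) (ul j)" for i j
    using al common_not_opp A_sym by metis
  have tl: "A (al i) (tl i)" "A (ul i) (tl i)" for i
    unfolding tl_def by (rule th_A(1)[OF al(2)], rule th_A(4)[OF al(2)])
  have par: "opp p (tl i) \<longleftrightarrow> opp p (al i) \<noteq> opp p (ul i)" for i p
    unfolding tl_def by (rule line_parity'[OF al(2)])
  have ut: "opp (ul i) (tl j)" "opp (al i) (tl j)" if "i < 3" "j < 3" "i \<noteq> j" for i j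
  proof -
    have "opp (ul i) (al j)" using au[of j i] that opp_sym[of "al j" "ul i"] by auto
    then show "opp (ul i) (tl j)" using par[of "ul i" j] nuu by auto
    show "opp (al i) (tl j)" using par[of "al i" j] au[OF that] naa by auto
  qed
  have ntt: "\<not> opp (tl i) (tl j)" if "i < 3" "j < 3" "i \<noteq> j" for i j
    using par[of "tl i" j] ut[of j i] opp_sym[of "tl i" "al j"] opp_sym[of "tl i" "ul j"] that by auto
  have tld: "tl i \<noteq> tl j" "\<not> A (tl i) (tl j)" if "i < 3" "j < 3" "i \<noteq> j" for i j
    using ut[OF that] tl[of i] A_not_opp common_not_opp by metis+
  have "D (tl 0) (tl 1)"
    using tld[of 0 1] ntt[of 0 1] tl A_in2 by (auto simp: D_def)
  then obtain z where z: "A (tl 0) z" "A z (tl 1)" by (rule D_mid)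
  obtain f where f: "A z f" "\<And>p. opp p f \<longleftrightarrow> opp p (tl 0) \<noteq> opp p (tl 1)"
    using plane_sum[OF A_sym[OF z(1)] z(2)] tld[of 0 1] by auto
  have asum: "opp p (al 2) \<longleftrightarrow> opp p (al 0) \<noteq> opp p (al 1)" for p
    using ds[of p] by (simp add: al_def)
  \<comment> \<open>The plane sum \<open>g\<close> of \<open>ul 0\<close> and \<open>ul 1\<close> is
    not opposite \<open>c\<close>, whereas \<open>th w g\<close> is; since \<open>ul 2\<close> is
    not opposite \<open>c\<close> either, it can only be \<open>g\<close>.\<close>
  have usum: "opp p (ul 2) \<longleftrightarrow> opp p (ul 0) \<noteq> opp p (ul 1)" for p
  proof -
    note wu = A_sym[OF al(3)[of 0]] A_sym[OF al(3)[of 1]] A_sym[OF al(3)[of 2]]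
    obtain g where g: "A w g" "g \<noteq> ul 0" "g \<noteq> ul 1" "\<not> A (ul 0) g" "\<not> A (ul 1) g"
      "\<And>p. opp p g \<longleftrightarrow> opp p (ul 0) \<noteq> opp p (ul 1)"
      using plane_sum[OF wu(1,2)] uld[of 0 1] by auto
    have nc: "\<not> opp (ul i) c" for i using al common_not_opp A_sym by metis
    have gc: "\<not> opp g c" using g(6)[of c] nc[of 0] nc[of 1] opp_sym[of c] by auto
    have "ul 2 \<in> {ul 0, th w (ul 0), ul 1, th w (ul 1), g, th w g}"
      using three_lines_cover[OF wu(1,2) g(1) _ _ _ _ _ _ wu(3)] uld[of 0 1] g by auto
    moreover have "ul 2 \<noteq> th w (ul i)" for i
      using line_parity[OF A_sym[OF al(3)[of i]], of c] nc[of i] nc[of 2] cw by auto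
    moreover have "ul 2 \<noteq> th w g" using line_parity[OF g(1), of c] nc[of 2] gc cw by auto
    ultimately have "ul 2 = g" using uld[of 0 2] uld[of 1 2] by auto
    then show ?thesis using g(6)[of p] by simp
  qed
  \<comment> \<open>Both the \<open>al\<close> and the \<open>ul\<close> sum to zero, hence so do
    the third points \<open>tl\<close>.\<close>
  have "opp p f \<longleftrightarrow> opp p (tl 2)" for p
    using f(2)[of p] par[of p] asum[of p] usum[of p] by auto
  then have f2: "f = tl 2" using opp_nondegenerate f(1) A_in2 tl by blast
  have zt: "A z (tl i)" if "i < 3" for i
    by (rule i3[OF _ _ _ that]) (use z f f2 in \<open>auto simp: A_commute\<close>)
  have zau: "opp z c \<and> opp z w"
  proof -
    have u01: "opp (ul 0) (tl 1)" "opp (al 0) (tl 1)" using ut[of 0 1] by auto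
    have "al 0 \<noteq> z" "\<not> A (al 0) z" "ul 0 \<noteq> z" "\<not> A (ul 0) z"
      using u01 z A_not_opp common_not_opp by metis+
    moreover have "w \<noteq> al 0" "\<not> A w (al 0)"
      using al[of 0] assms(1) A_not_opp common_not_opp A_sym by metis+
    then have "\<not> A c (tl 0)" "\<not> A w (tl 0)" "c \<noteq> tl 0" "w \<noteq> tl 0"
      using off_line[OF al(2)[of 0] tl(1,2)[of 0] al(1) ca(1)]
        off_line[OF A_sym[OF al(2)[of 0]] tl(2,1)[of 0] A_sym[OF al(3)]] ca[of 0] tl[of 0] A_sym by metis+
    ultimately show ?thesis
      using path_opp[of c "al 0" "tl 0" z] path_opp[of w "ul 0" "tl 0" z] al(1,3)[of 0] tl[of 0] z(1) A_sym opp_sym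
      by metis
  qed
  have "regulus c w z al ul tl"
    unfolding regulus_def
  proof (intro conjI allI impI)
    fix i :: nat assume "i < 3"
    show "A c (al i)" "A w (ul i)" "A z (tl i)" "A (al i) (ul i)" "A (al i) (tl i)" "A (ul i) (tl i)"
      using al[of i] zt[OF \<open>i < 3\<close>] tl[of i] A_commute by metis+
  next
    fix i j :: nat assume "i < 3" "j < 3" "i \<noteq> j"
    note ij = this
    show "al i \<noteq> al j" "\<not> A (al i) (al j)" "ul i \<noteq> ul j" "\<not> A (ul i) (ul j)"
      "tl i \<noteq> tl j" "\<not> A (tl i) (tl j)"
      using ald[OF ij] uld[OF ij] tld[OF ij] by auto
  qed (use assms(1) zau opp_sym in auto)
  from regulus_sum[OF this] have "opp p z \<longleftrightarrow> opp p c \<noteq> opp p w" for p .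
  moreover have "A z (th a u)" using zt[of 0] by (simp add: tl_def al_def ul_def)
  ultimately show ?thesis using that by blast
qed

text \<open>One construction for each distance: third point of a line, plane sum, hyperbolic
  sum.\<close>

lemma sum_exists:
  assumes "x \<in> X" "y \<in> X" "x \<noteq> y"
  obtains z where "z \<in> X" "\<And>p. opp p z \<longleftrightarrow> opp p x \<noteq> opp p y"
proof -
  consider "A x y" | "D x y" | "opp x y" using assms by (auto simp: D_def)
  then show ?thesis
  proof cases
    case 1
    then show ?thesis using that[of "th x y"] th_A[OF 1] A_in line_parity'[OF 1] by blast
  next
    case 2
    then obtain m where m: "A x m" "A m y" by (rule D_mid)
    have "\<not> A x y" using 2 by (simp add: D_def)
    from plane_sum[OF A_sym[OF m(1)] m(2) assms(3) this] obtain f where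
      "A m f" "\<And>p. opp p f \<longleftrightarrow> opp p x \<noteq> opp p y" by metis
    then show ?thesis using that A_in2 by blast
  next
    case 3
    obtain b where "A x b" using card_nbr_gt[OF assms(1), of "{}"] by auto
    then obtain a where a: "A x a" "\<not> opp a y" using opp_nbr_nonopp[OF 3] by metis
    obtain u where "A a u" "A u y" using opp_path[OF 3 a] by metis
    from hyperbolic_sum[OF 3 a(1) this] show ?thesis using that A_in by metis
  qed
qed

end

section \<open>Coordinates\<close>

context signed_hexagon begin

definition apartment where
  "apartment h0 h1 h2 h3 h4 h5 \<longleftrightarrow>
    A h0 h1 \<and> A h1 h2 \<and> A h2 h3 \<and> A h3 h4 \<and> A h4 h5 \<and> A h5 h0 \<and> opp h0 h3 \<and> opp h1 h4 \<and> opp h2 h5"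

lemma ex_opp:
  assumes "x \<in> X"
  obtains y where "opp x y"
proof -
  obtain a where a: "A x a" using card_nbr_gt[OF assms, of "{}"] by auto
  obtain u where u: "A a u" "x \<noteq> u" "\<not> A x u" using other_line[OF A_sym[OF a]] .
  obtain w where w: "A u w" "a \<noteq> w" "\<not> A a w" using other_line[OF A_sym[OF u(1)]] .
  from path_opp[OF a u(1) w(1) u(2,3) w(2,3)] show ?thesis by (rule that)
qed

lemma ex_apartment:
  assumes "opp c w"
  obtains a u v b where "apartment c a u w v b"
proof -
  obtain a0 where "A c a0" using card_nbr_gt[OF opp_in(1)[OF assms], of "{}"] by auto
  then obtain a where a: "A c a" "\<not> opp a w" using opp_nbr_nonopp[OF assms] by metis
  obtain b0 where b0: "A c b0" "a \<noteq> b0" "\<not> A a b0" using other_line[OF a(1)] .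
  obtain b where b: "A c b" "b = b0 \<or> b = th c b0" "\<not> opp b w"
    using opp_nbr_nonopp[OF assms b0(1)] by metis
  have ab: "a \<noteq> b" "\<not> A a b"
    using b(2) b0 off_line[OF b0(1) th_A(1,4)[OF b0(1)] A_sym[OF a(1)]] th_A[OF b0(1)] A_sym by metis+
  obtain u where u: "A a u" "A u w" "c \<noteq> u" "\<not> A c u" using opp_path[OF assms a] by metis
  obtain v where v: "A b v" "A v w" "c \<noteq> v" "\<not> A c v" using opp_path[OF assms b(1,3)] by metis
  have "opp a v" using path_opp[OF A_sym[OF a(1)] b(1) v(1) ab v(3,4)] .
  moreover have "opp b u" using path_opp[OF A_sym[OF b(1)] a(1) u(1) _ _ u(3,4)] ab A_sym by metis
  ultimately have "apartment c a u w v b"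
    using assms a b u v A_sym opp_sym unfolding apartment_def by metis
  then show ?thesis by (rule that)
qed

text \<open>Three rotation steps of three moves each apply the involution \<open>g\<close> nine
  times, an odd number. It is used with negation for \<open>KK - 4\<close>, and with the identity to
  show that a sign constant along lines would be symmetric.\<close>

lemma opp_swap:
  assumes left: "\<And>x y z. A x z \<Longrightarrow> opp x y \<Longrightarrow> opp z y \<Longrightarrow> h z y = g (h x y)"
    and right: "\<And>x y z. A x z \<Longrightarrow> opp y x \<Longrightarrow> opp y z \<Longrightarrow> h y z = g (h y x)"
    and invol: "\<And>v. g (g v) = v" and o: "opp x y"
  shows "h x y = g (h y x)"
proof -
  \<comment> \<open>One step of the rotation of an apartment; three steps swap its opposite vertices.\<close>
  have rotate: "h u b = g (h w c)"
    if r: "opp w c" "opp u b" "A u w" "A c b" "\<not> opp w b" "\<not> opp u c" for u b w c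
  proof -
    let ?w = "th u w"
    have w: "opp ?w b" "opp ?w c" using line_parity[OF r(3)] r by auto
    show ?thesis
      using left[OF th_A(4)[OF r(3)] r(1) w(2)] right[OF r(4) w(2,1)] left[OF th_A(3)[OF r(3)] w(1) r(2)] invol
      by simp
  qed
  obtain a u v b where "apartment x a u y v b" using ex_apartment[OF o] .
  then have e: "A x a" "A a u" "A u y" "A y v" "A v b" "A b x" and o: "opp x y" "opp a v" "opp u b"
    unfolding apartment_def by auto
  have n: "\<not> opp y b" "\<not> opp u x" "\<not> opp u v" "\<not> opp a b" "\<not> opp a y" "\<not> opp x v"
    using common_not_opp e A_sym by metis+
  have "opp y x" using o opp_sym by auto
  from rotate[OF this o(3) e(3) A_sym[OF e(6)] n(1,2)] rotate[OF o(3,2) e(2) A_sym[OF e(5)] n(3,4)]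
    rotate[OF o(2,1) e(1) A_sym[OF e(4)] n(5,6)]
  show ?thesis using invol by simp
qed

context
  fixes h0 h1 h2 h3 h4 h5
  assumes apt: "apartment h0 h1 h2 h3 h4 h5"
begin

text \<open>Bit \<open>i\<close> is opposition to the vertex across from \<open>hi\<close>, so that
  \<open>hi\<close> receives the code 2 to the power \<open>i\<close>; the list starts at
  \<open>h3\<close> for that reason.\<close>

definition code :: "'a \<Rightarrow> nat" where
  "code x = horner_sum of_bool 2 [opp h3 x, opp h4 x, opp h5 x, opp h0 x, opp h1 x, opp h2 x]"

lemma code_apartment: "code h0 = 1" "code h1 = 2" "code h2 = 4" "code h3 = 8" "code h4 = 16" "code h5 = 32"
proof -
  note a = apt[unfolded apartment_def]
  have e: "A h0 h1" "A h1 h2" "A h2 h3" "A h3 h4" "A h4 h5" "A h5 h0" using a by auto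
  have n: "\<not> opp h0 h1" "\<not> opp h1 h2" "\<not> opp h2 h3" "\<not> opp h3 h4" "\<not> opp h4 h5" "\<not> opp h5 h0"
    "\<not> opp h0 h2" "\<not> opp h1 h3" "\<not> opp h2 h4" "\<not> opp h3 h5" "\<not> opp h4 h0" "\<not> opp h5 h1"
    using e[THEN A_not_opp] common_not_opp[OF e(1,2)] common_not_opp[OF e(2,3)] common_not_opp[OF e(3,4)]
      common_not_opp[OF e(4,5)] common_not_opp[OF e(5,6)] common_not_opp[OF e(6,1)] by simp_all
  have n': "\<not> opp y x" if "\<not> opp x y" for x y using that opp_sym by blast
  have "opp h0 h3" "opp h3 h0" "opp h1 h4" "opp h4 h1" "opp h2 h5" "opp h5 h2"
    using a opp_sym by auto
  then show "code h0 = 1" "code h1 = 2" "code h2 = 4" "code h3 = 8" "code h4 = 16" "code h5 = 32"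
    unfolding code_def by (simp_all add: n n[THEN n'] opp_irrefl)
qed

lemma code_sum:
  assumes "\<And>p. opp p z \<longleftrightarrow> opp p x \<noteq> opp p y"
  shows "code z = code x XOR code y"
proof (rule bit_eqI)
  fix n :: nat
  consider "n = 0" | "n = 1" | "n = 2" | "n = 3" | "n = 4" | "n = 5" | "n \<ge> 6" by linarith
  then show "bit (code z) n \<longleftrightarrow> bit (code x XOR code y) n"
    by cases (simp_all only: code_def bit_xor_iff bit_horner_sum_bit_iff, simp_all add: assms)
qed

text \<open>A number with top bit \<open>n\<close> is the XOR of that power of two and a smaller
  number; \<open>sum_exists\<close> realises the XOR.\<close>

lemma code_onto:
  assumes "0 < k" "k < 2 ^ n" "n \<le> 6"
  shows "\<exists>x\<in>X. code x = k"
  using assms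
proof (induction n arbitrary: k)
  case (Suc n)
  have "n = 0 \<or> n = 1 \<or> n = 2 \<or> n = 3 \<or> n = 4 \<or> n = 5" using Suc.prems by linarith
  then obtain x where x: "x \<in> X" "code x = 2 ^ n"
    using code_apartment apt[unfolded apartment_def] A_in by force
  consider "k < 2 ^ n" | "k = 2 ^ n" | "2 ^ n < k" by linarith
  then show ?case
  proof cases
    case 3
    then have "0 < k - 2 ^ n" "k - 2 ^ n < 2 ^ n" using Suc.prems by auto
    then obtain y where y: "y \<in> X" "code y = k - 2 ^ n" using Suc.IH[of "k - 2 ^ n"] Suc.prems(3) by auto
    have "x \<noteq> y" using x y \<open>k - 2 ^ n < 2 ^ n\<close> by auto
    then obtain z where z: "z \<in> X" "code z = code x XOR code y"
      using sum_exists[OF x(1) y(1)] code_sum[of _ x y] by metis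
    have "bit (k - 2 ^ n) n = False"
      using \<open>k - 2 ^ n < 2 ^ n\<close> by (simp add: bit_nat_def)
    then have "2 ^ n AND (k - 2 ^ n) = 0"
      by (intro bit_eqI) (auto simp: bit_and_iff bit_exp_iff)
    then have "2 ^ n + (k - 2 ^ n) = 2 ^ n XOR (k - 2 ^ n)"
      by (rule disjunctive_add_eq_xor)
    then show ?thesis using x y z 3 by auto
  qed (use Suc x in auto)
qed simp

text \<open>A map from 63 points onto 63 codes is injective.\<close>

lemma code_bij: "bij_betw code X {1..<64}"
proof -
  have sub: "{1..<64} \<subseteq> code ` X"
  proof
    fix k :: nat assume "k \<in> {1..<64}"
    then show "k \<in> code ` X" using code_onto[of k 6] by auto
  qed
  have "card (code ` X) \<le> 63" using card_image_le[OF finite_X] card_X by metis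
  then have "{1..<64} = code ` X"
    using card_subset_eq[OF _ sub] card_mono[OF _ sub] finite_X by auto
  moreover have "inj_on code X"
    by (rule eq_card_imp_inj_on[OF finite_X]) (simp add: calculation[symmetric] card_X)
  ultimately show ?thesis by (simp add: bij_betw_def)
qed

lemma code_inj: "x \<in> X \<Longrightarrow> y \<in> X \<Longrightarrow> code x = code y \<longleftrightarrow> x = y"
  using code_bij by (auto simp: bij_betw_def inj_on_def)

lemma code_th: "A x y \<Longrightarrow> code (th x y) = code x XOR code y"
  using code_sum line_parity' by blast

lemma code_th': "A x y \<Longrightarrow> A x z \<Longrightarrow> code z \<noteq> code x XOR code y \<Longrightarrow> code y \<noteq> code z \<Longrightarrow> y \<noteq> z \<and> \<not> A y z"
  using on_line code_th by blast

lemma std_adj_sound: "std_adj k l \<Longrightarrow> \<exists>x y. A x y \<and> code x = k \<and> code y = l"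
proof (induction rule: std_adj.induct)
  case (std_third k l)
  then obtain x y where "A x y" "code x = k" "code y = l" by blast
  then show ?case using code_th[of x y] th_A(1)[of x y] by auto
next
  case (std_plane k l m)
  then obtain x y x' z where xy: "A x y" "code x = k" "code y = l" "A x' z" "code x' = k" "code z = m" by blast
  then have "x' = x" using code_inj[of x' x] A_in by auto
  with xy have xz: "A x z" by simp
  have "y \<noteq> z" "\<not> A y z" using code_th'[OF xy(1) xz] xy std_plane.hyps by auto
  from plane_sum[OF xy(1) xz this] obtain f where "A x f" "\<And>p. opp p f \<longleftrightarrow> opp p y \<noteq> opp p z" by metis
  then show ?case using code_sum[of f y z] xy by auto
next
  case (std_hyp k l m n)
  then obtain x y y' z z' w where xy: "A x y" "code x = k" "code y = l" "A y' z" "code y' = l" "code z = m"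
    "A z' w" "code z' = m" "code w = n" by blast
  then have "y' = y" "z' = z" using code_inj[of y' y] code_inj[of z' z] A_in A_in2 by auto
  with xy have yz: "A y z" "A z w" by simp_all
  have 1: "x \<noteq> z" "\<not> A x z"
    using code_th'[OF A_sym[OF xy(1)] yz(1)] xy std_hyp.hyps by (auto simp: xor.commute)
  have 2: "y \<noteq> w" "\<not> A y w"
    using code_th'[OF A_sym[OF yz(1)] yz(2)] xy std_hyp.hyps by (auto simp: xor.commute)
  from path_opp[OF xy(1) yz 1 2] have "opp x w" .
  from hyperbolic_sum[OF this xy(1) yz] obtain s where
    "A s (th y z)" "\<And>p. opp p s \<longleftrightarrow> opp p x \<noteq> opp p w" by metis
  then show ?case using code_sum[of s x w] code_th[OF yz(1)] xy by auto
next
  case (std_sym k l)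
  then show ?case using A_sym by blast
qed (use code_apartment apt[unfolded apartment_def] in blast)+

text \<open>The rules already produce six neighbours for each code, and a point has no more than
  six.\<close>

lemma A_iff_std_adj:
  assumes "x \<in> X" "y \<in> X"
  shows "A x y \<longleftrightarrow> std_adj (code x) (code y)"
proof -
  have sound: "A x y" if s: "std_adj (code x) (code y)" and xy: "x \<in> X" "y \<in> X" for x y
  proof -
    obtain x' y' where "A x' y'" "code x' = code x" "code y' = code y" using std_adj_sound[OF s] by blast
    then show ?thesis using code_inj[of x' x] code_inj[of y' y] xy A_in A_in2 by auto
  qed
  have "code x \<in> {1..<64}" using bij_betwE[OF code_bij] assms(1) by blast
  then have "0 < code x" "code x < 64" by auto
  from std_card_nbr[OF this] obtain S where
    S: "S \<subseteq> {l. std_adj (code x) l \<and> 0 < l \<and> l < 64}" "finite S" "card S = 6" by blast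
  have "S \<subseteq> code ` X" using S(1) code_bij by (auto simp: bij_betw_def)
  then obtain T where T: "T \<subseteq> X" "S = code ` T" by (meson subset_imageE)
  have "T \<subseteq> {z. A x z}" using T S(1) sound[OF _ assms(1)] by blast
  moreover have "card T = 6"
    using card_image[OF inj_on_subset[OF bij_betw_imp_inj_on[OF code_bij] T(1)]] T(2) S(3) by simp
  ultimately have "T = {z. A x z}"
    using card_subset_eq[of "{z. A x z}" T] card_nbr[OF assms(1)] finite_nbr[of x "\<lambda>_. True"] by simp
  then have "A x y \<Longrightarrow> std_adj (code x) (code y)" using T S(1) by blast
  then show ?thesis using sound assms by blast
qed

end

end

section \<open>Uniqueness of signed hexagons\<close>

context signed_hexagon begin

text \<open>Opposition in terms of \<open>A\<close> alone, so that a bijection that preserves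
  collinearity preserves it as well.\<close>

lemma opp_iff: "opp x y \<longleftrightarrow> x \<in> X \<and> y \<in> X \<and> x \<noteq> y \<and> \<not> A x y \<and> \<not> (\<exists>m. A x m \<and> A m y)"
proof -
  have "opp x y" if h: "x \<in> X" "y \<in> X" "x \<noteq> y" "\<not> A x y" "\<not> (\<exists>m. A x m \<and> A m y)"
    using h D_mid[of x y] unfolding D_def by blast
  then show ?thesis using opp_in opp_irrefl A_not_opp common_not_opp by blast
qed

lemma ex_opp_both:
  assumes "A y z"
  obtains n where "opp n y" "opp n z"
proof -
  let ?t = "th y z"
  obtain u where u: "A ?t u" "y \<noteq> u" "\<not> A y u" using other_line[OF th_A(3)[OF assms]] .
  obtain w where w: "A u w" "?t \<noteq> w" "\<not> A ?t w" using other_line[OF A_sym[OF u(1)]] .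
  have "opp w y" using path_opp[OF th_A(1)[OF assms] u(1) w(1) u(2,3) w(2,3)] opp_sym by blast
  moreover have "\<not> opp w ?t" using common_not_opp[OF u(1) w(1)] opp_sym by blast
  ultimately show ?thesis using that line_parity'[OF assms] by blast
qed

text \<open>The agreement \<open>g\<close> of two signs is unchanged when either point moves along a
  line among opposite pairs. \<open>connected_opposite\<close> makes it independent of the first
  point, and connectivity of collinearity makes it independent of the second.\<close>

lemma sign_unique:
  assumes C: "sign_function C"
  shows "(\<forall>x y. opp x y \<longrightarrow> (C x y \<longleftrightarrow> B x y)) \<or> (\<forall>x y. opp x y \<longrightarrow> (C x y \<longleftrightarrow> B y x))"
proof -
  define g where "g = (\<lambda>x y. B x y \<longleftrightarrow> C x y)"
  have gl: "g x y = g z y" if "A x z" "opp x y" "opp z y" for x y z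
    using sign_function_flip[OF C that] flip[OF that] by (auto simp: g_def)
  have gr: "g x y = g x z" if "A y z" "opp x y" "opp x z" for x y z
    using sign_function_flip'[OF C that] flip'[OF that] by (auto simp: g_def)
  have const: "g p x = g q x" if "opp p x" "opp q x" for p q x
  proof (rule connected_opposite[OF _ _ that])
    fix p q m u v
    assume h: "A x m" "A m u" "A m v" "A u v" "x \<noteq> u" "\<not> A x u" "A p u" "A q v" "opp p x" "opp q x"
    obtain b where b: "A x b" "m \<noteq> b" "\<not> A m b" using other_line[OF h(1)] .
    have v: "x \<noteq> v" "\<not> A x v" using h(8,10) A_not_opp common_not_opp A_sym by blast+
    \<comment> \<open>The term \<open>opp p b\<close> in \<open>sign_transfer\<close> is common to
      both signs and drops out of the comparison.\<close>
    have tr: "g u b = g p x" if "A p u" "A m u" "opp p x" for p u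
    proof -
      note t = that(1) A_sym[OF that(2)] A_sym[OF h(1)] b(1) that(3) b(2)[symmetric] b(3)
      show ?thesis
        using sign_transfer[OF C t] sign_transfer[OF sign_function_B t] by (auto simp: g_def)
    qed
    have "opp u b" "opp v b"
      using path_opp[of u m x b] path_opp[of v m x b] h v b A_sym by metis+
    then have "g u b = g v b" using gl[OF h(4)] by blast
    then show "g p x = g q x" using tr[OF h(7,2,9)] tr[OF h(8,3,10)] by simp
  qed (use gl in blast)
  define G where "G y \<longleftrightarrow> (\<exists>x. opp x y \<and> g x y)" for y
  have G: "G y = g x y" if "opp x y" for x y unfolding G_def using const[OF _ that] that by blast
  have G_adj: "G y = G z" if yz: "A y z" for y z
  proof -
    obtain n where n: "opp n y" "opp n z" using ex_opp_both[OF yz] .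
    then show ?thesis using G[OF n(1)] G[OF n(2)] gr[OF yz n] by simp
  qed
  have G_const: "G y = G z" if yz: "y \<in> X" "z \<in> X" for y z
  proof -
    consider "y = z" | "A y z" | "D y z" | "opp y z" using yz by (auto simp: D_def)
    then show ?thesis
    proof cases
      case 3
      then obtain m where "A y m" "A m z" by (rule D_mid)
      then show ?thesis using G_adj[of y m] G_adj[of m z] by simp
    next
      case 4
      obtain b where "A y b" using card_nbr_gt[OF yz(1), of "{}"] by auto
      then obtain a where a: "A y a" "\<not> opp a z" using opp_nbr_nonopp[OF 4] by metis
      obtain u where "A a u" "A u z" using opp_path[OF 4 a] by metis
      then show ?thesis using G_adj[of y a] G_adj[of a u] G_adj[of u z] a by simp
    qed (use G_adj in auto)
  qed
  show ?thesis
  proof (cases "\<exists>x y. opp x y \<and> g x y")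
    case True
    then obtain x0 y0 where o: "opp x0 y0" "g x0 y0" by blast
    have "g x y" if "opp x y" for x y
      using G[OF that] G[OF o(1)] G_const[OF opp_in(2)[OF that] opp_in(2)[OF o(1)]] o(2) by simp
    then show ?thesis unfolding g_def by blast
  next
    case False
    then show ?thesis unfolding g_def using B_swap by blast
  qed
qed

end

text \<open>Points with equal codes correspond; the sign of the second hexagon, pulled back to the
  first, is a sign function there.\<close>

theorem signed_hexagon_unique:
  assumes "signed_hexagon X A B" "signed_hexagon Y A' B'"
  shows "\<exists>f. bij_betw f X Y \<and> (\<forall>x\<in>X. \<forall>y\<in>X. A x y \<longleftrightarrow> A' (f x) (f y)) \<and>
    ((\<forall>x\<in>X. \<forall>y\<in>X. B x y \<longleftrightarrow> B' (f x) (f y)) \<or> (\<forall>x\<in>X. \<forall>y\<in>X. B x y \<longleftrightarrow> B' (f y) (f x)))"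
proof -
  interpret H: signed_hexagon X A B by fact
  interpret K: signed_hexagon Y A' B' by fact
  obtain x where "x \<in> X" using H.card_X by fastforce
  then obtain y where "H.opp x y" by (rule H.ex_opp)
  then obtain a u v b where h: "H.apartment x a u y v b" by (rule H.ex_apartment)
  obtain x' where "x' \<in> Y" using K.card_X by fastforce
  then obtain y' where "K.opp x' y'" by (rule K.ex_opp)
  then obtain a' u' v' b' where k: "K.apartment x' a' u' y' v' b'" by (rule K.ex_apartment)
  define c where "c = H.code x a u y v b"
  define d where "d = K.code x' a' u' y' v' b'"
  have c: "bij_betw c X {1..<64}" and d: "bij_betw d Y {1..<64}"
    using H.code_bij[OF h] K.code_bij[OF k] by (auto simp: c_def d_def)
  define f where "f = inv_into Y d \<circ> c"
  have f: "bij_betw f X Y"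
    unfolding f_def by (rule bij_betw_trans[OF c bij_betw_inv_into[OF d]])
  have df: "d (f x) = c x" if "x \<in> X" for x
    using bij_betw_inv_into_right[OF d] bij_betwE[OF c] that by (auto simp: f_def)
  have fY: "f x \<in> Y" if "x \<in> X" for x using bij_betwE[OF f] that by blast
  have A: "A x y \<longleftrightarrow> A' (f x) (f y)" if "x \<in> X" "y \<in> X" for x y
    using H.A_iff_std_adj[OF h that] K.A_iff_std_adj[OF k fY[OF that(1)] fY[OF that(2)]] df that
    by (simp add: c_def d_def)
  have opp: "H.opp x y \<longleftrightarrow> K.opp (f x) (f y)" if "x \<in> X" "y \<in> X" for x y
  proof -
    have "f x = f y \<longleftrightarrow> x = y" using f that by (auto simp: bij_betw_def inj_on_def)
    moreover have "(\<exists>m. A x m \<and> A m y) \<longleftrightarrow> (\<exists>n. A' (f x) n \<and> A' n (f y))"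
    proof
      assume "\<exists>n. A' (f x) n \<and> A' n (f y)"
      then obtain n where n: "A' (f x) n" "A' n (f y)" by blast
      then have "n \<in> f ` X" using f K.A_in[OF n(2)] by (simp add: bij_betw_def)
      then obtain m where "m \<in> X" "n = f m" by blast
      then show "\<exists>m. A x m \<and> A m y" using n A[of x m] A[of m y] that by blast
    next
      assume "\<exists>m. A x m \<and> A m y"
      then obtain m where m: "A x m" "A m y" by blast
      then show "\<exists>n. A' (f x) n \<and> A' n (f y)"
        using A[of x m] A[of m y] H.A_in[of m y] that by blast
    qed
    ultimately show ?thesis unfolding H.opp_iff K.opp_iff using that fY[OF that(1)] fY[OF that(2)] A[OF that] by simp
  qed
  have "H.sign_function (\<lambda>x y. B' (f x) (f y))"
    unfolding H.sign_function_def
  proof (intro conjI allI impI)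
    fix x y assume o: "H.opp x y"
    then have "K.opp (f x) (f y)" using opp[of x y] H.opp_in[OF o] by simp
    then show "B' (f y) (f x) = (\<not> B' (f x) (f y))" by (rule K.B_swap)
  next
    fix x y z assume o: "A x z" "H.opp x y" "H.opp z y"
    then have "A' (f x) (f z)" "K.opp (f x) (f y)" "K.opp (f z) (f y)"
      using opp[of x y] opp[of z y] A[of x z] H.opp_in[OF o(2)] H.opp_in[OF o(3)] by auto
    then show "B' (f z) (f y) = (\<not> B' (f x) (f y))" by (rule K.flip)
  qed
  note * = H.sign_unique[OF this]
  have "\<not> B x y \<and> \<not> B' (f x) (f y) \<and> \<not> B' (f y) (f x)" if "x \<in> X" "y \<in> X" "\<not> H.opp x y" for x y
    using opp[OF that(1,2)] that(3) by (auto simp: H.opp_def K.opp_def)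
  with * have "(\<forall>x\<in>X. \<forall>y\<in>X. B x y \<longleftrightarrow> B' (f x) (f y)) \<or> (\<forall>x\<in>X. \<forall>y\<in>X. B x y \<longleftrightarrow> B' (f y) (f x))"
    using H.opp_sym by (elim disj_forward) metis+
  then show ?thesis using f A by (intro exI[of _ f]) simp
qed

section \<open>The square of the sign matrix\<close>

context signed_hexagon begin

lemma card_symmetric_difference:
  assumes "finite U" "finite V"
  shows "card (U - V) + card (V - U) + 2 * card (U \<inter> V) = card U + card V"
proof -
  have "card (U - V) + card (U \<inter> V) = card U" "card (V - U) + card (V \<inter> U) = card V"
    using card_Diff_subset_Int[of U V] card_Diff_subset_Int[of V U] assms
      card_mono[of U "U \<inter> V"] card_mono[of V "V \<inter> U"] by auto
  then show ?thesis by (simp add: Int_commute)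
qed

lemma sum_card_swap:
  assumes "y \<in> X"
  shows "(\<Sum>x\<in>X. card {z. A x z \<and> P z}) = 6 * card {z \<in> X. P z}"
proof -
  have "(\<Sum>x\<in>X. card {z. A x z \<and> P z}) = (\<Sum>x\<in>X. \<Sum>z\<in>{z \<in> X. P z}. of_bool (A x z))"
  proof (intro sum.cong refl)
    fix x
    have "{z. A x z \<and> P z} = {z \<in> X. P z} \<inter> {z. A x z}" using A_in2 by auto
    then show "card {z. A x z \<and> P z} = (\<Sum>z\<in>{z \<in> X. P z}. of_bool (A x z))"
      using finite_X by (simp add: sum_of_bool_eq)
  qed
  also have "\<dots> = (\<Sum>z\<in>{z \<in> X. P z}. \<Sum>x\<in>X. of_bool (A x z))" by (rule sum.swap)
  also have "\<dots> = (\<Sum>z\<in>{z \<in> X. P z}. 6)"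
  proof (intro sum.cong refl)
    fix z assume "z \<in> {z \<in> X. P z}"
    moreover have "X \<inter> {x. A x z} = {x. A z x}" using A_in A_sym by auto
    ultimately show "(\<Sum>x\<in>X. of_bool (A x z)) = (6::nat)"
      using card_nbr[of z] finite_X by (simp add: sum_of_bool_eq)
  qed
  finally show ?thesis by simp
qed

text \<open>Counting pairs \<open>A x z\<close> with \<open>B z y\<close> or \<open>B y z\<close> in
  two ways gives \<open>6b = 3c + 2d\<close> and \<open>6c = 3b + 2d\<close>; together with
  \<open>63 = 7 + b + c + d\<close> this has one solution.\<close>

lemma valencies:
  assumes "y \<in> X"
  shows "card {z. B z y} = 16" "card {z. B y z} = 16" "card {z. D z y} = 24"
proof -
  let ?b = "card {z. B z y}" and ?c = "card {z. B y z}" and ?d = "card {z. D z y}"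
  have X: "X \<inter> {z. z = y} = {y}" "X \<inter> {z. A z y} = {z. A y z}" "X \<inter> {z. B z y} = {z. B z y}"
    "X \<inter> {z. B y z} = {z. B y z}" "X \<inter> {z. D z y} = {z. D z y}"
    using assms B_in A_in by (auto simp: D_def A_commute)
  have excl: "of_bool (x = y) + of_bool (A x y) + of_bool (B x y) + of_bool (B y x) + of_bool (D x y) = (1::nat)"
    if "x \<in> X" for x
    using that assms A_irrefl[of y] A_not_B[of x y] A_not_B[OF A_sym[of x y]] B_antisym[of x y] B_antisym[of y x]
    by (auto simp: D_def opp_def)
  have ab: "card {z. A x z \<and> B z y} = 3 * of_bool (B y x) + 2 * of_bool (D x y)"
    and ac: "card {z. A x z \<and> B y z} = 3 * of_bool (B x y) + 2 * of_bool (D x y)" if "x \<in> X" for x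
    using AB[OF that assms] AC[OF that assms] excl[OF that] by (auto simp: of_bool_def split: if_splits)
  have "6 * card {z \<in> X. B z y} = (\<Sum>x\<in>X. card {z. A x z \<and> B z y})"
    using sum_card_swap[OF assms, of "\<lambda>z. B z y"] by simp
  also have "\<dots> = 3 * ?c + 2 * ?d"
    using finite_X by (simp add: ab sum.distrib sum_of_bool_eq X flip: sum_distrib_left)
  also have "{z \<in> X. B z y} = {z. B z y}" using B_in by auto
  finally have e1: "6 * ?b = 3 * ?c + 2 * ?d" .
  have "6 * card {z \<in> X. B y z} = (\<Sum>x\<in>X. card {z. A x z \<and> B y z})"
    using sum_card_swap[OF assms, of "\<lambda>z. B y z"] by simp
  also have "\<dots> = 3 * ?b + 2 * ?d"
    using finite_X by (simp add: ac sum.distrib sum_of_bool_eq X flip: sum_distrib_left)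
  also have "{z \<in> X. B y z} = {z. B y z}" using B_in by auto
  finally have e2: "6 * ?c = 3 * ?b + 2 * ?d" .
  have "63 = (\<Sum>x\<in>X. of_bool (x = y) + of_bool (A x y) + of_bool (B x y) + of_bool (B y x) + of_bool (D x y) :: nat)"
    by (simp add: excl card_X)
  also have "\<dots> = 1 + 6 + ?b + ?c + ?d"
    using finite_X card_nbr[OF assms] assms by (simp add: sum.distrib sum_of_bool_eq X Int_insert_right)
  finally have e3: "63 = 1 + 6 + ?b + ?c + ?d" .
  from e1 e2 e3 show "?b = 16" "?c = 16" "?d = 24" by linarith+
qed

lemma card_opp:
  assumes "y \<in> X"
  shows "card {z. opp z y} = 32"
proof -
  have "{z. opp z y} = {z. B z y} \<union> {z. B y z}" by (auto simp: opp_def)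
  moreover have "{z. B z y} \<inter> {z. B y z} = {}" using B_antisym by blast
  moreover have "finite {z. B z y}" "finite {z. B y z}"
    by (rule finite_subset[OF _ finite_X]; use B_in in auto)+
  ultimately show ?thesis using valencies[OF assms] by (simp add: card_Un_disjoint)
qed

lemma finite_opp: "finite {z. opp z y \<and> P z}"
  by (rule finite_sub) (use opp_in in blast)

text \<open>The points opposite exactly one of \<open>x\<close> and \<open>y\<close> are those
  opposite their sum, 32 in number.\<close>

lemma card_opp_both:
  assumes "x \<in> X" "y \<in> X" "x \<noteq> y"
  shows "card {z. opp z x \<and> opp z y} = 16"
proof -
  obtain s where s: "s \<in> X" "\<And>p. opp p s \<longleftrightarrow> opp p x \<noteq> opp p y"
    using sum_exists[OF assms] by blast
  let ?U = "{z. opp z x}" and ?V = "{z. opp z y}"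
  have fin: "finite ?U" "finite ?V" using finite_opp[of _ "\<lambda>_. True"] by auto
  have "{z. opp z s} = (?U - ?V) \<union> (?V - ?U)" using s by auto
  then have "card (?U - ?V) + card (?V - ?U) = 32"
    using card_opp[OF s(1)] card_Un_disjoint[of "?U - ?V" "?V - ?U"] fin by auto
  moreover have "?U \<inter> ?V = {z. opp z x \<and> opp z y}" by auto
  ultimately show ?thesis
    using card_symmetric_difference[OF fin] card_opp[OF assms(1)] card_opp[OF assms(2)] by simp
qed

definition sg :: "'a \<Rightarrow> 'a \<Rightarrow> int" where
  "sg x y = (if B x y then 1 else if B y x then - 1 else 0)"

lemma sg_swap: "sg y x = - sg x y"
  using B_antisym by (auto simp: sg_def)

lemma sg_opp: "sg x y \<noteq> 0 \<longleftrightarrow> opp x y" "opp x y \<Longrightarrow> sg x y * sg x y = 1"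
  by (auto simp: sg_def opp_def)

lemma sg_flip: "A x z \<Longrightarrow> opp x y \<Longrightarrow> opp z y \<Longrightarrow> sg z y = - sg x y"
  using flip[of x z y] B_swap unfolding sg_def by auto

lemma sg_line:
  assumes "A x z"
  shows "sg x y + sg z y + sg (th x z) y = 0"
proof -
  let ?t = "th x z"
  note t = th_A[OF assms]
  have f: "opp x y \<Longrightarrow> opp z y \<Longrightarrow> sg z y = - sg x y" "opp x y \<Longrightarrow> opp ?t y \<Longrightarrow> sg ?t y = - sg x y"
    "opp z y \<Longrightarrow> opp ?t y \<Longrightarrow> sg ?t y = - sg z y"
    using sg_flip assms t by blast+
  have "opp x y \<or> sg x y = 0" "opp z y \<or> sg z y = 0" "opp ?t y \<or> sg ?t y = 0"
    using sg_opp by blast+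
  then show ?thesis using f line_parity[OF assms, of y] by auto
qed

text \<open>The square of the sign matrix; since \<open>sg\<close> is skew, it is symmetric and
  \<open>KK_opp_both\<close> carries a minus sign.\<close>

definition KK :: "'a \<Rightarrow> 'a \<Rightarrow> int" where
  "KK x y = (\<Sum>z\<in>X. sg x z * sg z y)"

lemma KK_sym: "KK x y = KK y x"
  unfolding KK_def by (rule sum.cong) (simp_all add: sg_swap[of _ x] sg_swap[of y])

lemma KK_line: "A x z \<Longrightarrow> KK x y + KK z y + KK (th x z) y = 0"
proof -
  assume a: "A x z"
  have "KK x y + KK z y + KK (th x z) y = (\<Sum>w\<in>X. (sg x w + sg z w + sg (th x z) w) * sg w y)"
    by (simp add: KK_def sum.distrib distrib_right)
  then show ?thesis using sg_line[OF a] by simp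
qed

lemma KK_opp_both: "KK x y = - (\<Sum>z\<in>{z. opp z x \<and> opp z y}. sg z x * sg z y)"
proof -
  have "KK x y = (\<Sum>z\<in>X. - (sg z x * sg z y))"
    unfolding KK_def by (rule sum.cong) (simp_all add: sg_swap[of _ x])
  also have "\<dots> = (\<Sum>z\<in>{z. opp z x \<and> opp z y}. - (sg z x * sg z y))"
  proof (rule sum.mono_neutral_right[OF finite_X])
    show "{z. opp z x \<and> opp z y} \<subseteq> X" using opp_in by blast
    show "\<forall>z\<in>X - {z. opp z x \<and> opp z y}. - (sg z x * sg z y) = 0" using sg_opp(1) by auto
  qed
  finally show ?thesis by (simp add: sum_negf)
qed

lemma KK_diag: "x \<in> X \<Longrightarrow> KK x x = - 32"
  using sg_opp(2) card_opp[of x] by (simp add: KK_opp_both)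

lemma KK_adj:
  assumes "A x y"
  shows "KK x y = 16"
proof -
  have "KK x y = - (\<Sum>z\<in>{z. opp z x \<and> opp z y}. - 1)"
    unfolding KK_opp_both
  proof (intro arg_cong[of _ _ uminus] sum.cong refl)
    fix z assume "z \<in> {z. opp z x \<and> opp z y}"
    then have o: "opp x z" "opp y z" "opp z x" using opp_sym by auto
    have "sg z y = - sg z x"
      using sg_flip[OF assms o(1,2)] sg_swap[of z x] sg_swap[of z y] by simp
    then show "sg z x * sg z y = - 1" using sg_opp(2)[OF o(3)] by simp
  qed
  then show ?thesis
    using card_opp_both[of x y] assms A_in A_in2 A_irrefl by fastforce
qed

lemma card_off_line:
  assumes "A c e"
  shows "card {w. A e w \<and> w \<noteq> c \<and> \<not> A c w} = 4"
proof -
  have "{w. A e w \<and> w \<noteq> c \<and> \<not> A c w} = {w. A e w} - {c, th c e}"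
    using on_line[OF A_sym[OF assms]] th_sym[OF assms] by auto
  moreover have "{c, th c e} \<subseteq> {w. A e w}" using assms th_A[OF assms] A_sym by auto
  ultimately have "card {w. A e w \<and> w \<noteq> c \<and> \<not> A c w} = card {w. A e w} - card {c, th c e}"
    by (simp add: card_Diff_subset)
  then show ?thesis using card_nbr[OF A_in2[OF assms]] th_neq[OF assms] by auto
qed

text \<open>Of the 16 points opposite both \<open>b\<close> and \<open>f\<close>, the 8 opposite
  their common neighbour \<open>c\<close> contribute 1 each. The other 8 lie beyond the third line
  through \<open>c\<close>: the 4 beyond the sum \<open>a\<close> contribute 1 each and the 4 beyond
  \<open>th c a\<close> contribute - 1 each.\<close>

lemma KK_dist2:
  assumes "D b f"
  shows "KK b f = - 8"
proof -
  obtain c where c: "A b c" "A c f" using D_mid[OF assms] .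
  have bf: "b \<noteq> f" "\<not> A b f" "b \<in> X" "f \<in> X" using assms by (auto simp: D_def)
  note cb = A_sym[OF c(1)] and cf = c(2)
  obtain a where a: "A c a" "a \<noteq> b" "a \<noteq> f" "\<not> A b a" "\<not> A f a"
    and as: "\<And>p. opp p a \<longleftrightarrow> opp p b \<noteq> opp p f"
    using plane_sum[OF cb cf bf(1,2)] by metis
  let ?O = "{z. opp z b \<and> opp z f}"
  let ?O1 = "{z \<in> ?O. opp z c}"
  let ?W = "\<lambda>e. {w. A e w \<and> w \<noteq> c \<and> \<not> A c w}"
  have fin: "finite ?O" by (rule finite_opp)
  note ca = a(1) and ca' = th_A(1)[OF a(1)]
  have off: "y \<noteq> e \<and> \<not> A y e" if "e = a \<or> e = th c a" "y = b \<or> y = f" for e y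
    using that a off_line[OF ca ca' th_A(4)[OF ca] A_sym[OF cb]]
      off_line[OF ca ca' th_A(4)[OF ca] A_sym[OF cf]] A_commute th_A[OF a(1)] by metis
  have far: "?W e \<subseteq> ?O" "w \<in> ?W e \<Longrightarrow> \<not> opp w c" if e: "A c e" "e = a \<or> e = th c a" for e w
  proof -
    show "?W e \<subseteq> ?O"
    proof
      fix w assume w: "w \<in> ?W e"
      have "opp w y" if "y = b \<or> y = f" for y
        using path_opp[of w e c y] off[OF e(2) that] w e(1) cb cf that A_commute by auto
      then show "w \<in> ?O" by simp
    qed
    show "w \<in> ?W e \<Longrightarrow> \<not> opp w c" using common_not_opp[of w e c] e(1) A_commute by auto
  qed
  have O2: "?O - ?O1 = ?W a \<union> ?W (th c a)"
  proof
    show "?W a \<union> ?W (th c a) \<subseteq> ?O - ?O1" using far[OF ca] far[OF ca'] by auto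
    show "?O - ?O1 \<subseteq> ?W a \<union> ?W (th c a)"
    proof
      fix w assume "w \<in> ?O - ?O1"
      then have w: "opp w b" "opp w f" "\<not> opp w c" by auto
      have wc: "w \<noteq> c" "\<not> A c w" using w A_not_opp[OF cb] common_not_opp[of w c b] cb A_sym by blast+
      then have "D c w" using w opp_in A_in[OF cb] opp_sym by (auto simp: D_def)
      then obtain e where e: "A c e" "A e w" by (rule D_mid)
      have "e \<noteq> y \<and> \<not> A e y" if "y = b \<or> y = f" "A c y" for y
        using nonopp_line[OF e _ _ that(2)] wc w that A_sym by blast
      then have eb: "e \<noteq> b" "\<not> A e b" "e \<noteq> f" "\<not> A e f" using cb cf by blast+
      have "e \<in> {b, th c b, f, th c f, a, th c a}"
        using three_lines_cover[OF cb cf ca bf(1,2) _ _ _ _ e(1)] a by auto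
      then have "e = a \<or> e = th c a"
        using eb th_A(2)[OF cb] th_A(2)[OF cf] by auto
      then show "w \<in> ?W a \<union> ?W (th c a)" using e wc by auto
    qed
  qed
  \<comment> \<open>\<open>sign_transfer\<close> to \<open>b\<close> and to \<open>f\<close> from
    the same \<open>p\<close> shows that the two signs at \<open>w\<close> agree exactly if
    \<open>p\<close> sees \<open>b\<close> and \<open>f\<close> alike.\<close>
  have val: "sg w b * sg w f = (if opp p b = opp p f then 1 else - 1)"
    if "A e w" "A c e" "w \<in> ?O" "e = a \<or> e = th c a" "A p w" "opp p c" for e w p
  proof -
    have o: "y \<noteq> e" "\<not> A e y" if "y = b \<or> y = f" for y
      using off[OF \<open>e = a \<or> e = th c a\<close> that] A_commute by auto
    have "B w y \<longleftrightarrow> (B p c \<longleftrightarrow> opp p y)" if y: "A c y" "y = b \<or> y = f" for y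
      using sign_transfer[OF sign_function_B \<open>A p w\<close> A_sym[OF \<open>A e w\<close>] A_sym[OF \<open>A c e\<close>] y(1) \<open>opp p c\<close> o[OF y(2)]] .
    from this[OF cb] this[OF cf] have "B w b = (B p c = opp p b)" "B w f = (B p c = opp p f)" by auto
    moreover have "opp w b" "opp w f" using that by auto
    ultimately show ?thesis unfolding sg_def opp_def by auto
  qed
  have ex_p: "\<exists>p. A p w \<and> opp p c \<and> \<not> opp p e" if w: "w \<in> ?W e" and e: "A c e" for e w
  proof -
    have ew: "A w e" using w A_sym by blast
    obtain p where p: "A w p" "e \<noteq> p" "\<not> A e p" using other_line[OF ew] .
    have "opp c p" using path_opp[OF e A_sym[OF ew] p(1)] w p by auto
    then show ?thesis using p common_not_opp[of p w e] ew A_sym opp_sym by blast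
  qed
  have Wa: "(\<Sum>w\<in>?W a. sg w b * sg w f) = 4"
  proof -
    have "sg w b * sg w f = 1" if w: "w \<in> ?W a" for w
    proof -
      obtain p where p: "A p w" "opp p c" "\<not> opp p a" using ex_p[OF w ca] by blast
      then show ?thesis using val[of a w p] far(1)[OF ca] w ca as[of p] by auto
    qed
    then show ?thesis using card_off_line[OF ca] by simp
  qed
  have Wa': "(\<Sum>w\<in>?W (th c a). sg w b * sg w f) = - 4"
  proof -
    have "sg w b * sg w f = - 1" if w: "w \<in> ?W (th c a)" for w
    proof -
      obtain p where p: "A p w" "opp p c" "\<not> opp p (th c a)" using ex_p[OF w ca'] by blast
      then have "opp p a" using line_parity'[OF ca] by auto
      then show ?thesis using val[of "th c a" w p] far(1)[OF ca'] w ca' as[of p] p by auto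
    qed
    then show ?thesis using card_off_line[OF ca'] by simp
  qed
  have disj: "?W a \<inter> ?W (th c a) = {}"
  proof -
    have "\<not> (A a w \<and> A (th c a) w \<and> w \<noteq> c)" for w
      using common_unique[of a "th c a" w c] ca ca' th_neq(2)[OF ca] A_sym by metis
    then show ?thesis by blast
  qed
  have finW: "finite (?W e)" for e by (rule finite_nbr)
  have "(\<Sum>w\<in>?O - ?O1. sg w b * sg w f) = 0"
    unfolding O2 by (subst sum.union_disjoint[OF finW finW disj]) (simp add: Wa Wa')
  moreover have "(\<Sum>w\<in>?O1. sg w b * sg w f) = 8"
  proof -
    have "sg w b * sg w f = 1" if "w \<in> ?O1" for w
    proof -
      have w: "opp b w" "opp f w" "opp c w" using that opp_sym by auto
      have "sg b w = - sg c w" "sg f w = - sg c w"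
        using sg_flip[OF cb w(3,1)] sg_flip[OF cf w(3,2)] by auto
      then show ?thesis using sg_opp(2)[OF w(3)] by (simp add: sg_swap[of w])
    qed
    \<comment> \<open>Among the points opposite \<open>b\<close>, those opposite any two of
      \<open>f, c, th c f\<close> form three classes of which each pair has 16 points
      together.\<close>
    moreover have "card ?O1 = 8"
    proof -
      let ?n2 = "{z. opp z b \<and> opp z f \<and> \<not> opp z c}" and ?n3 = "{z. opp z b \<and> \<not> opp z f \<and> opp z c}"
      let ?f' = "th c f"
      have f': "?f' \<in> X" "b \<noteq> ?f'" using th_A[OF cf] A_in A_commute bf by metis+
      have ne: "b \<noteq> c" using cb A_irrefl by auto
      have e: "?O1 \<union> ?n2 = {z. opp z b \<and> opp z f}" "?O1 \<union> ?n3 = {z. opp z b \<and> opp z c}"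
        "?n2 \<union> ?n3 = {z. opp z b \<and> opp z ?f'}"
        using line_parity'[OF cf] by auto
      have fn: "finite ?O1" "finite ?n2" "finite ?n3"
        by (rule finite_subset[OF _ finite_opp[of b "\<lambda>_. True"]]; auto)+
      have "card (?O1 \<union> ?n2) = card ?O1 + card ?n2" "card (?O1 \<union> ?n3) = card ?O1 + card ?n3"
        "card (?n2 \<union> ?n3) = card ?n2 + card ?n3"
        by (rule card_Un_disjoint; use fn in auto)+
      then have "card ?O1 + card ?n2 = 16" "card ?O1 + card ?n3 = 16" "card ?n2 + card ?n3 = 16"
        unfolding e
        using card_opp_both[OF bf(3,4,1)] card_opp_both[OF bf(3) A_in[OF cb] ne] card_opp_both[OF bf(3) f'] by simp_all
      then show ?thesis by linarith
    qed
    ultimately show ?thesis by simp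
  qed
  moreover have "(\<Sum>w\<in>?O. sg w b * sg w f) = (\<Sum>w\<in>?O - ?O1. sg w b * sg w f) + (\<Sum>w\<in>?O1. sg w b * sg w f)"
    by (rule sum.subset_diff[OF _ fin]) auto
  ultimately show ?thesis unfolding KK_opp_both by simp
qed

text \<open>\<open>KK - 4\<close> changes sign along collinear pairs like a sign function, hence is antisymmetric; but it
  is also symmetric.\<close>

lemma KK_opp:
  assumes "opp x y"
  shows "KK x y = 4"
proof -
  \<comment> \<open>The third point of the line \<open>x z\<close> is at distance two from
    \<open>y\<close> and contributes - 8 to the zero sum over the line.\<close>
  have step: "KK z y + KK x y = 8" if "A x z" "opp x y" "opp z y" for x y z
  proof -
    have n: "\<not> opp (th x z) y" using line_parity[OF that(1), of y] that by simp
    have "th x z \<noteq> y" "\<not> A (th x z) y"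
      using th_A[OF that(1)] that A_not_opp common_not_opp by metis+
    then have "D (th x z) y" using n that opp_in th_A[OF that(1)] A_in by (auto simp: D_def)
    then show ?thesis using KK_dist2 KK_line[OF that(1), of y] by simp
  qed
  have step': "KK y z - 4 = - (KK y x - 4)" if "A x z" "opp y x" "opp y z" for x y z
    using step[of x z y] KK_sym[of y x] KK_sym[of y z] that opp_sym[of y] by simp
  have "KK x y - 4 = - (KK y x - 4)"
    by (rule opp_swap[where h = "\<lambda>x y. KK x y - 4" and g = uminus]) (use step step' assms in force)+
  then show ?thesis using KK_sym[of x y] by simp
qed

end

section \<open>Bose--Mesner algebras and eigenmatrices\<close>

lemma mat_mult_assoc:
  assumes "finite X"
  shows "mat_mult X (mat_mult X F G) H = mat_mult X F (mat_mult X G H)"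
proof (intro ext)
  fix x y
  have "(\<Sum>z\<in>X. (\<Sum>w\<in>X. F x w * G w z) * H z y) = (\<Sum>w\<in>X. \<Sum>z\<in>X. F x w * G w z * H z y)"
    by (subst sum.swap) (simp add: sum_distrib_right)
  also have "\<dots> = (\<Sum>w\<in>X. F x w * (\<Sum>z\<in>X. G w z * H z y))"
    by (simp add: sum_distrib_left mult.assoc)
  finally show "mat_mult X (mat_mult X F G) H x y = mat_mult X F (mat_mult X G H) x y"
    by (simp add: mat_mult_def)
qed

lemma mat_mult_sum_right:
  "mat_mult X F (\<lambda>x y. \<Sum>j\<in>J. b j * G j x y) = (\<lambda>x y. \<Sum>j\<in>J. b j * mat_mult X F (G j) x y)"
proof (intro ext)
  fix x y
  have "(\<Sum>z\<in>X. F x z * (\<Sum>j\<in>J. b j * G j z y)) = (\<Sum>z\<in>X. \<Sum>j\<in>J. b j * (F x z * G j z y))"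
    by (simp add: sum_distrib_left mult_ac)
  also have "\<dots> = (\<Sum>j\<in>J. \<Sum>z\<in>X. b j * (F x z * G j z y))" by (rule sum.swap)
  finally show "mat_mult X F (\<lambda>x y. \<Sum>j\<in>J. b j * G j x y) x y = (\<Sum>j\<in>J. b j * mat_mult X F (G j) x y)"
    by (simp add: mat_mult_def sum_distrib_left)
qed

lemma mat_mult_sum_left:
  "mat_mult X (\<lambda>x y. \<Sum>j\<in>J. b j * G j x y) F = (\<lambda>x y. \<Sum>j\<in>J. b j * mat_mult X (G j) F x y)"
proof (intro ext)
  fix x y
  have "(\<Sum>z\<in>X. (\<Sum>j\<in>J. b j * G j x z) * F z y) = (\<Sum>z\<in>X. \<Sum>j\<in>J. b j * (G j x z * F z y))"
    by (simp add: sum_distrib_right mult.assoc)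
  also have "\<dots> = (\<Sum>j\<in>J. \<Sum>z\<in>X. b j * (G j x z * F z y))" by (rule sum.swap)
  finally show "mat_mult X (\<lambda>x y. \<Sum>j\<in>J. b j * G j x y) F x y = (\<Sum>j\<in>J. b j * mat_mult X (G j) F x y)"
    by (simp add: mat_mult_def sum_distrib_left)
qed

lemma mat_mult_sum:
  "mat_mult X (\<lambda>x y. \<Sum>i\<in>I. a i * F i x y) (\<lambda>x y. \<Sum>j\<in>J. b j * G j x y)
    = (\<lambda>x y. \<Sum>i\<in>I. \<Sum>j\<in>J. a i * b j * mat_mult X (F i) (G j) x y)"
  by (simp add: mat_mult_sum_left mat_mult_sum_right sum_distrib_left mult.assoc)

lemma mat_mult_diff_left: "mat_mult X (\<lambda>x y. F x y - G x y) H = (\<lambda>x y. mat_mult X F H x y - mat_mult X G H x y)"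
  by (simp add: mat_mult_def left_diff_distrib sum_subtractf fun_eq_iff)

lemma mat_mult_diff_right: "mat_mult X H (\<lambda>x y. F x y - G x y) = (\<lambda>x y. mat_mult X H F x y - mat_mult X H G x y)"
  by (simp add: mat_mult_def right_diff_distrib sum_subtractf fun_eq_iff)

lemma mat_mult_adjacency:
  assumes "finite X"
  shows "mat_mult X (adjacency R) (adjacency T) x y = of_nat (card {z \<in> X. (x, z) \<in> R \<and> (z, y) \<in> T})"
proof -
  have "mat_mult X (adjacency R) (adjacency T) x y = (\<Sum>z\<in>X. if (x, z) \<in> R \<and> (z, y) \<in> T then 1 else 0)"
    unfolding mat_mult_def adjacency_def by (intro sum.cong) auto
  also have "\<dots> = (\<Sum>z\<in>{z \<in> X. (x, z) \<in> R \<and> (z, y) \<in> T}. 1)"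
    using assms by (intro sum.mono_neutral_cong_right) auto
  finally show ?thesis by simp
qed

lemma bose_mesner_iff:
  "F \<in> bose_mesner d S \<longleftrightarrow> (\<exists>c. F = (\<lambda>x y. \<Sum>i\<le>d. c i * adjacency (S i) x y))"
  by (simp add: bose_mesner_def)

lemma bose_mesner_memI:
  "F = (\<lambda>x y. \<Sum>i\<le>d. c i * adjacency (S i) x y) \<Longrightarrow> F \<in> bose_mesner d S"
  unfolding bose_mesner_iff by (rule exI[of _ c])

section \<open>The Bose-Mesner algebra of a scheme\<close>

context assoc_scheme begin

lemma S_sub: "i \<le> d \<Longrightarrow> S i \<subseteq> X \<times> X"
  using cover by blast

lemma S_disjoint: "i \<le> d \<Longrightarrow> j \<le> d \<Longrightarrow> (x, y) \<in> S i \<Longrightarrow> (x, y) \<in> S j \<Longrightarrow> i = j"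
  using disjoint by blast

lemma ex_relation: "x \<in> X \<Longrightarrow> y \<in> X \<Longrightarrow> \<exists>i\<le>d. (x, y) \<in> S i"
  using cover by blast

lemma adjacency_sum:
  assumes "k \<le> d" "(x, y) \<in> S k"
  shows "(\<Sum>i\<le>d. c i * adjacency (S i) x y) = c k"
proof -
  have "(\<Sum>i\<le>d. c i * adjacency (S i) x y) = (\<Sum>i\<in>{k}. c i * adjacency (S i) x y)"
    using assms S_disjoint by (intro sum.mono_neutral_right) (auto simp: adjacency_def)
  then show ?thesis using assms by (simp add: adjacency_def)
qed

lemma adjacency_sum_outside:
  assumes "x \<notin> X \<or> y \<notin> X"
  shows "(\<Sum>i\<le>d. c i * adjacency (S i) x y) = 0"
  using assms S_sub by (intro sum.neutral) (auto simp: adjacency_def)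

lemma bose_mesner_I:
  assumes "\<And>x y. x \<notin> X \<or> y \<notin> X \<Longrightarrow> F x y = 0"
    and "\<And>k x y. k \<le> d \<Longrightarrow> (x, y) \<in> S k \<Longrightarrow> F x y = c k"
  shows "F = (\<lambda>x y. \<Sum>i\<le>d. c i * adjacency (S i) x y)"
proof (intro ext)
  fix x y
  show "F x y = (\<Sum>i\<le>d. c i * adjacency (S i) x y)"
  proof (cases "x \<in> X \<and> y \<in> X")
    case True
    then obtain k where "k \<le> d" "(x, y) \<in> S k" using ex_relation by blast
    then show ?thesis using assms adjacency_sum by simp
  next
    case False
    then show ?thesis using assms adjacency_sum_outside by simp
  qed
qed

lemma mat_mult_adjacency_outside:
  assumes "x \<notin> X \<or> y \<notin> X" "i \<le> d" "j \<le> d"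
  shows "mat_mult X (adjacency (S i)) (adjacency (S j)) x y = 0"
  using assms S_sub unfolding mat_mult_def adjacency_def by (intro sum.neutral) auto

lemma bose_mesner_mult:
  assumes "F \<in> bose_mesner d S" "G \<in> bose_mesner d S"
  shows "mat_mult X F G \<in> bose_mesner d S"
proof -
  obtain a b where F: "F = (\<lambda>x y. \<Sum>i\<le>d. a i * adjacency (S i) x y)"
    and G: "G = (\<lambda>x y. \<Sum>i\<le>d. b i * adjacency (S i) x y)"
    using assms unfolding bose_mesner_iff by (elim exE)
  define p where "p i j k = (SOME p. \<forall>(x, y) \<in> S k. card {z \<in> X. (x, z) \<in> S i \<and> (z, y) \<in> S j} = p)" for i j k
  have p: "card {z \<in> X. (x, z) \<in> S i \<and> (z, y) \<in> S j} = p i j k"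
    if "i \<le> d" "j \<le> d" "k \<le> d" "(x, y) \<in> S k" for i j k x y
  proof -
    have "\<forall>(x, y) \<in> S k. card {z \<in> X. (x, z) \<in> S i \<and> (z, y) \<in> S j} = p i j k"
      unfolding p_def by (rule someI_ex[OF intersection_numbers[OF that(1-3)]])
    from bspec[OF this that(4)] show ?thesis by simp
  qed
  have "mat_mult X F G = (\<lambda>x y. \<Sum>k\<le>d. (\<Sum>i\<le>d. \<Sum>j\<le>d. a i * b j * of_nat (p i j k)) * adjacency (S k) x y)"
    unfolding F G mat_mult_sum
  proof (rule bose_mesner_I)
    fix x y assume "x \<notin> X \<or> y \<notin> X"
    then show "(\<Sum>i\<le>d. \<Sum>j\<le>d. a i * b j * mat_mult X (adjacency (S i)) (adjacency (S j)) x y) = 0"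
      using mat_mult_adjacency_outside by (intro sum.neutral ballI) simp
  next
    fix k x y assume "k \<le> d" "(x, y) \<in> S k"
    then show "(\<Sum>i\<le>d. \<Sum>j\<le>d. a i * b j * mat_mult X (adjacency (S i)) (adjacency (S j)) x y)
        = (\<Sum>i\<le>d. \<Sum>j\<le>d. a i * b j * of_nat (p i j k))"
      using p by (intro sum.cong refl) (simp add: mat_mult_adjacency finite_points)
  qed
  then show ?thesis
    by (rule bose_mesner_memI[where c = "\<lambda>k. \<Sum>i\<le>d. \<Sum>j\<le>d. a i * b j * of_nat (p i j k)"])
qed

lemma bose_mesner_diff:
  assumes "F \<in> bose_mesner d S" "G \<in> bose_mesner d S"
  shows "(\<lambda>x y. F x y - G x y) \<in> bose_mesner d S"
proof -
  obtain a b where F: "F = (\<lambda>x y. \<Sum>i\<le>d. a i * adjacency (S i) x y)"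
    and G: "G = (\<lambda>x y. \<Sum>i\<le>d. b i * adjacency (S i) x y)"
    using assms unfolding bose_mesner_iff by (elim exE)
  have "(\<lambda>x y. F x y - G x y) = (\<lambda>x y. \<Sum>i\<le>d. (a i - b i) * adjacency (S i) x y)"
    by (simp add: F G left_diff_distrib sum_subtractf)
  then show ?thesis by (rule bose_mesner_memI[where c = "\<lambda>i. a i - b i"])
qed

end

section \<open>Primitive idempotents and intersection numbers\<close>

context commutative_assoc_scheme begin

lemma bose_mesner_commute:
  assumes "F \<in> bose_mesner d S" "G \<in> bose_mesner d S"
  shows "mat_mult X F G = mat_mult X G F"
proof -
  obtain a b where F: "F = (\<lambda>x y. \<Sum>i\<le>d. a i * adjacency (S i) x y)"
    and G: "G = (\<lambda>x y. \<Sum>i\<le>d. b i * adjacency (S i) x y)"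
    using assms unfolding bose_mesner_iff by (elim exE)
  have "mat_mult X (adjacency (S i)) (adjacency (S j)) x y = mat_mult X (adjacency (S j)) (adjacency (S i)) x y"
    if "i \<le> d" "j \<le> d" for i j x y
  proof (cases "x \<in> X \<and> y \<in> X")
    case True
    then show ?thesis using commute[OF that] by (simp add: mat_mult_adjacency finite_points)
  next
    case False
    then show ?thesis using mat_mult_adjacency_outside that by auto
  qed
  then show ?thesis
    unfolding F G mat_mult_sum by (subst sum.swap) (auto simp: mult.commute intro!: sum.cong ext)
qed

text \<open>Otherwise \<open>E\<close> would split into the orthogonal nonzero idempotents
  \<open>EG\<close> and \<open>E - EG\<close>.\<close>

lemma primitive_absorb:
  assumes E: "E \<in> primitive_idempotents X d S" and G: "G \<in> primitive_idempotents X d S"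
    and nz: "mat_mult X E G \<noteq> (\<lambda>x y. 0)"
  shows "mat_mult X E G = E"
proof (rule ccontr)
  let ?F = "mat_mult X E G"
  assume ne: "?F \<noteq> E"
  have e: "E \<in> bose_mesner d S" "mat_mult X E E = E"
    and g: "G \<in> bose_mesner d S" "mat_mult X G G = G"
    using E G by (auto simp: primitive_idempotents_def nonzero_idempotents_def)
  note assoc = mat_mult_assoc[OF finite_points]
  have comm: "mat_mult X G E = ?F" using bose_mesner_commute e g by blast
  have EF: "mat_mult X E ?F = ?F" using assoc[of E E G] e by simp
  have FE: "mat_mult X ?F E = ?F" using assoc[of E G E] comm EF by simp
  have FF: "mat_mult X ?F ?F = ?F"
    using assoc[of ?F E G] FE assoc[of E G G] g by simp
  have F: "?F \<in> nonzero_idempotents X d S"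
    using bose_mesner_mult[OF e(1) g(1)] nz FF by (simp add: nonzero_idempotents_def)
  let ?D = "\<lambda>x y. E x y - ?F x y"
  have "mat_mult X ?D ?D = ?D"
    using e EF FE FF by (simp add: mat_mult_diff_left mat_mult_diff_right)
  moreover have "?D \<noteq> (\<lambda>x y. 0)"
  proof
    assume 0: "?D = (\<lambda>x y. 0)"
    have "?F x y = E x y" for x y using fun_cong[OF fun_cong[OF 0, of x], of y] by simp
    then show False using ne by blast
  qed
  ultimately have D: "?D \<in> nonzero_idempotents X d S"
    using bose_mesner_diff[OF e(1) bose_mesner_mult[OF e(1) g(1)]] by (simp add: nonzero_idempotents_def)
  have "mat_mult X ?F ?D = (\<lambda>x y. 0)" "mat_mult X ?D ?F = (\<lambda>x y. 0)"
    using e EF FE FF by (simp_all add: mat_mult_diff_left mat_mult_diff_right)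
  moreover have "E = (\<lambda>x y. ?F x y + ?D x y)" by (simp add: fun_eq_iff)
  ultimately show False using E F D unfolding primitive_idempotents_def by blast
qed

lemma primitive_orthogonal:
  assumes E: "E \<in> primitive_idempotents X d S" and G: "G \<in> primitive_idempotents X d S" and "E \<noteq> G"
  shows "mat_mult X E G = (\<lambda>x y. 0)"
proof (rule ccontr)
  assume nz: "mat_mult X E G \<noteq> (\<lambda>x y. 0)"
  have "mat_mult X E G = mat_mult X G E"
    using E G bose_mesner_commute by (simp add: primitive_idempotents_def nonzero_idempotents_def)
  then show False
    using primitive_absorb[OF E G nz] primitive_absorb[OF G E] nz \<open>E \<noteq> G\<close> by simp
qed

text \<open>Each row of \<open>P\<close> is a character of the algebra, and the primitive
  idempotents are orthogonal; so numbers \<open>c k\<close> that satisfy the character equations are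
  the coefficients of the product.\<close>

lemma eigenmatrix_intersection:
  assumes P: "is_first_eigenmatrix X d S P"
    and c: "\<And>r. r \<le> d \<Longrightarrow> (\<Sum>k\<le>d. of_nat (c k) * P r k) = P r i * P r j"
    and k: "i \<le> d" "j \<le> d" "k \<le> d" "(x, y) \<in> S k"
  shows "card {z \<in> X. (x, z) \<in> S i \<and> (z, y) \<in> S j} = c k"
proof -
  obtain E where E: "bij_betw E {..d} (primitive_idempotents X d S)"
    and A: "\<And>j. j \<le> d \<Longrightarrow> adjacency (S j) = (\<lambda>x y. \<Sum>i\<le>d. P i j * E i x y)"
    using P unfolding is_first_eigenmatrix_def by blast
  have prim: "E r \<in> primitive_idempotents X d S" if "r \<le> d" for r
    using E that by (auto simp: bij_betw_def)
  have EE: "mat_mult X (E r) (E s) = (if r = s then E r else (\<lambda>x y. 0))" if "r \<le> d" "s \<le> d" for r s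
  proof (cases "r = s")
    case True
    then show ?thesis using prim[OF that(1)] by (simp add: primitive_idempotents_def nonzero_idempotents_def)
  next
    case False
    then have "E r \<noteq> E s" using E that by (auto simp: bij_betw_def inj_on_def)
    then show ?thesis using primitive_orthogonal prim that False by simp
  qed
  have "mat_mult X (adjacency (S i)) (adjacency (S j)) x y
      = (\<Sum>r\<le>d. \<Sum>s\<le>d. P r i * P s j * mat_mult X (E r) (E s) x y)"
    unfolding A[OF k(1)] A[OF k(2)] mat_mult_sum ..
  also have "\<dots> = (\<Sum>r\<le>d. \<Sum>s\<le>d. if s = r then P r i * P r j * E r x y else 0)"
    by (intro sum.cong refl) (auto simp: EE)
  also have "\<dots> = (\<Sum>r\<le>d. P r i * P r j * E r x y)" by simp
  also have "\<dots> = (\<Sum>r\<le>d. (\<Sum>k\<le>d. of_nat (c k) * P r k) * E r x y)"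
    by (intro sum.cong refl) (simp add: c)
  also have "\<dots> = (\<Sum>k\<le>d. \<Sum>r\<le>d. of_nat (c k) * P r k * E r x y)"
    by (subst sum.swap) (simp add: sum_distrib_right)
  also have "\<dots> = (\<Sum>k\<le>d. of_nat (c k) * adjacency (S k) x y)"
    by (intro sum.cong refl) (simp add: A sum_distrib_left mult.assoc)
  also have "\<dots> = of_nat (c k)" by (rule adjacency_sum[OF k(3,4)])
  finally show ?thesis by (simp add: mat_mult_adjacency finite_points)
qed

end

section \<open>From the eigenmatrix to a signed hexagon and an isomorphism\<close>

lemma atMost_4: "{..4::nat} = {0, 1, 2, 3, 4}"
  by auto

lemma le_4: "(i::nat) \<le> 4 \<longleftrightarrow> i = 0 \<or> i = 1 \<or> i = 2 \<or> i = 3 \<or> i = 4"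
  by auto

text \<open>The intersection numbers, with the relation of the pair as last index;
  \<open>P_matrix_numbers\<close> checks them against the characters, and \<open>products\<close>
  later derives them from a signed hexagon.\<close>

definition scheme_numbers :: "nat list list list" where
  "scheme_numbers =
    [[[1, 0, 0, 0, 0], [0, 1, 0, 0, 0], [0, 0, 1, 0, 0], [0, 0, 0, 1, 0], [0, 0, 0, 0, 1]],
     [[0, 1, 0, 0, 0], [6, 1, 0, 1, 0], [0, 0, 0, 2, 3], [0, 4, 3, 1, 3], [0, 0, 3, 2, 0]],
     [[0, 0, 1, 0, 0], [0, 0, 0, 2, 3], [0, 8, 3, 2, 7], [0, 8, 9, 6, 3], [16, 0, 3, 6, 3]],
     [[0, 0, 0, 1, 0], [0, 4, 3, 1, 3], [0, 8, 9, 6, 3], [24, 4, 9, 10, 9], [0, 8, 3, 6, 9]],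
     [[0, 0, 0, 0, 1], [0, 0, 3, 2, 0], [16, 0, 3, 6, 3], [0, 8, 3, 6, 9], [0, 8, 7, 2, 3]]]"

lemma P_matrix_numbers:
  assumes "i \<le> 4" "j \<le> 4" "r \<le> 4"
  shows "(\<Sum>k\<le>4. of_nat (scheme_numbers ! i ! j ! k) * P_matrix r k) = P_matrix r i * P_matrix r j"
  using assms[unfolded le_4]
  by (elim disjE; simp add: atMost_4 P_matrix_def scheme_numbers_def complex_eq_iff)

lemma (in assoc_scheme) relation_3:
  assumes "d = 4" "(S 2)\<inverse> = S 4" "x \<in> X" "y \<in> X"
  shows "(x, y) \<in> S 3 \<longleftrightarrow> x \<noteq> y \<and> (x, y) \<notin> S 1 \<and> (x, y) \<notin> S 2 \<and> (y, x) \<notin> S 2"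
proof -
  obtain k where k: "k \<le> 4" "(x, y) \<in> S k" using ex_relation assms by blast
  have "(x, y) \<in> S i \<longleftrightarrow> k = i" if "i \<le> 4" for i
    using S_disjoint[of k i x y] k that assms(1) by blast
  from this[of 0] this[of 1] this[of 2] this[of 3] this[of 4]
  have "x = y \<longleftrightarrow> k = 0" "(x, y) \<in> S 1 \<longleftrightarrow> k = 1" "(x, y) \<in> S 2 \<longleftrightarrow> k = 2" "(y, x) \<in> S 2 \<longleftrightarrow> k = 4"
    "(x, y) \<in> S 3 \<longleftrightarrow> k = 3"
    unfolding assms(2)[symmetric] diagonal using assms(3,4) by (simp_all add: Id_on_iff)
  then show ?thesis using k(1)[unfolded le_4] by (elim disjE) simp_all
qed

lemma scheme_signed_hexagon:
  assumes sch: "assoc_scheme X 4 S" and card: "card X = 63"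
    and sym: "(S 1)\<inverse> = S 1" "(S 2)\<inverse> = S 4"
    and num: "\<And>j k x y. j \<le> 4 \<Longrightarrow> k \<le> 4 \<Longrightarrow> (x, y) \<in> S k \<Longrightarrow>
      card {z \<in> X. (x, z) \<in> S 1 \<and> (z, y) \<in> S j} = scheme_numbers ! 1 ! j ! k"
  shows "signed_hexagon X (\<lambda>x y. (x, y) \<in> S 1) (\<lambda>x y. (x, y) \<in> S 2)"
proof -
  interpret assoc_scheme X 4 S by fact
  have AA: "card {z \<in> X. (x, z) \<in> S 1 \<and> (z, y) \<in> S 1} = [6, 1, 0, 1, 0] ! k"
    and AB: "card {z \<in> X. (x, z) \<in> S 1 \<and> (z, y) \<in> S 2} = [0, 0, 0, 2, 3] ! k"
    and AC: "card {z \<in> X. (x, z) \<in> S 1 \<and> (z, y) \<in> S 4} = [0, 0, 3, 2, 0] ! k"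
    if "k \<le> 4" "(x, y) \<in> S k" for k x y
    using num[OF _ that] by (simp_all add: scheme_numbers_def)
  have sub: "(x, y) \<in> S i \<Longrightarrow> x \<in> X \<and> y \<in> X" if "i \<le> 4" for i x y using S_sub[OF that] by blast
  have conv: "(x, y) \<in> S 1 \<longleftrightarrow> (y, x) \<in> S 1" "(x, y) \<in> S 4 \<longleftrightarrow> (y, x) \<in> S 2" for x y
    using sym by blast+
  have neq: "(x, y) \<in> S i \<Longrightarrow> (x, y) \<in> S j \<Longrightarrow> False" if "i \<le> 4" "j \<le> 4" "i \<noteq> j" for i j x y
    using S_disjoint[OF that(1,2)] that(3) by blast
  have X: "{z. (x, z) \<in> S 1 \<and> Q z} = {z \<in> X. (x, z) \<in> S 1 \<and> Q z}" for x Q using sub[of 1] by auto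
  have rel: "(x = y \<longleftrightarrow> k = 0) \<and> ((x, y) \<in> S 1 \<longleftrightarrow> k = 1) \<and> ((x, y) \<in> S 2 \<longleftrightarrow> k = 2) \<and> ((y, x) \<in> S 2 \<longleftrightarrow> k = 4)"
    if k: "k \<le> 4" "(x, y) \<in> S k" for k x y
  proof -
    have "(x, y) \<in> S i \<longleftrightarrow> k = i" if "i \<le> 4" for i using S_disjoint[OF k(1) that k(2)] k(2) by blast
    from this[of 0] this[of 1] this[of 2] this[of 4] show ?thesis
      using sub[OF k] diagonal conv(2)[of x y] by (simp add: Id_on_iff)
  qed
  show ?thesis
  proof
    show "finite X" by (rule finite_points)
    show "card X = 63" by (rule card)
    show "\<And>x y. (x, y) \<in> S 1 \<Longrightarrow> x \<in> X" using sub[of 1] by simp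
    show "\<And>x y. (x, y) \<in> S 1 \<Longrightarrow> (y, x) \<in> S 1" using conv by blast
    show "(x, x) \<notin> S 1" for x using rel[of 1 x x] by auto
    show "\<And>x y. (x, y) \<in> S 2 \<Longrightarrow> x \<in> X \<and> y \<in> X" using sub[of 2] by simp
    show "(y, x) \<notin> S 2" if "(x, y) \<in> S 2" for x y using rel[of 2 x y] that by auto
    show "(x, y) \<notin> S 2" if "(x, y) \<in> S 1" for x y using rel[of 1 x y] that by auto
  next
    fix x y assume "x \<in> X" "y \<in> X"
    then obtain k where k: "k \<le> 4" "(x, y) \<in> S k" using ex_relation by blast
    note r = rel[OF k]
    show "card {z. (x, z) \<in> S 1 \<and> (z, y) \<in> S 1} =
        (if x = y then 6 else if (x, y) \<in> S 1 then 1 else if (x, y) \<in> S 2 \<or> (y, x) \<in> S 2 then 0 else 1)"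
      unfolding X AA[OF k] using r k(1)[unfolded le_4] by (elim disjE) simp_all
    show "card {z. (x, z) \<in> S 1 \<and> (z, y) \<in> S 2} =
        (if x = y \<or> (x, y) \<in> S 1 \<or> (x, y) \<in> S 2 then 0 else if (y, x) \<in> S 2 then 3 else 2)"
      unfolding X AB[OF k] using r k(1)[unfolded le_4] by (elim disjE) simp_all
    have "{z. (x, z) \<in> S 1 \<and> (y, z) \<in> S 2} = {z \<in> X. (x, z) \<in> S 1 \<and> (z, y) \<in> S 4}"
      using conv(2) sub[of 1] by auto
    then have c: "card {z. (x, z) \<in> S 1 \<and> (y, z) \<in> S 2} = [0, 0, 3, 2, 0] ! k"
      using AC[OF k] by simp
    show "card {z. (x, z) \<in> S 1 \<and> (y, z) \<in> S 2} =
        (if x = y \<or> (x, y) \<in> S 1 \<or> (y, x) \<in> S 2 then 0 else if (x, y) \<in> S 2 then 3 else 2)"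
      unfolding c using r k(1)[unfolded le_4] by (elim disjE) simp_all
  qed
qed

text \<open>A nonzero intersection number at the diagonal identifies the transpose of a relation and
  is its valency; the valencies 1, 6, 16, 24, 16 add up to 63.\<close>

lemma eigenmatrix_signed_hexagon:
  assumes "commutative_assoc_scheme X 4 S" "is_first_eigenmatrix X 4 S P_matrix"
  shows "signed_hexagon X (\<lambda>x y. (x, y) \<in> S 1) (\<lambda>x y. (x, y) \<in> S 2)" "(S 1)\<inverse> = S 1" "(S 2)\<inverse> = S 4"
proof -
  interpret commutative_assoc_scheme X 4 S by fact
  have num: "card {z \<in> X. (x, z) \<in> S i \<and> (z, y) \<in> S j} = scheme_numbers ! i ! j ! k"
    if "i \<le> 4" "j \<le> 4" "k \<le> 4" "(x, y) \<in> S k" for i j k x y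
    by (rule eigenmatrix_intersection[OF assms(2) P_matrix_numbers[OF that(1,2)] that])
  have diag: "(x, x) \<in> S 0" if "x \<in> X" for x using diagonal that by auto
  obtain x y where "(x, y) \<in> S 0" using nonempty[of 0] by fast
  then have x: "x \<in> X" using S_sub[of 0] by auto
  note d = diag[OF x]
  have n0: "card {z \<in> X. (x, z) \<in> S i \<and> (z, x) \<in> S j} = scheme_numbers ! i ! j ! 0"
    if "i \<le> 4" "j \<le> 4" for i j using num[OF that _ d] by simp
  have conv: "(S i)\<inverse> = S j" if ij: "i \<le> 4" "j \<le> 4" and n: "card {z \<in> X. (x, z) \<in> S i \<and> (z, x) \<in> S j} \<noteq> 0" for i j
  proof -
    from n have "{z \<in> X. (x, z) \<in> S i \<and> (z, x) \<in> S j} \<noteq> {}" by (metis card.empty)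
    then obtain z where z: "(x, z) \<in> S i" "(z, x) \<in> S j" by blast
    obtain k where k: "k \<le> 4" "S k = (S i)\<inverse>" using transpose[OF ij(1)] by blast
    then have "(z, x) \<in> S k" using z by simp
    then show ?thesis using S_disjoint[OF k(1) ij(2) _ z(2)] k(2) by simp
  qed
  show s1: "(S 1)\<inverse> = S 1" by (rule conv) (use n0[of 1 1] in \<open>auto simp: scheme_numbers_def\<close>)
  show s2: "(S 2)\<inverse> = S 4" by (rule conv) (use n0[of 2 4] in \<open>auto simp: scheme_numbers_def\<close>)
  have s4: "(S 4)\<inverse> = S 2" unfolding s2[symmetric] by simp
  have s3: "(S 3)\<inverse> = S 3" by (rule conv) (use n0[of 3 3] in \<open>auto simp: scheme_numbers_def\<close>)
  define N where "N i = {z \<in> X. (x, z) \<in> S i}" for i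
  have N: "N i = {z \<in> X. (x, z) \<in> S i \<and> (z, x) \<in> S j}" if "(S i)\<inverse> = S j" for i j
  proof -
    have "(z, x) \<in> S j \<longleftrightarrow> (x, z) \<in> S i" for z unfolding that[symmetric] by simp
    then show ?thesis unfolding N_def by simp
  qed
  have "N 0 = {x}" using diagonal x by (auto simp: N_def)
  then have c0: "card (N 0) = 1" by simp
  have c: "card (N i) = scheme_numbers ! i ! j ! 0" if "(S i)\<inverse> = S j" "i \<le> 4" "j \<le> 4" for i j
    unfolding N[OF that(1)] by (rule n0[OF that(2,3)])
  note cs = c0 c[OF s1] c[OF s2] c[OF s3] c[OF s4]
  have "X = (\<Union>i\<in>{0,1,2,3,4}. N i)"
    using ex_relation[OF x] x by (auto simp: N_def le_4)
  then have "card X = card (\<Union>i\<in>{0,1,2,3,4}. N i)" by simp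
  also have "\<dots> = (\<Sum>i\<in>{0,1,2,3,4}. card (N i))"
  proof (rule card_UN_disjoint)
    show "\<forall>i\<in>{0,1,2,3,4}. finite (N i)" using finite_points by (simp add: N_def)
    have "N i \<inter> N j = {}" if "i \<le> 4" "j \<le> 4" "i \<noteq> j" for i j
      using S_disjoint[OF that(1,2)] that(3) by (auto simp: N_def)
    then show "\<forall>i\<in>{0,1,2,3,4}. \<forall>j\<in>{0,1,2,3,4}. i \<noteq> j \<longrightarrow> N i \<inter> N j = {}" by auto
  qed simp
  also have "\<dots> = 63" using cs by (simp add: scheme_numbers_def)
  finally have "card X = 63" .
  then show "signed_hexagon X (\<lambda>x y. (x, y) \<in> S 1) (\<lambda>x y. (x, y) \<in> S 2)"
    by (rule scheme_signed_hexagon[OF assoc_scheme_axioms _ s1 s2 num]) simp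
qed

lemma scheme_isomorphic:
  assumes sch: "assoc_scheme X 4 S" "assoc_scheme Y 4 T"
    and S: "signed_hexagon X (\<lambda>x y. (x, y) \<in> S 1) (\<lambda>x y. (x, y) \<in> S 2)" "(S 2)\<inverse> = S 4"
    and T: "signed_hexagon Y (\<lambda>x y. (x, y) \<in> T 1) (\<lambda>x y. (x, y) \<in> T 2)" "(T 2)\<inverse> = T 4"
  shows "isomorphic_schemes 4 X S Y T"
proof -
  interpret s: assoc_scheme X 4 S by fact
  interpret t: assoc_scheme Y 4 T by fact
  from signed_hexagon_unique[OF S(1) T(1)] obtain f where f: "bij_betw f X Y"
    and f1: "\<forall>x\<in>X. \<forall>y\<in>X. (x, y) \<in> S 1 \<longleftrightarrow> (f x, f y) \<in> T 1"
    and f2: "(\<forall>x\<in>X. \<forall>y\<in>X. (x, y) \<in> S 2 \<longleftrightarrow> (f x, f y) \<in> T 2) \<or>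
      (\<forall>x\<in>X. \<forall>y\<in>X. (x, y) \<in> S 2 \<longleftrightarrow> (f y, f x) \<in> T 2)"
    by (elim exE conjE) (rule that)
  have im: "map_prod f f ` S i = T j" if ij: "i \<le> 4" "j \<le> 4"
    and r: "\<And>x y. x \<in> X \<Longrightarrow> y \<in> X \<Longrightarrow> (x, y) \<in> S i \<longleftrightarrow> (f x, f y) \<in> T j" for i j
  proof
    show "map_prod f f ` S i \<subseteq> T j"
    proof
      fix p assume "p \<in> map_prod f f ` S i"
      then obtain x y where p: "(x, y) \<in> S i" "p = (f x, f y)" by auto
      then show "p \<in> T j" using r[of x y] s.S_sub[OF ij(1)] by auto
    qed
    show "T j \<subseteq> map_prod f f ` S i"
    proof
      fix p assume p: "p \<in> T j"
      then have "fst p \<in> f ` X" "snd p \<in> f ` X"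
        using t.S_sub[OF ij(2)] f by (auto simp: bij_betw_def)
      then obtain x y where "x \<in> X" "fst p = f x" "y \<in> X" "snd p = f y" by blast
      then have "x \<in> X" "y \<in> X" "p = (f x, f y)" by (simp_all add: prod_eq_iff)
      then show "p \<in> map_prod f f ` S i" using p r[of x y] by (intro image_eqI[of _ _ "(x, y)"]) auto
    qed
  qed
  have inj: "f x = f y \<longleftrightarrow> x = y" if "x \<in> X" "y \<in> X" for x y
    using f that by (auto simp: bij_betw_def inj_on_def)
  have fY: "f x \<in> Y" if "x \<in> X" for x using f that by (auto simp: bij_betw_def)
  have 0: "map_prod f f ` S 0 = T 0"
    by (rule im) (auto simp: s.diagonal t.diagonal inj fY)
  have 1: "map_prod f f ` S 1 = T 1" by (rule im) (use f1 in auto)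
  have S4: "(x, y) \<in> S 4 \<longleftrightarrow> (y, x) \<in> S 2" and T4: "(u, v) \<in> T 4 \<longleftrightarrow> (v, u) \<in> T 2" for x y u v
    unfolding S(2)[symmetric] T(2)[symmetric] by simp_all
  note S3 = s.relation_3[OF refl S(2)] and T3 = t.relation_3[OF refl T(2)]
  have 3: "map_prod f f ` S 3 = T 3"
    by (rule im) (use f1 f2 inj fY in \<open>auto simp: S3 T3\<close>)
  have im4: "(\<lambda>R. map_prod f f ` R) ` S ` {..4} =
      {map_prod f f ` S 0, map_prod f f ` S 1, map_prod f f ` S 2, map_prod f f ` S 3, map_prod f f ` S 4}"
    by (simp add: atMost_4)
  have T4': "T ` {..4} = {T 0, T 1, T 2, T 3, T 4}" by (simp add: atMost_4)
  from f2 have "(\<lambda>R. map_prod f f ` R) ` S ` {..4} = T ` {..4}"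
  proof
    assume *: "\<forall>x\<in>X. \<forall>y\<in>X. (x, y) \<in> S 2 \<longleftrightarrow> (f x, f y) \<in> T 2"
    have "map_prod f f ` S 2 = T 2" "map_prod f f ` S 4 = T 4"
      by (rule im; use * S4 T4 in auto)+
    then show ?thesis unfolding im4 T4' 0 1 3 by simp
  next
    \<comment> \<open>Reversed signs only exchange the images of \<open>S 2\<close> and
      \<open>S 4\<close>, and \<open>isomorphic_schemes\<close> compares sets of relations.\<close>
    assume *: "\<forall>x\<in>X. \<forall>y\<in>X. (x, y) \<in> S 2 \<longleftrightarrow> (f y, f x) \<in> T 2"
    have "map_prod f f ` S 2 = T 4" "map_prod f f ` S 4 = T 2"
      by (rule im; use * S4 T4 in auto)+
    then show ?thesis unfolding im4 T4' 0 1 3 by auto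
  qed
  with f show ?thesis unfolding isomorphic_schemes_def by (intro exI[of _ f] conjI)
qed

lemma mat_mult_scale_right: "mat_mult X F (\<lambda>x y. a * G x y) = (\<lambda>x y. a * mat_mult X F G x y)"
  by (simp add: mat_mult_def sum_distrib_left mult_ac)

context commutative_assoc_scheme begin

text \<open>With \<open>Q\<close> inverse to \<open>P\<close>, the matrices \<open>E r\<close> built
  from the columns of \<open>Q\<close> are orthogonal idempotents and simultaneous eigenvectors for
  multiplication. Every idempotent then has coefficients 0 and 1 in the \<open>E r\<close>, so the
  primitive ones are precisely the \<open>E r\<close>.\<close>

lemma eigenmatrix_criterion:
  assumes c: "\<And>i j. i \<le> d \<Longrightarrow> j \<le> d \<Longrightarrow>
      mat_mult X (adjacency (S i)) (adjacency (S j)) = (\<lambda>x y. \<Sum>k\<le>d. c i j k * adjacency (S k) x y)"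
    and P: "\<And>i j r. i \<le> d \<Longrightarrow> j \<le> d \<Longrightarrow> r \<le> d \<Longrightarrow> (\<Sum>k\<le>d. c i j k * P r k) = P r i * P r j"
    and PQ: "\<And>i j. i \<le> d \<Longrightarrow> j \<le> d \<Longrightarrow> (\<Sum>k\<le>d. P i k * Q k j) = of_bool (i = j)"
    and QP: "\<And>i j. i \<le> d \<Longrightarrow> j \<le> d \<Longrightarrow> (\<Sum>k\<le>d. Q i k * P k j) = of_bool (i = j)"
  shows "is_first_eigenmatrix X d S P"
proof -
  define M where "M j = adjacency (S j)" for j
  define E where "E r = (\<lambda>x y. \<Sum>k\<le>d. Q k r * M k x y)" for r
  have ME: "M j = (\<lambda>x y. \<Sum>r\<le>d. P r j * E r x y)" if j: "j \<le> d" for j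
  proof (intro ext)
    fix x y
    have "(\<Sum>r\<le>d. P r j * E r x y) = (\<Sum>r\<le>d. \<Sum>k\<le>d. Q k r * P r j * M k x y)"
      by (simp add: E_def sum_distrib_left mult_ac)
    also have "\<dots> = (\<Sum>k\<le>d. \<Sum>r\<le>d. Q k r * P r j * M k x y)" by (rule sum.swap)
    also have "\<dots> = (\<Sum>k\<le>d. of_bool (k = j) * M k x y)"
      by (intro sum.cong refl) (simp add: QP[OF _ j] flip: sum_distrib_right)
    also have "\<dots> = (\<Sum>k\<in>{j}. of_bool (k = j) * M k x y)"
      by (rule sum.mono_neutral_right) (use j in auto)
    finally show "M j x y = (\<Sum>r\<le>d. P r j * E r x y)" by simp
  qed
  have M_E: "mat_mult X (M j) (E r) = (\<lambda>x y. P r j * E r x y)" if j: "j \<le> d" and r: "r \<le> d" for j r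
  proof (intro ext)
    fix x y
    have prod: "mat_mult X (M j) (M k) x y = (\<Sum>s\<le>d. P s j * P s k * E s x y)" if k: "k \<le> d" for k
    proof -
      have "mat_mult X (M j) (M k) x y = (\<Sum>l\<le>d. c j k l * (\<Sum>s\<le>d. P s l * E s x y))"
        unfolding M_def c[OF j k] by (intro sum.cong refl) (simp add: fun_cong[OF fun_cong[OF ME[unfolded M_def]]])
      also have "\<dots> = (\<Sum>l\<le>d. \<Sum>s\<le>d. c j k l * P s l * E s x y)"
        by (simp add: sum_distrib_left mult.assoc)
      also have "\<dots> = (\<Sum>s\<le>d. \<Sum>l\<le>d. c j k l * P s l * E s x y)" by (rule sum.swap)
      also have "\<dots> = (\<Sum>s\<le>d. P s j * P s k * E s x y)"
        by (intro sum.cong refl) (simp add: P[OF j k] flip: sum_distrib_right)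
      finally show ?thesis .
    qed
    have "mat_mult X (M j) (E r) x y = (\<Sum>k\<le>d. Q k r * (\<Sum>s\<le>d. P s j * P s k * E s x y))"
      unfolding E_def[of r] mat_mult_sum_right by (intro sum.cong refl) (simp add: prod)
    also have "\<dots> = (\<Sum>k\<le>d. \<Sum>s\<le>d. P s k * Q k r * (P s j * E s x y))"
      by (simp add: sum_distrib_left mult_ac)
    also have "\<dots> = (\<Sum>s\<le>d. \<Sum>k\<le>d. P s k * Q k r * (P s j * E s x y))" by (rule sum.swap)
    also have "\<dots> = (\<Sum>s\<le>d. of_bool (s = r) * (P s j * E s x y))"
      by (intro sum.cong refl) (simp add: PQ[OF _ r] flip: sum_distrib_right)
    also have "\<dots> = (\<Sum>s\<in>{r}. of_bool (s = r) * (P s j * E s x y))"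
      by (rule sum.mono_neutral_right) (use r in auto)
    finally show "mat_mult X (M j) (E r) x y = P r j * E r x y" by simp
  qed
  have alg: "\<exists>f. F = (\<lambda>x y. \<Sum>r\<le>d. f r * E r x y) \<and> (\<forall>r\<le>d. mat_mult X F (E r) = (\<lambda>x y. f r * E r x y))"
    if FB: "F \<in> bose_mesner d S" for F
  proof -
    obtain a where F: "F = (\<lambda>x y. \<Sum>j\<le>d. a j * M j x y)"
      using FB unfolding bose_mesner_iff M_def by (elim exE)
    have "F x y = (\<Sum>r\<le>d. (\<Sum>j\<le>d. a j * P r j) * E r x y)" for x y
    proof -
      have "F x y = (\<Sum>j\<le>d. \<Sum>r\<le>d. a j * P r j * E r x y)"
        unfolding F by (intro sum.cong refl) (simp add: fun_cong[OF fun_cong[OF ME]] sum_distrib_left mult.assoc)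
      also have "\<dots> = (\<Sum>r\<le>d. \<Sum>j\<le>d. a j * P r j * E r x y)" by (rule sum.swap)
      finally show ?thesis by (simp add: sum_distrib_right)
    qed
    moreover have "mat_mult X F (E r) = (\<lambda>x y. (\<Sum>j\<le>d. a j * P r j) * E r x y)" if "r \<le> d" for r
      unfolding F mat_mult_sum_left
      by (intro ext) (simp add: M_E that sum_distrib_right mult.assoc)
    ultimately show ?thesis by (intro exI[of _ "\<lambda>r. \<Sum>j\<le>d. a j * P r j"]) auto
  qed
  have EE: "mat_mult X (E s) (E r) = (\<lambda>x y. of_bool (r = s) * E r x y)" if "s \<le> d" "r \<le> d" for s r
  proof (intro ext)
    fix x y
    have "mat_mult X (E s) (E r) x y = (\<Sum>j\<le>d. P r j * Q j s * E r x y)"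
      unfolding E_def[of s] mat_mult_sum_left by (intro sum.cong refl) (simp add: M_E that mult_ac)
    then show "mat_mult X (E s) (E r) x y = of_bool (r = s) * E r x y"
      using PQ[OF that(2,1)] by (simp flip: sum_distrib_right)
  qed
  have E_BM: "E r \<in> bose_mesner d S" for r
    by (rule bose_mesner_memI[where c = "\<lambda>k. Q k r"]) (simp add: E_def M_def)
  have E_nz: "\<exists>x y. E r x y \<noteq> 0" if r: "r \<le> d" for r
  proof (rule ccontr)
    assume z: "\<not> (\<exists>x y. E r x y \<noteq> 0)"
    have "Q k r = 0" if k: "k \<le> d" for k
    proof -
      obtain x y where xy: "(x, y) \<in> S k" using nonempty[OF k] by fast
      have "E r x y = Q k r" unfolding E_def M_def by (rule adjacency_sum[OF k xy])
      then show ?thesis using z by auto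
    qed
    then have "(\<Sum>k\<le>d. P r k * Q k r) = 0" by (intro sum.neutral) auto
    then show False using PQ[OF r r] by simp
  qed
  have E_cancel: "a = b" if eq: "(\<lambda>x y. a * E r x y) = (\<lambda>x y. b * E r x y)" and r: "r \<le> d" for a b r
  proof -
    obtain x y where "E r x y \<noteq> 0" using E_nz[OF r] by blast
    moreover have "a * E r x y = b * E r x y" using fun_cong[OF fun_cong[OF eq]] .
    ultimately show ?thesis by simp
  qed
  have E_idem: "E r \<in> nonzero_idempotents X d S" if r: "r \<le> d" for r
    using E_BM EE[OF r r] E_nz[OF r] unfolding nonzero_idempotents_def by (auto simp: fun_eq_iff)
  have idem: "\<exists>f. F = (\<lambda>x y. \<Sum>r\<le>d. f r * E r x y) \<and> (\<forall>r\<le>d. (f r = 0 \<or> f r = 1) \<and>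
      mat_mult X F (E r) = (\<lambda>x y. f r * E r x y))"
    if "F \<in> nonzero_idempotents X d S" for F
  proof -
    have F: "F \<in> bose_mesner d S" "mat_mult X F F = F" using that by (auto simp: nonzero_idempotents_def)
    from alg[OF F(1)] obtain f where f: "F = (\<lambda>x y. \<Sum>r\<le>d. f r * E r x y)"
      "\<forall>r\<le>d. mat_mult X F (E r) = (\<lambda>x y. f r * E r x y)" by (elim exE conjE)
    have "f r = 0 \<or> f r = 1" if r: "r \<le> d" for r
    proof -
      have FE: "mat_mult X F (E r) = (\<lambda>x y. f r * E r x y)" using f(2) r by blast
      have "mat_mult X (mat_mult X F F) (E r) = (\<lambda>x y. f r * (f r * E r x y))"
        unfolding mat_mult_assoc[OF finite_points] FE mat_mult_scale_right ..
      then have "(\<lambda>x y. f r * f r * E r x y) = (\<lambda>x y. f r * E r x y)"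
        unfolding F(2) FE by (simp add: mult.assoc)
      from E_cancel[OF this r] show ?thesis by simp
    qed
    then show ?thesis using f by (intro exI[of _ f]) auto
  qed
  have nonzero: "\<exists>r\<le>d. f r \<noteq> 0" if "F = (\<lambda>x y. \<Sum>r\<le>d. f r * E r x y)" "F \<noteq> (\<lambda>x y. 0)" for F and f :: "nat \<Rightarrow> complex"
  proof (rule ccontr)
    assume "\<not> (\<exists>r\<le>d. f r \<noteq> 0)"
    then have "F = (\<lambda>x y. 0)" unfolding that(1) by (intro ext sum.neutral) auto
    then show False using that(2) by simp
  qed
  have add: "mat_mult X (\<lambda>x y. F x y + G x y) H = (\<lambda>x y. mat_mult X F H x y + mat_mult X G H x y)" for F G H
    by (simp add: mat_mult_def distrib_right sum.distrib)
  have E_prim: "E r \<in> primitive_idempotents X d S" if r: "r \<le> d" for r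
  proof -
    have False if F: "F \<in> nonzero_idempotents X d S" and G: "G \<in> nonzero_idempotents X d S"
      and sum: "E r = (\<lambda>x y. F x y + G x y)" for F G
    proof -
      from idem[OF F] obtain f where f: "F = (\<lambda>x y. \<Sum>r\<le>d. f r * E r x y)"
        "\<forall>r\<le>d. (f r = 0 \<or> f r = 1) \<and> mat_mult X F (E r) = (\<lambda>x y. f r * E r x y)" by (elim exE conjE)
      from idem[OF G] obtain g where g: "G = (\<lambda>x y. \<Sum>r\<le>d. g r * E r x y)"
        "\<forall>r\<le>d. (g r = 0 \<or> g r = 1) \<and> mat_mult X G (E r) = (\<lambda>x y. g r * E r x y)" by (elim exE conjE)
      have fg: "f s + g s = of_bool (s = r)" if s: "s \<le> d" for s
      proof -
        have "mat_mult X (\<lambda>x y. F x y + G x y) (E s) = (\<lambda>x y. of_bool (s = r) * E s x y)"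
          using EE[OF r s] sum by simp
        moreover have "mat_mult X (\<lambda>x y. F x y + G x y) (E s) = (\<lambda>x y. (f s + g s) * E s x y)"
          using f(2) g(2) s by (simp add: add distrib_right)
        ultimately show ?thesis using E_cancel[OF _ s] by metis
      qed
      obtain s where s: "s \<le> d" "f s \<noteq> 0" using nonzero[OF f(1)] F by (auto simp: nonzero_idempotents_def)
      obtain t where t: "t \<le> d" "g t \<noteq> 0" using nonzero[OF g(1)] G by (auto simp: nonzero_idempotents_def)
      have v: "f s = 1" "g t = 1" "f t = 0 \<or> f t = 1" "g s = 0 \<or> g s = 1"
        using f(2) g(2) s t by blast+
      have "s = r" using fg[OF s(1)] v by (auto simp: of_bool_def split: if_splits)
      moreover have "t = r" using fg[OF t(1)] v by (auto simp: of_bool_def split: if_splits)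
      ultimately show False using fg[OF r] v by simp
    qed
    then show ?thesis unfolding primitive_idempotents_def using E_idem[OF r] by blast
  qed
  have prim_E: "F \<in> E ` {..d}" if F: "F \<in> primitive_idempotents X d S" for F
  proof (rule ccontr)
    assume notin: "F \<notin> E ` {..d}"
    have F': "F \<in> nonzero_idempotents X d S" using F by (simp add: primitive_idempotents_def)
    from idem[OF F'] obtain f where f: "F = (\<lambda>x y. \<Sum>r\<le>d. f r * E r x y)"
      "\<forall>r\<le>d. (f r = 0 \<or> f r = 1) \<and> mat_mult X F (E r) = (\<lambda>x y. f r * E r x y)" by (elim exE conjE)
    obtain r where r: "r \<le> d" "f r \<noteq> 0" using nonzero[OF f(1)] F' by (auto simp: nonzero_idempotents_def)
    have "F \<noteq> E r" using notin r(1) by auto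
    from primitive_orthogonal[OF F E_prim[OF r(1)] this]
    have "(\<lambda>x y. f r * E r x y) = (\<lambda>x y. 0 * E r x y)" using f(2) r(1) by simp
    then show False using E_cancel[OF _ r(1)] r(2) by blast
  qed
  have "inj_on E {..d}"
  proof (rule inj_onI)
    fix r s assume rs: "r \<in> {..d}" "s \<in> {..d}" "E r = E s"
    then have "(\<lambda>x y. of_bool (r = s) * E r x y) = (\<lambda>x y. 1 * E r x y)"
      using EE[of s r] EE[of r r] by simp
    then have "(of_bool (r = s) :: complex) = 1" using E_cancel rs by blast
    then show "r = s" by (simp split: if_splits)
  qed
  moreover have "E ` {..d} = primitive_idempotents X d S"
  proof
    show "E ` {..d} \<subseteq> primitive_idempotents X d S" using E_prim by (intro image_subsetI) simp
    show "primitive_idempotents X d S \<subseteq> E ` {..d}" by (intro subsetI) (rule prim_E)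
  qed
  ultimately have "bij_betw E {..d} (primitive_idempotents X d S)" unfolding bij_betw_def by (intro conjI)
  moreover have "\<forall>j\<le>d. adjacency (S j) = (\<lambda>x y. \<Sum>i\<le>d. P i j * E i x y)"
    using ME unfolding M_def by (intro allI impI)
  ultimately show ?thesis unfolding is_first_eigenmatrix_def by (intro exI[of _ E] conjI)
qed

end

section \<open>From a signed hexagon to the scheme\<close>

text \<open>Five explicit coefficients instead of an indexed sum, so that the multiplication table
  consists of rewrite rules with literal entries.\<close>

definition lincomb :: "(nat \<Rightarrow> 'a \<Rightarrow> 'a \<Rightarrow> complex) \<Rightarrow> complex \<Rightarrow> complex \<Rightarrow> complex \<Rightarrow> complex \<Rightarrow> complex \<Rightarrow> 'a \<Rightarrow> 'a \<Rightarrow> complex" where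
  "lincomb M a b c d e = (\<lambda>x y. a * M 0 x y + b * M 1 x y + c * M 2 x y + d * M 3 x y + e * M 4 x y)"

lemma mat_mult_lincomb:
  "mat_mult X F (lincomb M a b c d e) x y = a * mat_mult X F (M 0) x y + b * mat_mult X F (M 1) x y +
    c * mat_mult X F (M 2) x y + d * mat_mult X F (M 3) x y + e * mat_mult X F (M 4) x y"
  "mat_mult X (lincomb M a b c d e) F x y = a * mat_mult X (M 0) F x y + b * mat_mult X (M 1) F x y +
    c * mat_mult X (M 2) F x y + d * mat_mult X (M 3) F x y + e * mat_mult X (M 4) F x y"
  by (simp_all add: mat_mult_def lincomb_def sum.distrib sum_distrib_left algebra_simps)

text \<open>The inverse of \<open>P_matrix\<close>: the second eigenmatrix divided by the number of
  points. Its first row lists the multiplicities 1, 21, 27, 7, 7 before the division.\<close>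

definition Q_matrix :: "nat \<Rightarrow> nat \<Rightarrow> complex" where
  "Q_matrix i j =
    [[1, 21, 27, 7, 7],
     [1, 21 / 2, - 9 / 2, - 7 / 2, - 7 / 2],
     [1, - 21 / 8, 27 / 8, (- 7 - 21 * \<i>) / 8, (- 7 + 21 * \<i>) / 8],
     [1, 0, - 9 / 2, 7 / 4, 7 / 4],
     [1, - 21 / 8, 27 / 8, (- 7 + 21 * \<i>) / 8, (- 7 - 21 * \<i>) / 8]] ! i ! j / 63"

lemma PQ_matrix:
  assumes "i \<le> 4" "j \<le> 4"
  shows "(\<Sum>k\<le>4. P_matrix i k * Q_matrix k j) = of_bool (i = j)"
    "(\<Sum>k\<le>4. Q_matrix i k * P_matrix k j) = of_bool (i = j)"
  using assms[unfolded le_4]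
  by (elim disjE; simp add: atMost_4 P_matrix_def Q_matrix_def complex_eq_iff)+

text \<open>Keeps the index in \<open>rel 1\<close> and \<open>M 1\<close> from turning into
  \<open>Suc 0\<close>.\<close>

declare One_nat_def [simp del]

context signed_hexagon begin

definition rel :: "nat \<Rightarrow> ('a \<times> 'a) set" where
  "rel i = (if i = 0 then Id_on X else if i = 1 then {(x, y). A x y} else if i = 2 then {(x, y). B x y}
    else if i = 3 then {(x, y). D x y} else {(x, y). B y x})"

abbreviation mm (infixl "\<otimes>" 70) where "F \<otimes> G \<equiv> mat_mult X F G"
abbreviation lc where "lc \<equiv> lincomb (\<lambda>i. adjacency (rel i))"
abbreviation M where "M i \<equiv> adjacency (rel i)"

lemma M_simps:
  "M 0 x y = of_bool (x = y \<and> x \<in> X)" "M 1 x y = of_bool (A x y)" "M 2 x y = of_bool (B x y)"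
  "M 3 x y = of_bool (D x y)" "M 4 x y = of_bool (B y x)"
  by (auto simp: adjacency_def rel_def)

lemma outside: "x \<notin> X \<or> y \<notin> X \<Longrightarrow> \<not> A x y \<and> \<not> B x y \<and> \<not> D x y \<and> \<not> B y x"
  using A_in A_in2 B_in by (auto simp: D_def)

lemma cases_rel:
  assumes "x \<in> X" "y \<in> X"
  obtains "x = y" "\<not> A x y" "\<not> B x y" "\<not> D x y" "\<not> B y x"
  | "x \<noteq> y" "A x y" "\<not> B x y" "\<not> D x y" "\<not> B y x"
  | "x \<noteq> y" "\<not> A x y" "B x y" "\<not> D x y" "\<not> B y x"
  | "x \<noteq> y" "\<not> A x y" "\<not> B x y" "D x y" "\<not> B y x"
  | "x \<noteq> y" "\<not> A x y" "\<not> B x y" "\<not> D x y" "B y x"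
proof -
  have "A x y \<longrightarrow> x \<noteq> y \<and> \<not> B x y \<and> \<not> B y x" "B x y \<longrightarrow> x \<noteq> y \<and> \<not> B y x" "B y x \<longrightarrow> x \<noteq> y"
    using A_irrefl A_not_B A_sym B_antisym by blast+
  moreover have "D x y \<longleftrightarrow> x \<noteq> y \<and> \<not> A x y \<and> \<not> B x y \<and> \<not> B y x"
    using assms by (auto simp: D_def opp_def)
  ultimately show ?thesis using that by argo
qed

lemma mat_mult_outside:
  assumes "x \<notin> X \<or> y \<notin> X"
  shows "(M i \<otimes> M j) x y = 0"
  using assms A_in A_in2 B_in unfolding mat_mult_def adjacency_def
  by (intro sum.neutral) (auto simp: rel_def D_def)

lemma lc_outside: "x \<notin> X \<or> y \<notin> X \<Longrightarrow> lc a b c d e x y = 0"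
  using outside[of x y] by (auto simp: lincomb_def M_simps)

lemma lc_eqI:
  assumes "\<And>x y. x \<in> X \<Longrightarrow> y \<in> X \<Longrightarrow> (M i \<otimes> M j) x y = lc a b c d e x y"
  shows "M i \<otimes> M j = lc a b c d e"
  using assms mat_mult_outside[of _ _ i j] lc_outside[of _ _ a b c d e] by (intro ext) metis

lemma lc_transpose: "lc a b c d e y x = lc a b e d c x y"
  by (auto simp: lincomb_def M_simps A_commute D_sym)

lemma M_transpose: "(M i \<otimes> M j) y x = (M j' \<otimes> M i') x y"
  if "(i, i') \<in> {(0,0), (1,1), (2,4), (3,3), (4,2)}" "(j, j') \<in> {(0,0), (1,1), (2,4), (3,3), (4,2)}"
proof -
  have "M k y x = M k' x y" if "(k, k') \<in> {(0,0), (1,1), (2,4), (3,3), (4,2)}" for k k' x y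
    using that by (auto simp: M_simps A_commute D_sym)
  from this[OF that(1)] this[OF that(2)] show ?thesis
    by (simp add: mat_mult_def mult.commute)
qed

lemma product_transpose:
  assumes "M i \<otimes> M j = lc a b c d e"
    "(i, i') \<in> {(0,0), (1,1), (2,4), (3,3), (4,2)}" "(j, j') \<in> {(0,0), (1,1), (2,4), (3,3), (4,2)}"
  shows "M j' \<otimes> M i' = lc a b e d c"
proof (intro ext)
  fix x y
  show "(M j' \<otimes> M i') x y = lc a b e d c x y"
    using M_transpose[OF assms(2,3), of y x] assms(1) lc_transpose[of a b c d e y x] by simp
qed

lemma M_card:
  assumes "x \<in> X" "y \<in> X"
  shows "(M i \<otimes> M j) x y = of_nat (card {z \<in> X. (x, z) \<in> rel i \<and> (z, y) \<in> rel j})"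
  by (rule mat_mult_adjacency[OF finite_X])

section \<open>The multiplication table\<close>

lemma product_1:
  "M 1 \<otimes> M 1 = lc 6 1 0 1 0" "M 1 \<otimes> M 2 = lc 0 0 0 2 3" "M 1 \<otimes> M 4 = lc 0 0 3 2 0"
proof -
  have X: "{z \<in> X. (x, z) \<in> rel 1 \<and> Q z} = {z. A x z \<and> Q z}" for x Q
    using A_in2 by (auto simp: rel_def)
  have r: "(z, y) \<in> rel 1 \<longleftrightarrow> A z y" "(z, y) \<in> rel 2 \<longleftrightarrow> B z y" "(z, y) \<in> rel 4 \<longleftrightarrow> B y z" for z y
    by (auto simp: rel_def)
  show "M 1 \<otimes> M 1 = lc 6 1 0 1 0"
  proof (rule lc_eqI)
    fix x y assume xy: "x \<in> X" "y \<in> X"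
    show "(M 1 \<otimes> M 1) x y = lc 6 1 0 1 0 x y"
      unfolding M_card[OF xy] X unfolding r AA[OF xy]
      by (rule cases_rel[OF xy]) (simp_all add: lincomb_def M_simps xy)
  qed
  show "M 1 \<otimes> M 2 = lc 0 0 0 2 3"
  proof (rule lc_eqI)
    fix x y assume xy: "x \<in> X" "y \<in> X"
    show "(M 1 \<otimes> M 2) x y = lc 0 0 0 2 3 x y"
      unfolding M_card[OF xy] X unfolding r AB[OF xy]
      by (rule cases_rel[OF xy]) (simp_all add: lincomb_def M_simps xy)
  qed
  show "M 1 \<otimes> M 4 = lc 0 0 3 2 0"
  proof (rule lc_eqI)
    fix x y assume xy: "x \<in> X" "y \<in> X"
    show "(M 1 \<otimes> M 4) x y = lc 0 0 3 2 0 x y"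
      unfolding M_card[OF xy] X unfolding r AC[OF xy]
      by (rule cases_rel[OF xy]) (simp_all add: lincomb_def M_simps xy)
  qed
qed

lemma product_0:
  "M 0 \<otimes> M j = M j" "M j \<otimes> M 0 = M j"
proof -
  have "(M 0 \<otimes> M j) x y = M j x y" "(M j \<otimes> M 0) x y = M j x y" if xy: "x \<in> X" "y \<in> X" for x y
  proof -
    have "(M 0 \<otimes> M j) x y = (\<Sum>z\<in>{x}. of_bool (x = z \<and> x \<in> X) * M j z y)"
      unfolding mat_mult_def M_simps using finite_X xy by (intro sum.mono_neutral_right) auto
    then show "(M 0 \<otimes> M j) x y = M j x y" using xy by simp
    have "(M j \<otimes> M 0) x y = (\<Sum>z\<in>{y}. M j x z * of_bool (z = y \<and> z \<in> X))"
      unfolding mat_mult_def M_simps using finite_X xy by (intro sum.mono_neutral_right) auto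
    then show "(M j \<otimes> M 0) x y = M j x y" using xy by simp
  qed
  moreover have "M j x y = 0" if "x \<notin> X \<or> y \<notin> X" for x y
    using outside[OF that] that by (auto simp: adjacency_def rel_def)
  ultimately show "M 0 \<otimes> M j = M j" "M j \<otimes> M 0 = M j"
    using mat_mult_outside[of _ _ 0 j] mat_mult_outside[of _ _ j 0] by (intro ext; metis)+
qed

lemma all_one: "x \<in> X \<Longrightarrow> y \<in> X \<Longrightarrow> lc 1 1 1 1 1 x y = 1"
  by (rule cases_rel[of x y]) (simp_all add: lincomb_def M_simps)

lemma row_sum:
  assumes "\<And>x. x \<in> X \<Longrightarrow> card {z. (x, z) \<in> rel i} = k" "x \<in> X" "y \<in> X" "i \<le> 4"
  shows "(M i \<otimes> lc 1 1 1 1 1) x y = of_nat k"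
proof -
  have "(M i \<otimes> lc 1 1 1 1 1) x y = (\<Sum>z\<in>X. if (x, z) \<in> rel i then 1 else 0)"
    unfolding mat_mult_def
  proof (rule sum.cong)
    fix z assume "z \<in> X"
    then have "lc 1 1 1 1 1 z y = 1" by (rule all_one[OF _ assms(3)])
    then show "M i x z * lc 1 1 1 1 1 z y = (if (x, z) \<in> rel i then 1 else 0)"
      by (simp only:) (simp add: adjacency_def)
  qed simp
  also have "\<dots> = (\<Sum>z\<in>{z. (x, z) \<in> rel i}. 1)"
  proof (rule sum.mono_neutral_cong_right[OF finite_X])
    show "{z. (x, z) \<in> rel i} \<subseteq> X" using A_in2 B_in assms(2) by (auto simp: rel_def D_def split: if_splits)
  qed auto
  finally show ?thesis using assms by simp
qed

lemma row_sums:
  assumes "x \<in> X" "y \<in> X"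
  shows "(M 1 \<otimes> lc 1 1 1 1 1) x y = 6" "(M 2 \<otimes> lc 1 1 1 1 1) x y = 16" "(M 4 \<otimes> lc 1 1 1 1 1) x y = 16"
proof -
  show "(M 1 \<otimes> lc 1 1 1 1 1) x y = 6"
    using row_sum[of 1 6, OF _ assms] card_nbr by (simp add: rel_def)
  show "(M 2 \<otimes> lc 1 1 1 1 1) x y = 16"
    using row_sum[of 2 16, OF _ assms] valencies by (simp add: rel_def)
  show "(M 4 \<otimes> lc 1 1 1 1 1) x y = 16"
    using row_sum[of 4 16, OF _ assms] valencies by (simp add: rel_def)
qed

text \<open>The product with the all-one matrix is 6 times that matrix, and the other four summands
  are known.\<close>

lemma product_13: "M 1 \<otimes> M 3 = lc 0 4 3 1 3"
proof (rule lc_eqI)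
  \<comment> \<open>The redundant factors 0 and 1 reproduce the shape of the unfolded
    \<open>lincomb\<close> terms, so that the identity applies by unification.\<close>
  have lin: "p = 0 * a0 + 4 * a1 + 3 * a2 + 1 * a3 + 3 * a4"
    if "1 * a1 + 1 * (6 * a0 + 1 * a1 + 0 * a2 + 1 * a3 + 0 * a4) + 1 * (0 * a0 + 0 * a1 + 0 * a2 + 2 * a3 + 3 * a4)
        + 1 * p + 1 * (0 * a0 + 0 * a1 + 3 * a2 + 2 * a3 + 0 * a4) = 6"
      "1 * a0 + 1 * a1 + 1 * a2 + 1 * a3 + 1 * a4 = 1" for p a0 a1 a2 a3 a4 :: complex
  proof -
    have "p - (0 * a0 + 4 * a1 + 3 * a2 + 1 * a3 + 3 * a4) = (1 * a1 + 1 * (6 * a0 + 1 * a1 + 0 * a2 + 1 * a3 + 0 * a4) + 1 * (0 * a0 + 0 * a1 + 0 * a2 + 2 * a3 + 3 * a4)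
        + 1 * p + 1 * (0 * a0 + 0 * a1 + 3 * a2 + 2 * a3 + 0 * a4) - 6) - 6 * (1 * a0 + 1 * a1 + 1 * a2 + 1 * a3 + 1 * a4 - 1)"
      by (simp add: algebra_simps)
    then show ?thesis unfolding that by simp
  qed
  fix x y assume xy: "x \<in> X" "y \<in> X"
  show "(M 1 \<otimes> M 3) x y = lc 0 4 3 1 3 x y"
    unfolding lincomb_def
    by (rule lin[OF row_sums(1)[OF xy, unfolded mat_mult_lincomb product_1 product_0, unfolded lincomb_def]
          all_one[OF xy, unfolded lincomb_def]])
qed

text \<open>The count \<open>AA\<close> solved for \<open>M 3\<close>, which reduces its products to
  those of \<open>M 1\<close>.\<close>

lemma product_3:
  "(M 3 \<otimes> F) x y = (M 1 \<otimes> (M 1 \<otimes> F)) x y - 6 * (M 0 \<otimes> F) x y - (M 1 \<otimes> F) x y"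
proof -
  have "(M 1 \<otimes> (M 1 \<otimes> F)) x y = (lc 6 1 0 1 0 \<otimes> F) x y"
    by (simp add: product_1(1) flip: mat_mult_assoc[OF finite_X])
  then show ?thesis by (simp add: mat_mult_lincomb)
qed

lemma product_3s:
  "M 3 \<otimes> M 1 = lc 0 4 3 1 3" "M 3 \<otimes> M 2 = lc 0 8 9 6 3" "M 3 \<otimes> M 3 = lc 24 4 9 10 9" "M 3 \<otimes> M 4 = lc 0 8 3 6 9"
  by (intro ext, simp add: product_3 product_0 product_1 product_13 mat_mult_lincomb,
      simp add: lincomb_def algebra_simps)+

lemma product_right:
  "M 2 \<otimes> M 1 = lc 0 0 0 2 3" "M 4 \<otimes> M 1 = lc 0 0 3 2 0"
  "M 2 \<otimes> M 3 = lc 0 8 9 6 3" "M 4 \<otimes> M 3 = lc 0 8 3 6 9"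
  by (rule product_transpose[OF product_1(3)] product_transpose[OF product_1(2)]
      product_transpose[OF product_3s(4)] product_transpose[OF product_3s(2)]; simp)+

text \<open>Row sums 16 of \<open>M 2\<close> and \<open>M 4\<close>, after subtraction of the known
  products.\<close>

lemma product_24_sum:
  assumes "x \<in> X" "y \<in> X"
  shows "(M 2 \<otimes> M 2) x y + (M 2 \<otimes> M 4) x y = lc 16 8 6 8 10 x y"
    "(M 4 \<otimes> M 2) x y + (M 4 \<otimes> M 4) x y = lc 16 8 10 8 6 x y"
proof -
  have lin: "p + q = 16 * a0 + 8 * a1 + 6 * a2 + 8 * a3 + 10 * a4"
    if "1 * a2 + 1 * (0 * a0 + 0 * a1 + 0 * a2 + 2 * a3 + 3 * a4) + 1 * p
        + 1 * (0 * a0 + 8 * a1 + 9 * a2 + 6 * a3 + 3 * a4) + 1 * q = 16"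
      "1 * a0 + 1 * a1 + 1 * a2 + 1 * a3 + 1 * a4 = 1" for p q a0 a1 a2 a3 a4 :: complex
  proof -
    have "p + q - (16 * a0 + 8 * a1 + 6 * a2 + 8 * a3 + 10 * a4) = (1 * a2 + 1 * (0 * a0 + 0 * a1 + 0 * a2 + 2 * a3 + 3 * a4) + 1 * p
        + 1 * (0 * a0 + 8 * a1 + 9 * a2 + 6 * a3 + 3 * a4) + 1 * q - 16) - 16 * (1 * a0 + 1 * a1 + 1 * a2 + 1 * a3 + 1 * a4 - 1)"
      by (simp add: algebra_simps)
    then show ?thesis unfolding that by simp
  qed
  show "(M 2 \<otimes> M 2) x y + (M 2 \<otimes> M 4) x y = lc 16 8 6 8 10 x y"
    unfolding lincomb_def
    by (rule lin[OF row_sums(2)[OF assms, unfolded mat_mult_lincomb product_right product_0, unfolded lincomb_def]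
          all_one[OF assms, unfolded lincomb_def]])
  have lin: "p + q = 16 * a0 + 8 * a1 + 10 * a2 + 8 * a3 + 6 * a4"
    if "1 * a4 + 1 * (0 * a0 + 0 * a1 + 3 * a2 + 2 * a3 + 0 * a4) + 1 * p
        + 1 * (0 * a0 + 8 * a1 + 3 * a2 + 6 * a3 + 9 * a4) + 1 * q = 16"
      "1 * a0 + 1 * a1 + 1 * a2 + 1 * a3 + 1 * a4 = 1" for p q a0 a1 a2 a3 a4 :: complex
  proof -
    have "p + q - (16 * a0 + 8 * a1 + 10 * a2 + 8 * a3 + 6 * a4) = (1 * a4 + 1 * (0 * a0 + 0 * a1 + 3 * a2 + 2 * a3 + 0 * a4) + 1 * p
        + 1 * (0 * a0 + 8 * a1 + 3 * a2 + 6 * a3 + 9 * a4) + 1 * q - 16) - 16 * (1 * a0 + 1 * a1 + 1 * a2 + 1 * a3 + 1 * a4 - 1)"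
      by (simp add: algebra_simps)
    then show ?thesis unfolding that by simp
  qed
  show "(M 4 \<otimes> M 2) x y + (M 4 \<otimes> M 4) x y = lc 16 8 10 8 6 x y"
    unfolding lincomb_def
    by (rule lin[OF row_sums(3)[OF assms, unfolded mat_mult_lincomb product_right product_0, unfolded lincomb_def]
          all_one[OF assms, unfolded lincomb_def]])
qed

lemma product_22_sum:
  assumes "x \<in> X" "y \<in> X"
  shows "(M 2 \<otimes> M 2) x y + (M 4 \<otimes> M 2) x y = lc 16 8 6 8 10 x y"
  using product_24_sum(2)[OF assms(2,1)] M_transpose[of 4 2 2 4 y x] M_transpose[of 4 2 4 2 y x]
    lc_transpose[of 16 8 10 8 6 y x] by (simp add: add.commute)

lemma KK_product:
  assumes "x \<in> X" "y \<in> X"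
  shows "(M 2 \<otimes> M 2) x y - (M 2 \<otimes> M 4) x y - (M 4 \<otimes> M 2) x y + (M 4 \<otimes> M 4) x y = lc (- 32) 16 4 (- 8) 4 x y"
proof -
  have sg: "of_int (sg u v) = M 2 u v - M 4 u v" for u v
    using B_antisym by (auto simp: sg_def M_simps)
  have "of_int (KK x y) = (\<Sum>z\<in>X. (M 2 x z - M 4 x z) * (M 2 z y - M 4 z y))"
    by (simp add: KK_def sg)
  also have "\<dots> = (M 2 \<otimes> M 2) x y - (M 2 \<otimes> M 4) x y - (M 4 \<otimes> M 2) x y + (M 4 \<otimes> M 4) x y"
    by (simp add: mat_mult_def algebra_simps sum.distrib sum_subtractf)
  finally have e: "of_int (KK x y) = (M 2 \<otimes> M 2) x y - (M 2 \<otimes> M 4) x y - (M 4 \<otimes> M 2) x y + (M 4 \<otimes> M 4) x y" .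
  have "of_int (KK x y) = lc (- 32) 16 4 (- 8) 4 x y"
    by (rule cases_rel[OF assms])
      (simp_all add: lincomb_def M_simps assms KK_diag KK_adj KK_dist2 KK_opp[unfolded opp_def])
  then show ?thesis using e by simp
qed

text \<open>Row and column sums give three independent equations for the four products;
  \<open>KK_product\<close>, the square of \<open>M 2 - M 4\<close>, is the fourth.\<close>

lemma product_24:
  "M 2 \<otimes> M 2 = lc 0 8 3 2 7" "M 2 \<otimes> M 4 = lc 16 0 3 6 3" "M 4 \<otimes> M 2 = lc 16 0 3 6 3" "M 4 \<otimes> M 4 = lc 0 8 7 2 3"
proof -
  have *: "(M 2 \<otimes> M 2) x y = lc 0 8 3 2 7 x y \<and> (M 2 \<otimes> M 4) x y = lc 16 0 3 6 3 x y \<and>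
      (M 4 \<otimes> M 2) x y = lc 16 0 3 6 3 x y \<and> (M 4 \<otimes> M 4) x y = lc 0 8 7 2 3 x y"
    if xy: "x \<in> X" "y \<in> X" for x y
  proof -
    have "p = 8 * a1 + 3 * a2 + 2 * a3 + 7 * a4 \<and> q = 16 * a0 + 3 * a2 + 6 * a3 + 3 * a4 \<and>
        r = 16 * a0 + 3 * a2 + 6 * a3 + 3 * a4 \<and> s = 8 * a1 + 7 * a2 + 2 * a3 + 3 * a4"
      if "p + q = 16 * a0 + 8 * a1 + 6 * a2 + 8 * a3 + 10 * a4"
        "r + s = 16 * a0 + 8 * a1 + 10 * a2 + 8 * a3 + 6 * a4"
        "p + r = 16 * a0 + 8 * a1 + 6 * a2 + 8 * a3 + 10 * a4"
        "p - q - r + s = - 32 * a0 + 16 * a1 + 4 * a2 - 8 * a3 + 4 * a4" for p q r s a0 a1 a2 a3 a4 :: complex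
    proof -
      have p: "p = 8 * a1 + 3 * a2 + 2 * a3 + 7 * a4" using that by algebra
      then show ?thesis using that by algebra
    qed
    from this[of "(M 2 \<otimes> M 2) x y" "(M 2 \<otimes> M 4) x y" "M 0 x y" "M 1 x y" "M 2 x y" "M 3 x y" "M 4 x y" "(M 4 \<otimes> M 2) x y" "(M 4 \<otimes> M 4) x y"]
    show ?thesis
      using product_24_sum[OF xy] product_22_sum[OF xy] KK_product[OF xy] by (simp add: lincomb_def)
  qed
  show "M 2 \<otimes> M 2 = lc 0 8 3 2 7" by (rule lc_eqI) (use * in blast)
  show "M 2 \<otimes> M 4 = lc 16 0 3 6 3" by (rule lc_eqI) (use * in blast)
  show "M 4 \<otimes> M 2 = lc 16 0 3 6 3" by (rule lc_eqI) (use * in blast)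
  show "M 4 \<otimes> M 4 = lc 0 8 7 2 3" by (rule lc_eqI) (use * in blast)
qed

lemma lc_M: "M 0 = lc 1 0 0 0 0" "M 1 = lc 0 1 0 0 0" "M 2 = lc 0 0 1 0 0" "M 3 = lc 0 0 0 1 0" "M 4 = lc 0 0 0 0 1"
  by (simp_all add: lincomb_def)

lemma lc_sum: "lc (c 0) (c 1) (c 2) (c 3) (c 4) = (\<lambda>x y. \<Sum>k\<le>4. c k * M k x y)"
  by (simp add: lincomb_def atMost_4 add.assoc)

lemma products:
  assumes "i \<le> 4" "j \<le> 4"
  shows "M i \<otimes> M j = (\<lambda>x y. \<Sum>k\<le>4. of_nat (scheme_numbers ! i ! j ! k) * M k x y)"
proof -
  note nums = product_1 product_13 product_3s product_right product_24
  have "M i \<otimes> M j = lc (of_nat (scheme_numbers ! i ! j ! 0)) (of_nat (scheme_numbers ! i ! j ! 1))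
      (of_nat (scheme_numbers ! i ! j ! 2)) (of_nat (scheme_numbers ! i ! j ! 3))
      (of_nat (scheme_numbers ! i ! j ! 4))"
    using assms[unfolded le_4]
    by (elim disjE) (simp_all add: scheme_numbers_def product_0 nums lc_M[symmetric])
  from this lc_sum[of "\<lambda>k. of_nat (scheme_numbers ! i ! j ! k)"] show ?thesis by (rule trans)
qed

section \<open>The scheme axioms and the eigenmatrix of a signed hexagon\<close>

lemma rel_partition:
  assumes "x \<in> X" "y \<in> X"
  obtains k where "k \<le> 4" "\<And>i. i \<le> 4 \<Longrightarrow> (x, y) \<in> rel i \<longleftrightarrow> i = k"
proof -
  have "\<exists>k\<le>4. \<forall>i\<le>4. (x, y) \<in> rel i \<longleftrightarrow> i = k"
  proof (rule cases_rel[OF assms])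
    assume "x = y" "\<not> A x y" "\<not> B x y" "\<not> D x y" "\<not> B y x"
    then show ?thesis using assms by (intro exI[of _ 0]) (auto simp: le_4 rel_def)
  next
    assume "x \<noteq> y" "A x y" "\<not> B x y" "\<not> D x y" "\<not> B y x"
    then show ?thesis by (intro exI[of _ 1]) (auto simp: le_4 rel_def)
  next
    assume "x \<noteq> y" "\<not> A x y" "B x y" "\<not> D x y" "\<not> B y x"
    then show ?thesis by (intro exI[of _ 2]) (auto simp: le_4 rel_def)
  next
    assume "x \<noteq> y" "\<not> A x y" "\<not> B x y" "D x y" "\<not> B y x"
    then show ?thesis by (intro exI[of _ 3]) (auto simp: le_4 rel_def)
  next
    assume "x \<noteq> y" "\<not> A x y" "\<not> B x y" "\<not> D x y" "B y x"
    then show ?thesis by (intro exI[of _ 4]) (auto simp: le_4 rel_def)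
  qed
  then show ?thesis using that by blast
qed

lemma rel_sub: "rel i \<subseteq> X \<times> X"
  using A_in A_in2 B_in by (auto simp: rel_def D_def split: if_splits)

lemma rel_card:
  assumes "i \<le> 4" "j \<le> 4" "k \<le> 4" "(x, y) \<in> rel k"
  shows "card {z \<in> X. (x, z) \<in> rel i \<and> (z, y) \<in> rel j} = scheme_numbers ! i ! j ! k"
proof -
  have xy: "x \<in> X" "y \<in> X" using assms(4) rel_sub by blast+
  obtain l where l: "l \<le> 4" "\<And>i. i \<le> 4 \<Longrightarrow> (x, y) \<in> rel i \<longleftrightarrow> i = l" using rel_partition[OF xy] by blast
  have "of_nat (card {z \<in> X. (x, z) \<in> rel i \<and> (z, y) \<in> rel j}) = (M i \<otimes> M j) x y"
    using M_card[OF xy] by simp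
  also have "\<dots> = (\<Sum>m\<le>4. of_nat (scheme_numbers ! i ! j ! m) * M m x y)"
    unfolding products[OF assms(1,2)] ..
  also have "\<dots> = (\<Sum>m\<in>{k}. of_nat (scheme_numbers ! i ! j ! m) * M m x y)"
    by (rule sum.mono_neutral_right) (use assms l in \<open>auto simp: adjacency_def\<close>)
  also have "\<dots> = of_nat (scheme_numbers ! i ! j ! k)"
    using assms by (simp add: adjacency_def)
  finally show ?thesis by (simp only: of_nat_eq_iff)
qed

theorem hexagon_scheme: "commutative_assoc_scheme X 4 rel"
proof
  obtain x where x: "x \<in> X" using card_X by fastforce
  show "finite X" by (rule finite_X)
  show "rel i \<noteq> {}" if i: "i \<le> 4" for i
  proof -
    have ex: "\<exists>z. P z" if "card {z. P z} = k" "k \<noteq> 0" for P :: "'a \<Rightarrow> bool" and k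
    proof (rule ccontr)
      assume "\<not> (\<exists>z. P z)"
      then have "{z. P z} = {}" by simp
      with that show False by simp
    qed
    obtain a where a: "A x a" using ex[OF card_nbr[OF x]] by auto
    obtain b where b: "B b x" using ex[OF valencies(1)[OF x]] by auto
    obtain c where c: "D c x" using ex[OF valencies(3)[OF x]] by auto
    have "(x, x) \<in> rel 0" "(x, a) \<in> rel 1" "(b, x) \<in> rel 2" "(c, x) \<in> rel 3" "(x, b) \<in> rel 4"
      using x a b c by (simp_all add: rel_def Id_on_iff)
    then show ?thesis using i[unfolded le_4] by (elim disjE) auto
  qed
  show "rel i \<inter> rel j = {}" if "i \<le> 4" "j \<le> 4" "i \<noteq> j" for i j
  proof -
    have False if "(x, y) \<in> rel i" "(x, y) \<in> rel j" for x y
    proof -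
      have "x \<in> X" "y \<in> X" using that rel_sub by blast+
      then obtain k where "k \<le> 4" "\<And>i. i \<le> 4 \<Longrightarrow> (x, y) \<in> rel i \<longleftrightarrow> i = k" by (rule rel_partition) blast
      then show False using that \<open>i \<le> 4\<close> \<open>j \<le> 4\<close> \<open>i \<noteq> j\<close> by simp
    qed
    then show ?thesis by auto
  qed
  show "(\<Union>i\<le>4. rel i) = X \<times> X"
  proof
    show "(\<Union>i\<le>4. rel i) \<subseteq> X \<times> X" using rel_sub by blast
    show "X \<times> X \<subseteq> (\<Union>i\<le>4. rel i)"
    proof clarify
      fix x y assume "x \<in> X" "y \<in> X"
      then obtain k where "k \<le> 4" "\<And>i. i \<le> 4 \<Longrightarrow> (x, y) \<in> rel i \<longleftrightarrow> i = k" by (rule rel_partition) blast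
      then show "(x, y) \<in> (\<Union>i\<le>4. rel i)" by blast
    qed
  qed
  show "rel 0 = Id_on X" by (simp add: rel_def)
  show "\<exists>j\<le>4. rel j = (rel i)\<inverse>" if "i \<le> 4" for i
  proof -
    have "rel 0 = (rel 0)\<inverse>" "rel 1 = (rel 1)\<inverse>" "rel 4 = (rel 2)\<inverse>" "rel 3 = (rel 3)\<inverse>" "rel 2 = (rel 4)\<inverse>"
      by (auto simp: rel_def A_commute D_sym)
    moreover have "(0::nat) \<le> 4" "(1::nat) \<le> 4" "(2::nat) \<le> 4" "(3::nat) \<le> 4" "(4::nat) \<le> 4" by simp_all
    ultimately show ?thesis using that[unfolded le_4] by blast
  qed
  show "\<exists>p. \<forall>(x, y)\<in>rel k. card {z \<in> X. (x, z) \<in> rel i \<and> (z, y) \<in> rel j} = p"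
    if "i \<le> 4" "j \<le> 4" "k \<le> 4" for i j k
    using rel_card[OF that] by (intro exI[of _ "scheme_numbers ! i ! j ! k"]) auto
  show "card {z \<in> X. (x, z) \<in> rel i \<and> (z, y) \<in> rel j} = card {z \<in> X. (x, z) \<in> rel j \<and> (z, y) \<in> rel i}"
    if ij: "i \<le> 4" "j \<le> 4" and xy: "x \<in> X" "y \<in> X" for i j x y
  proof -
    obtain k where k: "k \<le> 4" "\<And>i. i \<le> 4 \<Longrightarrow> (x, y) \<in> rel i \<longleftrightarrow> i = k" using rel_partition[OF xy] by blast
    have "scheme_numbers ! i ! j = scheme_numbers ! j ! i"
      using ij[unfolded le_4] by (elim disjE) (simp_all add: scheme_numbers_def)
    then show ?thesis using rel_card[OF ij k(1)] rel_card[OF ij(2,1) k(1)] k by simp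
  qed
qed

theorem hexagon_eigenmatrix: "is_first_eigenmatrix X 4 rel P_matrix"
proof -
  interpret commutative_assoc_scheme X 4 rel by (rule hexagon_scheme)
  show ?thesis
  proof (rule eigenmatrix_criterion[where Q = Q_matrix and
        c = "\<lambda>i j k. of_nat (scheme_numbers ! i ! j ! k)"])
    show "M i \<otimes> M j = (\<lambda>x y. \<Sum>k\<le>4. of_nat (scheme_numbers ! i ! j ! k) * M k x y)"
      if "i \<le> 4" "j \<le> 4" for i j
      using that by (rule products)
  qed (rule P_matrix_numbers PQ_matrix; assumption)+
qed

end

declare One_nat_def [simp]

section \<open>Fissions of the distance scheme\<close>

context signed_hexagon begin

lemma collinearity_distances:
  defines "adj \<equiv> {(x, y). A x y}"
  shows "distance_relation X adj 0 = rel 0" "distance_relation X adj 1 = rel 1"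
    "distance_relation X adj 2 = rel 3" "distance_relation X adj 3 = rel 2 \<union> rel 4"
proof -
  have adj: "(x, y) \<in> adj \<longleftrightarrow> A x y" for x y by (simp add: adj_def)
  have p0: "(x, y) \<in> adj ^^ 0 \<longleftrightarrow> x = y" for x y by simp
  have p1: "(x, y) \<in> adj ^^ 1 \<longleftrightarrow> A x y" for x y by (simp add: adj)
  have p2: "(x, y) \<in> adj ^^ 2 \<longleftrightarrow> (\<exists>m. A x m \<and> A m y)" for x y
    by (auto simp: numeral_2_eq_2 relcomp_unfold adj)
  have p3: "(x, y) \<in> adj ^^ 3 \<longleftrightarrow> (\<exists>m n. A x m \<and> A m n \<and> A n y)" for x y
    by (auto simp: numeral_3_eq_3 relcomp_unfold adj)
  have lt: "(\<forall>m<(1::nat). Q m) \<longleftrightarrow> Q 0" "(\<forall>m<(2::nat). Q m) \<longleftrightarrow> Q 0 \<and> Q 1"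
    "(\<forall>m<(3::nat). Q m) \<longleftrightarrow> Q 0 \<and> Q 1 \<and> Q 2" for Q
    by (auto simp: less_Suc_eq numeral_2_eq_2 numeral_3_eq_3)
  have D: "D x y \<longleftrightarrow> x \<in> X \<and> y \<in> X \<and> x \<noteq> y \<and> \<not> A x y \<and> (\<exists>m. A x m \<and> A m y)" for x y
    using opp_iff unfolding D_def by blast
  have O: "opp x y \<longleftrightarrow> x \<in> X \<and> y \<in> X \<and> (\<exists>m n. A x m \<and> A m n \<and> A n y) \<and> x \<noteq> y \<and> \<not> A x y \<and> \<not> (\<exists>m. A x m \<and> A m y)" for x y
  proof -
    have "\<exists>m n. A x m \<and> A m n \<and> A n y" if o: "opp x y"
    proof -
      obtain b where "A x b" using card_nbr_gt[OF opp_in(1)[OF o], of "{}"] by auto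
      then obtain a where a: "A x a" "\<not> opp a y" using opp_nbr_nonopp[OF o] by metis
      obtain u where "A a u" "A u y" using opp_path[OF o a] by metis
      then show ?thesis using a by blast
    qed
    then show ?thesis using opp_iff[of x y] by blast
  qed
  show "distance_relation X adj 0 = rel 0"
    unfolding distance_relation_def p0 rel_def by auto
  show "distance_relation X adj 1 = rel 1"
    unfolding distance_relation_def lt p0 p1 rel_def using A_in A_in2 A_irrefl by auto
  show "distance_relation X adj 2 = rel 3"
    unfolding distance_relation_def lt p0 p1 p2 rel_def by (auto simp: D)
  have "rel 2 \<union> rel 4 = {(x, y). opp x y}" by (auto simp: rel_def opp_def)
  then show "distance_relation X adj 3 = rel 2 \<union> rel 4"
    unfolding distance_relation_def lt p0 p1 p2 p3 by (auto simp: O)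
qed

text \<open>Double counting the entries of the square of the sign matrix at collinear pairs gives
  \<open>6v = 32(3 - 2n)\<close>, so \<open>n\<close> is \<open>0\<close> or \<open>3\<close>; if it were \<open>3\<close>, then \<open>G\<close> would be symmetric by \<open>opp_swap\<close>.\<close>

lemma sign_function_from_counts:
  assumes G: "\<And>x y. opp x y \<longleftrightarrow> G x y \<or> G y x" and anti: "\<And>x y. G x y \<Longrightarrow> \<not> G y x"
    and n: "\<And>x y. opp x y \<Longrightarrow> card {z. A x z \<and> opp z y \<and> (G z y \<longleftrightarrow> G x y)} = n"
    and v: "\<And>x y. A x y \<Longrightarrow>
      (\<Sum>z\<in>X. (of_bool (G x z) - of_bool (G z x)) * (of_bool (G z y) - of_bool (G y z))) = (v :: int)"
  shows "sign_function G"
proof -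
  define t :: "'a \<Rightarrow> 'a \<Rightarrow> int" where "t = (\<lambda>x y. of_bool (G x y) - of_bool (G y x))"
  have v: "(\<Sum>z\<in>X. t x z * t z y) = v" if "A x y" for x y using v[OF that] by (simp add: t_def)
  have t_swap: "t y x = - t x y" for x y by (simp add: t_def)
  have t_opp: "t x y = (if opp x y then (if G x y then 1 else - 1) else 0)" for x y
    using G[of x y] anti by (auto simp: t_def)
  have fin: "finite {z. A x z \<and> P z}" for x P by (rule finite_nbr)
  \<comment> \<open>Three neighbours of \<open>y\<close> are opposite \<open>z\<close>:
    \<open>n\<close> of them keep the sign of \<open>y\<close> and \<open>3 - n\<close> reverse it;
    multiplication by \<open>t z y = - t y z\<close> turns \<open>2n - 3\<close> into
    \<open>3 - 2n\<close>.\<close>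
  have nbr_sum: "(\<Sum>x\<in>{x. A y x}. t x z) * t z y = (if opp z y then 3 - 2 * int n else 0)"
    if y: "y \<in> X" for y z
  proof (cases "opp z y")
    case True
    then have o: "opp y z" using opp_sym by simp
    let ?P = "{x. A y x \<and> opp x z \<and> (G x z \<longleftrightarrow> G y z)}" and ?N = "{x. A y x \<and> opp x z \<and> (G x z \<noteq> G y z)}"
    have "{x. A y x \<and> opp x z} = ?P \<union> ?N" by auto
    moreover have "card (?P \<union> ?N) = card ?P + card ?N"
      by (rule card_Un_disjoint[OF fin fin]) auto
    moreover have "card {x. A y x \<and> opp x z} = 3"
      using card_opp_nbr[OF opp_in[OF o]] o A_not_opp opp_irrefl by auto
    ultimately have c: "int (card ?N) = 3 - int n" "int (card ?P) = int n" using n[OF o] by simp_all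
    have "(\<Sum>x\<in>{x. A y x}. t x z) = (\<Sum>x\<in>?P \<union> ?N. t x z)"
      by (rule sum.mono_neutral_right) (use fin[of y "\<lambda>_. True"] in \<open>auto simp: t_opp\<close>)
    also have "\<dots> = (\<Sum>x\<in>?P. t x z) + (\<Sum>x\<in>?N. t x z)"
      by (rule sum.union_disjoint[OF fin fin]) auto
    also have "(\<Sum>x\<in>?P. t x z) = (\<Sum>x\<in>?P. t y z)" by (rule sum.cong) (auto simp: t_opp o)
    also have "(\<Sum>x\<in>?N. t x z) = (\<Sum>x\<in>?N. - t y z)" by (rule sum.cong) (auto simp: t_opp o)
    finally have "(\<Sum>x\<in>{x. A y x}. t x z) = int (card ?P) * t y z + int (card ?N) * (- t y z)"
      by (simp only: sum_constant)
    then have s: "(\<Sum>x\<in>{x. A y x}. t x z) = (2 * int n - 3) * t y z"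
      by (simp only: c) (simp add: algebra_simps)
    have "t y z = 1 \<or> t y z = - 1" using o t_opp[of y z] by simp
    then have "t y z * t z y = - 1" using t_swap[of y z] by auto
    then have "(2 * int n - 3) * t y z * t z y = 3 - 2 * int n"
      by (simp add: mult.assoc)
    then show ?thesis using s True by simp
  next
    case False
    then show ?thesis by (simp add: t_opp)
  qed
  obtain y where y: "y \<in> X" using card_X by fastforce
  have fA: "finite {x. A y x}" using fin[of y "\<lambda>_. True"] by simp
  have "6 * v = (\<Sum>x\<in>{x. A y x}. v)" using card_nbr[OF y] by simp
  also have "\<dots> = (\<Sum>x\<in>{x. A y x}. \<Sum>z\<in>X. t x z * t z y)"
  proof (rule sum.cong)
    fix x assume "x \<in> {x. A y x}"
    then have "A x y" using A_sym by simp
    then show "v = (\<Sum>z\<in>X. t x z * t z y)" using v by simp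
  qed simp
  also have "\<dots> = (\<Sum>z\<in>X. \<Sum>x\<in>{x. A y x}. t x z * t z y)" by (rule sum.swap)
  also have "\<dots> = (\<Sum>z\<in>X. if opp z y then 3 - 2 * int n else 0)"
    by (rule sum.cong) (simp_all add: nbr_sum[OF y] flip: sum_distrib_right)
  also have "\<dots> = (\<Sum>z\<in>{z. opp z y}. 3 - 2 * int n)"
    by (rule sum.mono_neutral_cong_right[OF finite_X]) (use opp_in in auto)
  also have "\<dots> = 32 * (3 - 2 * int n)" using card_opp[OF y] by simp
  finally have eq: "6 * v = 32 * (3 - 2 * int n)" .
  obtain z where o: "opp y z" using ex_opp[OF y] .
  have "n \<le> 3"
  proof -
    have "n \<le> card {x. A y x \<and> opp x z}"
      unfolding n[OF o, symmetric] by (rule card_mono[OF fin]) auto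
    moreover have "y \<noteq> z" "\<not> A y z" using o opp_irrefl A_not_opp by blast+
    ultimately show ?thesis using card_opp_nbr[OF opp_in[OF o]] o by simp
  qed
  \<comment> \<open>Modulo 3 the equation says that 3 divides \<open>n\<close>.\<close>
  then have "n = 0 \<or> n = 3" using eq by presburger
  moreover have "n \<noteq> 3"
  proof
    assume n3: "n = 3"
    have keep: "G x' z \<longleftrightarrow> G x z" if "A x x'" "opp x z" "opp x' z" for x x' z
    proof -
      have "{w. A x w \<and> opp w z \<and> (G w z \<longleftrightarrow> G x z)} \<subseteq> {w. A x w \<and> opp w z}" by auto
      moreover have "card {w. A x w \<and> opp w z} = 3"
        using card_opp_nbr[OF opp_in[OF that(2)]] that(2) A_not_opp opp_irrefl by auto
      ultimately have "{w. A x w \<and> opp w z \<and> (G w z \<longleftrightarrow> G x z)} = {w. A x w \<and> opp w z}"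
        using n[OF that(2)] n3 by (intro card_subset_eq[OF fin]) auto
      then show ?thesis using that by blast
    qed
    have swap: "G x z \<longleftrightarrow> \<not> G z x" if "opp x z" for x z using that G anti by blast
    have keep': "G z x' \<longleftrightarrow> G z x" if "A x x'" "opp z x" "opp z x'" for x x' z
      using keep[OF that(1)] swap that opp_sym by metis
    have "G y z = G z y"
      by (rule opp_swap[where h = G and g = "\<lambda>v. v"]) (use keep keep' o in blast)+
    then show False using swap[OF o] by simp
  qed
  ultimately have n0: "n = 0" by simp
  show ?thesis
    unfolding sign_function_def
  proof (intro conjI allI impI)
    fix x y assume "opp x y"
    then show "G y x = (\<not> G x y)" using G anti by blast
  next
    fix x y z assume h: "A x z" "opp x y" "opp z y"
    have "{z. A x z \<and> opp z y \<and> (G z y \<longleftrightarrow> G x y)} = {}" using n[OF h(2)] n0 fin by simp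
    then show "G z y = (\<not> G x y)" using h by blast
  qed
qed

lemma reverse: "signed_hexagon X A (\<lambda>x y. B y x)"
proof
  show "card {z. A x z \<and> A z y} = (if x = y then 6 else if A x y then 1 else if B y x \<or> B x y then 0 else 1)"
    if "x \<in> X" "y \<in> X" for x y using AA[OF that] by (simp add: disj_commute)
qed (use finite_X card_X A_in A_sym A_irrefl B_in B_antisym A_not_B AC AB in \<open>blast\<close>)+

text \<open>The given \<open>B\<close> need not be \<open>F 2\<close>. Constancy of the intersection
  numbers makes \<open>F 2\<close> a sign function, and \<open>sign_unique\<close> leaves only
  \<open>B\<close> and its transpose.\<close>

lemma fission_signed_hexagon:
  assumes F: "commutative_assoc_scheme X 4 F"
    and F1: "F 1 = {(x, y). A x y}" and F24: "F 2 \<union> F 4 = {(x, y). opp x y}" and F4: "F 4 = (F 2)\<inverse>"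
  shows "signed_hexagon X (\<lambda>x y. (x, y) \<in> F 1) (\<lambda>x y. (x, y) \<in> F 2)"
proof -
  interpret F: commutative_assoc_scheme X 4 F by fact
  define G where "G x y \<longleftrightarrow> (x, y) \<in> F 2" for x y
  have G4: "(x, y) \<in> F 4 \<longleftrightarrow> G y x" for x y using F4 by (simp add: G_def)
  have A1: "(x, y) \<in> F 1 \<longleftrightarrow> A x y" for x y using F1 by simp
  have opp: "opp x y \<longleftrightarrow> G x y \<or> G y x" for x y
    using F24 G4[of x y] unfolding G_def by blast
  have anti: "G x y \<Longrightarrow> \<not> G y x" for x y
    using F.S_disjoint[of 2 4 x y] G4[of x y] unfolding G_def by auto
  have G_in: "G x y \<Longrightarrow> x \<in> X \<and> y \<in> X" for x y using F.S_sub[of 2] unfolding G_def by auto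
  obtain p where p: "\<forall>(x, y)\<in>F 2. card {z \<in> X. (x, z) \<in> F 1 \<and> (z, y) \<in> F 2} = p"
    using F.intersection_numbers[of 1 2 2] by auto
  have n: "card {z. A x z \<and> opp z y \<and> (G z y \<longleftrightarrow> G x y)} = p" if "opp x y" for x y
  proof (cases "G x y")
    case True
    then have "{z. A x z \<and> opp z y \<and> (G z y \<longleftrightarrow> G x y)} = {z \<in> X. (x, z) \<in> F 1 \<and> (z, y) \<in> F 2}"
      using A_in2 opp by (auto simp: A1[simplified] G_def[symmetric])
    then show ?thesis using p True unfolding G_def by auto
  next
    case False
    \<comment> \<open>For a pair in \<open>F 4\<close>, commutativity of the scheme turns the count
      into that of the transposed pair in \<open>F 2\<close>, so the same \<open>p\<close>
      results.\<close>
    then have yx: "G y x" using opp that by blast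
    then have "{z. A x z \<and> opp z y \<and> (G z y \<longleftrightarrow> G x y)} = {z \<in> X. (y, z) \<in> F 2 \<and> (z, x) \<in> F 1}"
      using False A_in2 A_sym opp anti by (auto simp: A1[simplified] G_def[symmetric])
    also have "card \<dots> = card {z \<in> X. (y, z) \<in> F 1 \<and> (z, x) \<in> F 2}"
      using F.commute[of 2 1 y x] G_in[OF yx] by simp
    finally show ?thesis using p yx unfolding G_def by auto
  qed
  have "\<exists>v. \<forall>x y. A x y \<longrightarrow> (\<Sum>z\<in>X. (of_bool (G x z) - of_bool (G z x)) * (of_bool (G z y) - of_bool (G y z))) = (v::int)"
  proof -
    define q where "q i j = (SOME p. \<forall>(x, y)\<in>F 1. card {z \<in> X. (x, z) \<in> F i \<and> (z, y) \<in> F j} = p)" for i j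
    have "\<forall>(x, y)\<in>F 1. card {z \<in> X. (x, z) \<in> F i \<and> (z, y) \<in> F j} = q i j" if "i \<le> 4" "j \<le> 4" for i j
      unfolding q_def by (rule someI_ex) (rule F.intersection_numbers[OF that], simp)
    then have q: "card {z \<in> X. (x, z) \<in> F i \<and> (z, y) \<in> F j} = q i j" if "i \<le> 4" "j \<le> 4" "A x y" for i j x y
      using that A1[of x y] by blast
    have "(\<Sum>z\<in>X. (of_bool (G x z) - of_bool (G z x)) * (of_bool (G z y) - of_bool (G y z)))
        = int (q 2 2) - int (q 2 4) - int (q 4 2) + int (q 4 4)" if xy: "A x y" for x y
    proof -
      have c: "int (card {z \<in> X. (x, z) \<in> F i \<and> (z, y) \<in> F j}) = (\<Sum>z\<in>X. of_bool ((x, z) \<in> F i) * of_bool ((z, y) \<in> F j))" for i j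
      proof -
        have "{z \<in> X. (x, z) \<in> F i \<and> (z, y) \<in> F j} = X \<inter> {z. (x, z) \<in> F i \<and> (z, y) \<in> F j}" by auto
        then have "int (card {z \<in> X. (x, z) \<in> F i \<and> (z, y) \<in> F j}) = (\<Sum>z\<in>X. of_bool ((x, z) \<in> F i \<and> (z, y) \<in> F j))"
          using finite_X by (simp add: sum_of_bool_eq)
        then show ?thesis by (simp add: of_bool_conj)
      qed
      have "int (q i j) = (\<Sum>z\<in>X. of_bool ((x, z) \<in> F i) * of_bool ((z, y) \<in> F j))" if "i \<le> 4" "j \<le> 4" for i j
        using q[OF that xy] c[of i j] by simp
      then show ?thesis
        by (simp add: G4 G_def[symmetric] algebra_simps sum.distrib sum_subtractf)
    qed
    then show ?thesis by blast
  qed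
  then obtain v where v: "\<And>x y. A x y \<Longrightarrow>
      (\<Sum>z\<in>X. (of_bool (G x z) - of_bool (G z x)) * (of_bool (G z y) - of_bool (G y z))) = (v::int)" by blast
  have "sign_function G" by (rule sign_function_from_counts[OF opp anti n v])
  from sign_unique[OF this] have "G = B \<or> G = (\<lambda>x y. B y x)"
  proof
    assume *: "\<forall>x y. opp x y \<longrightarrow> (G x y \<longleftrightarrow> B x y)"
    have "G x y \<longleftrightarrow> B x y" for x y using * opp[of x y] unfolding opp_def by blast
    then show ?thesis by (intro disjI1 ext)
  next
    assume *: "\<forall>x y. opp x y \<longrightarrow> (G x y \<longleftrightarrow> B y x)"
    have "G x y \<longleftrightarrow> B y x" for x y using * opp[of x y] unfolding opp_def by blast
    then show ?thesis by (intro disjI2 ext)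
  qed
  then have "signed_hexagon X A G" using reverse signed_hexagon_axioms by auto
  then show ?thesis by (simp add: A1[simplified] G_def[symmetric])
qed

end

section \<open>The split Cayley hexagon\<close>

text \<open>Exhaustive checks run on tuples of truth values, which \<open>bv\<close> translates to vectors over \<open>bit\<close>.\<close>

type_synonym bool7 = "bool \<times> bool \<times> bool \<times> bool \<times> bool \<times> bool \<times> bool"

definition xr :: "bool \<Rightarrow> bool \<Rightarrow> bool" where
  "xr a b = (if a then \<not> b else b)"

text \<open>The bilinear form of the quadric; the coordinate \<open>d\<close> is absent because a
  square is additive in characteristic two.\<close>

fun polar :: "bool7 \<Rightarrow> bool7 \<Rightarrow> bool" where
  "polar (a,b,c,d,e,f,g) (a',b',c',d',e',f',g') =
   xr (xr (xr (a \<and> e') (e \<and> a')) (xr (b \<and> f') (f \<and> b'))) (xr (c \<and> g') (g \<and> c'))"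

fun grassmann_eqs :: "bool7 \<Rightarrow> bool7 \<Rightarrow> bool" where
  "grassmann_eqs (a,b,c,d,e,f,g) (a',b',c',d',e',f',g') =
  (xr (b \<and> c') (c \<and> b') = xr (d \<and> e') (e \<and> d') \<and>
   xr (f \<and> e') (e \<and> f') = xr (d \<and> c') (c \<and> d') \<and>
   xr (c \<and> a') (a \<and> c') = xr (d \<and> f') (f \<and> d') \<and>
   xr (g \<and> f') (f \<and> g') = xr (d \<and> a') (a \<and> d') \<and>
   xr (a \<and> b') (b \<and> a') = xr (d \<and> g') (g \<and> d') \<and>
   xr (e \<and> g') (g \<and> e') = xr (d \<and> b') (b \<and> d'))"

text \<open>The sign is a polynomial of degree two in either argument over \<open>GF(2)\<close>; it was found by solving the
  linear system that describes the alternation of the signs.\<close>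

fun tri :: "bool \<Rightarrow> bool \<Rightarrow> bool \<Rightarrow> bool \<Rightarrow> bool \<Rightarrow> bool \<Rightarrow> bool" where
  "tri a b c a' b' c' = xr (xr (a \<and> (b' \<or> c')) (xr (b \<and> (a' \<or> c')) (c \<and> (a' \<or> b'))))
    (xr (a \<and> b \<and> c') (xr (a \<and> c \<and> b') (b \<and> c \<and> a')))"

fun sign7 :: "bool7 \<Rightarrow> bool7 \<Rightarrow> bool" where
  "sign7 (a,b,c,d,e,f,g) (a',b',c',d',e',f',g') =
   xr (xr (d \<or> d') (xr (a \<and> e') (xr (b \<and> f') (c \<and> g')))) (xr (tri a b c a' b' c') (tri e f g e' f' g'))"

definition bools :: "bool list" where
  "bools = [False, True]"

text \<open>Squaring is the identity on the field with two elements, so the quadric equation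
  computes \<open>d\<close> from the other six coordinates, which range over the 63 nonzero
  vectors.\<close>

definition pts7 :: "bool7 list" where
  "pts7 = filter (\<lambda>(a,b,c,d,e,f,g). a \<or> b \<or> c \<or> e \<or> f \<or> g)
    [(a,b,c,xr (xr (a \<and> e) (b \<and> f)) (c \<and> g),e,f,g). a \<leftarrow> bools, b \<leftarrow> bools, c \<leftarrow> bools,
      e \<leftarrow> bools, f \<leftarrow> bools, g \<leftarrow> bools]"

text \<open>Vanishing of \<open>polar\<close> says that the sum of two distinct points is again on
  the quadric (\<open>add7_quad\<close>).\<close>

definition adj7 :: "bool7 \<Rightarrow> bool7 \<Rightarrow> bool" where
  "adj7 x y = (if polar x y \<or> x = y then False else grassmann_eqs x y)"

definition pos7 :: "bool7 \<Rightarrow> bool7 \<Rightarrow> bool" where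
  "pos7 x y = (if polar x y then sign7 x y else False)"

text \<open>The list of neighbours of \<open>x\<close> is bound once and shared by the counts for
  all \<open>y\<close>.\<close>

definition count7 where
  "count7 R k x = (let nb = filter (adj7 x) pts7 in list_all (\<lambda>y. length (filter (\<lambda>z. R z y) nb) = k x y) pts7)"

lemma pos7_antisym: "list_all (\<lambda>x. list_all (\<lambda>y. if pos7 x y then \<not> pos7 y x \<and> \<not> adj7 x y else True) pts7) pts7"
  by code_simp

lemma pts7_distinct: "distinct pts7" "length pts7 = 63"
  by code_simp+

lemma count7_AA:
  "list_all (count7 adj7 (\<lambda>x y. if x = y then 6 else if adj7 x y then 1 else if pos7 x y \<or> pos7 y x then 0 else 1)) pts7"
  by code_simp

lemma count7_AB:
  "list_all (count7 pos7 (\<lambda>x y. if x = y \<or> adj7 x y \<or> pos7 x y then 0 else if pos7 y x then 3 else 2)) pts7"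
  by code_simp

lemma count7_AC:
  "list_all (count7 (\<lambda>z y. pos7 y z) (\<lambda>x y. if x = y \<or> adj7 x y \<or> pos7 y x then 0 else if pos7 x y then 3 else 2)) pts7"
  by code_simp

section \<open>Translation to vectors over the field with two elements\<close>

definition bv :: "bool7 \<Rightarrow> bit ^ 7" where
  "bv = (\<lambda>(a,b,c,d,e,f,g). \<chi> i. of_bool (if i = 0 then a else if i = 1 then b else if i = 2 then c
    else if i = 3 then d else if i = 4 then e else if i = 5 then f else g))"

lemma bv_nth:
  "bv (a,b,c,d,e,f,g) $ 0 = of_bool a" "bv (a,b,c,d,e,f,g) $ 1 = of_bool b" "bv (a,b,c,d,e,f,g) $ 2 = of_bool c"
  "bv (a,b,c,d,e,f,g) $ 3 = of_bool d" "bv (a,b,c,d,e,f,g) $ 4 = of_bool e" "bv (a,b,c,d,e,f,g) $ 5 = of_bool f"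
  "bv (a,b,c,d,e,f,g) $ 6 = of_bool g"
  by (simp_all add: bv_def)

lemma UNIV_7: "(UNIV :: 7 set) = {0, 1, 2, 3, 4, 5, 6}"
proof -
  have "card {0, 1, 2, 3, 4, 5, 6 :: 7} = 7" by simp
  then have "{0, 1, 2, 3, 4, 5, 6 :: 7} = UNIV"
    by (intro card_subset_eq) simp_all
  then show ?thesis ..
qed

lemma vec7_eq_iff: "x = y \<longleftrightarrow> x $ 0 = y $ 0 \<and> x $ 1 = y $ 1 \<and> x $ 2 = y $ 2 \<and> x $ 3 = y $ 3 \<and>
    x $ 4 = y $ 4 \<and> x $ 5 = y $ 5 \<and> x $ 6 = y $ 6" for x y :: "'b ^ 7"
proof -
  have "(\<forall>i. x $ i = y $ i) \<longleftrightarrow> (\<forall>i\<in>{0, 1, 2, 3, 4, 5, 6}. x $ i = y $ i)"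
    unfolding UNIV_7[symmetric] by simp
  then show ?thesis unfolding vec_eq_iff by simp
qed

lemma of_bool_bit:
  "of_bool a + of_bool b = (of_bool (xr a b) :: bit)" "of_bool a - of_bool b = (of_bool (xr a b) :: bit)"
  "of_bool a * of_bool b = (of_bool (a \<and> b) :: bit)" "(of_bool a)\<^sup>2 = (of_bool a :: bit)"
  "(of_bool a :: bit) = of_bool b \<longleftrightarrow> a = b"
  by (cases a; cases b; simp add: xr_def)+

fun quad7 :: "bool7 \<Rightarrow> bool" where
  "quad7 (a,b,c,d,e,f,g) \<longleftrightarrow> (a \<or> b \<or> c \<or> e \<or> f \<or> g) \<and> d = xr (xr (a \<and> e) (b \<and> f)) (c \<and> g)"

fun add7 :: "bool7 \<Rightarrow> bool7 \<Rightarrow> bool7" where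
  "add7 (a,b,c,d,e,f,g) (a',b',c',d',e',f',g') = (xr a a', xr b b', xr c c', xr d d', xr e e', xr f f', xr g g')"

lemma pts7_iff: "t \<in> set pts7 \<longleftrightarrow> quad7 t"
proof -
  have "set bools = UNIV" by (auto simp: bools_def)
  then show ?thesis by (cases t) (auto simp: pts7_def image_iff)
qed

lemma add7_quad: "list_all (\<lambda>x. list_all (\<lambda>y. if x = y then True else quad7 (add7 x y) = (\<not> polar x y)) pts7) pts7"
  by code_simp

lemma bv_eq_iff: "bv s = bv t \<longleftrightarrow> s = t"
  by (cases s; cases t) (simp add: vec7_eq_iff bv_nth of_bool_bit)

lemma bv_onto: "\<exists>t. x = bv t"
proof -
  have "x $ i = of_bool (x $ i = 1)" for i by (cases "x $ i") simp_all
  then show ?thesis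
    by (intro exI[of _ "(x $ 0 = 1, x $ 1 = 1, x $ 2 = 1, x $ 3 = 1, x $ 4 = 1, x $ 5 = 1, x $ 6 = 1)"])
      (simp add: vec7_eq_iff bv_nth)
qed

lemma bv_add: "bv s + bv t = bv (add7 s t)"
  by (cases s; cases t) (simp only: add7.simps vec7_eq_iff vector_add_component bv_nth of_bool_bit simp_thms)

lemma bv_point: "bv t \<in> H2_points \<longleftrightarrow> quad7 t"
proof (cases t)
  case (fields a b c d e f g)
  have "bv t = 0 \<longleftrightarrow> \<not> (a \<or> b \<or> c \<or> d \<or> e \<or> f \<or> g)"
    by (auto simp: fields vec7_eq_iff bv_nth)
  then show ?thesis
    by (auto simp: fields H2_points_def bv_nth of_bool_bit xr_def)
qed

lemma H2_points_image: "H2_points = bv ` set pts7"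
proof
  show "H2_points \<subseteq> bv ` set pts7"
  proof
    fix x assume x: "x \<in> H2_points"
    obtain t where "x = bv t" using bv_onto by blast
    then show "x \<in> bv ` set pts7" using x by (simp add: bv_point pts7_iff)
  qed
  show "bv ` set pts7 \<subseteq> H2_points" by (auto simp: bv_point pts7_iff)
qed

definition line_eqs :: "bit ^ 7 \<Rightarrow> bit ^ 7 \<Rightarrow> bool" where
  "line_eqs x y \<longleftrightarrow> grassmann x y 1 2 = grassmann x y 3 4 \<and> grassmann x y 5 4 = grassmann x y 3 2 \<and>
    grassmann x y 2 0 = grassmann x y 3 5 \<and> grassmann x y 6 5 = grassmann x y 3 0 \<and>
    grassmann x y 0 1 = grassmann x y 3 6 \<and> grassmann x y 4 6 = grassmann x y 3 1"

lemma line_eqs_bv: "line_eqs (bv s) (bv t) \<longleftrightarrow> grassmann_eqs s t"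
  by (cases s; cases t) (simp only: line_eqs_def grassmann_def bv_nth of_bool_bit grassmann_eqs.simps)

lemma vec_bit_add_self: "(x :: bit ^ 7) + x = 0" "x + (x + y) = y"
  by (simp_all add: vec_eq_iff flip: add.assoc)

text \<open>Grassmann coordinates are alternating, and signs vanish in characteristic two; hence the
  line equations depend only on the line and not on the two points that span it.\<close>

lemma grassmann_line:
  "grassmann y x i j = grassmann x y i j" "grassmann x (x + y) i j = grassmann x y i j"
  by (cases "x $ i"; cases "x $ j"; cases "y $ i"; cases "y $ j"; simp add: grassmann_def)+

lemma line_eqs_line: "line_eqs y x = line_eqs x y" "line_eqs x (x + y) = line_eqs x y" "line_eqs (x + y) x = line_eqs x y"
  unfolding line_eqs_def by (simp_all only: grassmann_line grassmann_line(1)[of "x + y" x])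

text \<open>Any two points of a line span it, so the pair \<open>x, y\<close> can replace the pair
  that defines the line.\<close>

lemma H2_collinear_iff:
  "(x, y) \<in> H2_collinear \<longleftrightarrow> x \<noteq> y \<and> {x, y, x + y} \<subseteq> H2_points \<and> line_eqs x y"
proof
  assume "(x, y) \<in> H2_collinear"
  then obtain u v where xy: "x \<noteq> y" "x \<in> {u, v, u + v}" "y \<in> {u, v, u + v}"
    and uv: "{u, v, u + v} \<subseteq> H2_points" "line_eqs u v"
    unfolding H2_collinear_def H2_lines_def line_eqs_def by blast
  have c: "v + u = u + v" "u + v + u = v" "u + v + v = u" "v + (u + v) = u" "u + (u + v) = v"
    using vec_bit_add_self(2)[of u v] vec_bit_add_self(2)[of v u] by (simp_all add: add.commute)
  have e: "line_eqs v (u + v) = line_eqs u v" "line_eqs (u + v) v = line_eqs u v"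
    using line_eqs_line(2)[of v u] line_eqs_line(3)[of v u] line_eqs_line(1)[of u v] by (simp_all add: add.commute)
  from xy show "x \<noteq> y \<and> {x, y, x + y} \<subseteq> H2_points \<and> line_eqs x y"
    using uv by (elim insertE emptyE) (simp_all add: c e line_eqs_line)
next
  assume a: "x \<noteq> y \<and> {x, y, x + y} \<subseteq> H2_points \<and> line_eqs x y"
  then have "{x, y, x + y} \<in> H2_lines" unfolding H2_lines_def line_eqs_def by blast
  then show "(x, y) \<in> H2_collinear" using a unfolding H2_collinear_def by blast
qed

lemma bv_collinear:
  assumes "s \<in> set pts7" "t \<in> set pts7"
  shows "(bv s, bv t) \<in> H2_collinear \<longleftrightarrow> adj7 s t"
proof (cases "s = t")
  case True
  then show ?thesis by (simp add: H2_collinear_iff adj7_def)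
next
  case False
  then have "quad7 (add7 s t) = (\<not> polar s t)"
    using add7_quad assms by (simp add: list_all_iff)
  then show ?thesis
    using assms False
    by (simp add: H2_collinear_iff adj7_def bv_eq_iff bv_add bv_point line_eqs_bv pts7_iff)
qed

lemma H2_hexagon: "\<exists>B. signed_hexagon H2_points (\<lambda>x y. (x, y) \<in> H2_collinear) B"
proof -
  let ?A = "\<lambda>x y. (x, y) \<in> H2_collinear"
  define B where "B x y \<longleftrightarrow> (\<exists>s\<in>set pts7. \<exists>t\<in>set pts7. x = bv s \<and> y = bv t \<and> pos7 s t)" for x y
  have B: "B (bv s) (bv t) \<longleftrightarrow> pos7 s t" if "s \<in> set pts7" "t \<in> set pts7" for s t
    unfolding B_def using that by (auto simp: bv_eq_iff)
  have pt: "\<exists>s\<in>set pts7. x = bv s" if "x \<in> H2_points" for x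
    using that unfolding H2_points_image by blast
  have inj: "inj_on bv U" for U by (simp add: inj_on_def bv_eq_iff)
  \<comment> \<open>\<open>bv\<close> is injective and every neighbour is the image of a listed
    tuple, so the cardinality is the length of the filtered list.\<close>
  have cnt: "card {z. ?A (bv s) z \<and> R z (bv t)} = k s t"
    if c: "list_all (count7 (\<lambda>z y. Q z y) k) pts7" and st: "s \<in> set pts7" "t \<in> set pts7"
      and R: "\<And>z. z \<in> set pts7 \<Longrightarrow> R (bv z) (bv t) = Q z t" for R Q k s t
  proof -
    let ?l = "filter (\<lambda>z. Q z t) (filter (adj7 s) pts7)"
    have "z \<in> {z. ?A (bv s) z \<and> R z (bv t)} \<longleftrightarrow> z \<in> bv ` set ?l" for z
    proof
      assume z: "z \<in> {z. ?A (bv s) z \<and> R z (bv t)}"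
      then have "z \<in> H2_points" by (simp add: H2_collinear_iff)
      then obtain w where "w \<in> set pts7" "z = bv w" using pt by blast
      then show "z \<in> bv ` set ?l" using z bv_collinear[OF st(1)] R by auto
    qed (use bv_collinear[OF st(1)] R in auto)
    then have "{z. ?A (bv s) z \<and> R z (bv t)} = bv ` set ?l" by blast
    then have "card {z. ?A (bv s) z \<and> R z (bv t)} = length ?l"
      using card_image[OF inj] distinct_card[of ?l] by (simp add: pts7_distinct)
    also have "\<dots> = k s t" using c st unfolding count7_def list_all_iff Let_def by blast
    finally show ?thesis .
  qed
  have anti: "\<not> pos7 t s \<and> \<not> adj7 s t" if "s \<in> set pts7" "t \<in> set pts7" "pos7 s t" for s t
    using pos7_antisym that unfolding list_all_iff by fastforce
  have "signed_hexagon H2_points ?A B"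
  proof
    show "finite H2_points" "card H2_points = 63"
      unfolding H2_points_image using card_image[OF inj] distinct_card[OF pts7_distinct(1)] pts7_distinct(2) by simp_all
    show "x \<in> H2_points" if "?A x y" for x y using that by (simp add: H2_collinear_iff)
    show "?A y x" if "?A x y" for x y using that by (auto simp: H2_collinear_iff line_eqs_line add.commute)
    show "\<not> ?A x x" for x by (simp add: H2_collinear_iff)
    show "x \<in> H2_points \<and> y \<in> H2_points" if "B x y" for x y using that unfolding B_def H2_points_image by blast
    show "\<not> B y x" if b: "B x y" for x y using b anti B unfolding B_def by blast
    show "\<not> B x y" if a: "?A x y" for x y using a anti bv_collinear unfolding B_def by blast
  next
    fix x y assume "x \<in> H2_points" "y \<in> H2_points"
    then obtain s t where x: "x = bv s" and y: "y = bv t" and st: "s \<in> set pts7" "t \<in> set pts7" using pt by metis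
    note simps = B[OF st] B[OF st(2,1)] bv_collinear[OF st] bv_eq_iff
    show "card {z. ?A x z \<and> ?A z y} = (if x = y then 6 else if ?A x y then 1 else if B x y \<or> B y x then 0 else 1)"
      unfolding x y simps by (rule cnt[OF count7_AA st]) (use bv_collinear st in blast)
    show "card {z. ?A x z \<and> B z y} = (if x = y \<or> ?A x y \<or> B x y then 0 else if B y x then 3 else 2)"
      unfolding x y simps by (rule cnt[OF count7_AB st]) (use B st in blast)
    show "card {z. ?A x z \<and> B y z} = (if x = y \<or> ?A x y \<or> B y x then 0 else if B x y then 3 else 2)"
      unfolding x y simps by (rule cnt[OF count7_AC st, where R = "\<lambda>z y. B y z"]) (use B st in blast)
  qed
  then show ?thesis by blast
qed

lemma H2_fission_exists:
  "\<exists>F. H2_fission_scheme F \<and> is_first_eigenmatrix H2_points 4 F P_matrix"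
proof -
  obtain B where "signed_hexagon H2_points (\<lambda>x y. (x, y) \<in> H2_collinear) B" using H2_hexagon by blast
  then interpret signed_hexagon H2_points "\<lambda>x y. (x, y) \<in> H2_collinear" B .
  have "rel 4 = (rel 2)\<inverse>" by (auto simp: rel_def)
  then have "H2_fission_scheme rel"
    using hexagon_scheme collinearity_distances unfolding H2_fission_scheme_def by simp
  then show ?thesis using hexagon_eigenmatrix by blast
qed

text \<open>Covers every fission, not just the one constructed from the explicit sign: the latter
  only provides the ambient signed hexagon.\<close>

lemma H2_fission_hexagon:
  assumes "H2_fission_scheme F"
  shows "signed_hexagon H2_points (\<lambda>x y. (x, y) \<in> F 1) (\<lambda>x y. (x, y) \<in> F 2)" "(F 2)\<inverse> = F 4"
    "assoc_scheme H2_points 4 F"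
proof -
  obtain B where "signed_hexagon H2_points (\<lambda>x y. (x, y) \<in> H2_collinear) B" using H2_hexagon by blast
  then interpret signed_hexagon H2_points "\<lambda>x y. (x, y) \<in> H2_collinear" B .
  have F: "commutative_assoc_scheme H2_points 4 F" "F 1 = H2_distance 1" "F 2 \<union> F 4 = H2_distance 3" "F 4 = (F 2)\<inverse>"
    using assms unfolding H2_fission_scheme_def by blast+
  have "F 1 = {(x, y). (x, y) \<in> H2_collinear}"
    using F(2) collinearity_distances(2) by (simp add: rel_def)
  moreover have "F 2 \<union> F 4 = {(x, y). opp x y}"
    using F(3) collinearity_distances(4) by (auto simp: rel_def opp_def)
  ultimately show "signed_hexagon H2_points (\<lambda>x y. (x, y) \<in> F 1) (\<lambda>x y. (x, y) \<in> F 2)"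
    by (rule fission_signed_hexagon[OF F(1) _ _ F(4)])
  show "(F 2)\<inverse> = F 4" using F(4) by simp
  show "assoc_scheme H2_points 4 F" using F(1) by (rule commutative_assoc_scheme.axioms(1))
qed

theorem theorem6p3:
  shows "(\<forall>(X :: 'a set) S (Y :: 'b set) T.
            commutative_assoc_scheme X 4 S \<and> is_first_eigenmatrix X 4 S P_matrix \<and>
            commutative_assoc_scheme Y 4 T \<and> is_first_eigenmatrix Y 4 T P_matrix \<longrightarrow>
            isomorphic_schemes 4 X S Y T) \<and>
         (\<exists>F. H2_fission_scheme F \<and> is_first_eigenmatrix H2_points 4 F P_matrix) \<and>
         (\<forall>(X :: 'a set) S F.
            commutative_assoc_scheme X 4 S \<and> is_first_eigenmatrix X 4 S P_matrix \<and>
            H2_fission_scheme F \<longrightarrow>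
            isomorphic_schemes 4 X S H2_points F)"
proof (intro conjI allI impI)
  fix X :: "'a set" and S and Y :: "'b set" and T
  assume "commutative_assoc_scheme X 4 S \<and> is_first_eigenmatrix X 4 S P_matrix \<and>
    commutative_assoc_scheme Y 4 T \<and> is_first_eigenmatrix Y 4 T P_matrix"
  then show "isomorphic_schemes 4 X S Y T"
    by (elim conjE) (rule scheme_isomorphic; simp add: commutative_assoc_scheme.axioms(1) eigenmatrix_signed_hexagon del: One_nat_def)
next
  show "\<exists>F. H2_fission_scheme F \<and> is_first_eigenmatrix H2_points 4 F P_matrix" by (rule H2_fission_exists)
next
  fix X :: "'a set" and S F
  assume "commutative_assoc_scheme X 4 S \<and> is_first_eigenmatrix X 4 S P_matrix \<and> H2_fission_scheme F"
  then show "isomorphic_schemes 4 X S H2_points F"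
    by (elim conjE) (rule scheme_isomorphic;
        simp add: commutative_assoc_scheme.axioms(1) eigenmatrix_signed_hexagon H2_fission_hexagon del: One_nat_def)
qed

end
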